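(* Let $d=d(n)$ be a sequence of integers with $d(n)\to\infty$ and $\log d(n)/\log n\to0$ as $n\to\infty$ (with $nd$ even). Let $P\sim\mathcal P_{n,d}$. Then $$\frac{\log H_n(P)-\log\mathbb E\,H_n(P)}{\sqrt{2/d}}\ \Rightarrow\ N(0,1)$$ (convergence in distribution to a standard normal).
   Context: Configuration model $\mathcal P_{n,d}$ ($nd$ even): $nd$ prevertices are partitioned into $n$ bins of size $d$, and $\mathcal P_{n,d}$ is the uniform law on perfect matchings ("pairings") of the $nd$ prevertices. The projection of a pairing is the $d$-regular pseudograph on $n$ vertices obtained by identifying all prevertices in each bin and keeping every pair as an edge. For a pairing $P$, $H_n(P)$ is the number of Hamiltonian cycles in its projection (collections of $n$ pairs of $P$ projecting to a cycle through all $n$ vertices). Convention: $\log 0=-\infty$. *)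

theory Defs
  imports "HOL-Probability.Probability"
begin

text \<open>
  The prevertex \<open>(v, i)\<close> is the \<open>i\<close>-th element of bin \<open>v\<close>, so that projecting to
  the vertex set \<open>{..<n}\<close> is \<open>fst\<close>.
\<close>

definition prevertices :: "nat \<Rightarrow> nat \<Rightarrow> (nat \<times> nat) set" where
  "prevertices n d = {..<n} \<times> {..<d}"

definition pairings :: "nat \<Rightarrow> nat \<Rightarrow> (nat \<times> nat) set set set" where
  "pairings n d = {P. partition_on (prevertices n d) P \<and> (\<forall>e\<in>P. card e = 2)}"

text \<open>
  The set of pairings is finite, and it is nonempty iff \<open>n * d\<close> is even; \<open>pmf_of_set\<close> is
  meaningful only in that case.
\<close>

definition config_model :: "nat \<Rightarrow> nat \<Rightarrow> (nat \<times> nat) set set pmf" where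
  "config_model n d = pmf_of_set (pairings n d)"

text \<open>
  The projection of a pairing \<open>P\<close> is the pseudograph on \<open>{..<n}\<close> whose edges are the elements
  of \<open>P\<close>, the edge \<open>e\<close> having the set of endpoints below (a singleton if \<open>e\<close> is a loop).
  Parallel edges are distinct elements of \<open>P\<close>.
\<close>

definition endpoints :: "(nat \<times> nat) set \<Rightarrow> nat set" where
  "endpoints e = fst ` e"

text \<open>
  \<open>v\<close> lists the vertices and \<open>c\<close> the edges in their order along the cycle. The cycle itself is
  the set \<open>C\<close> of pairs, so it carries neither a starting point nor an orientation.
  For \<open>n = 1\<close> it is a loop, for \<open>n = 2\<close> two parallel edges.
\<close>

definition projects_to_ham_cycle :: "nat \<Rightarrow> (nat \<times> nat) set set \<Rightarrow> bool" where
  "projects_to_ham_cycle n C \<longleftrightarrow>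
     (\<exists>v c. bij_betw v {..<n} {..<n} \<and> bij_betw c {..<n} C \<and>
        (\<forall>i<n. endpoints (c i) = {v i, v (Suc i mod n)}))"

definition ham_count :: "nat \<Rightarrow> (nat \<times> nat) set set \<Rightarrow> nat" where
  "ham_count n P = card {C. C \<subseteq> P \<and> card C = n \<and> projects_to_ham_cycle n C}"

definition expected_ham_count :: "nat \<Rightarrow> nat \<Rightarrow> real" where
  "expected_ham_count n d =
     measure_pmf.expectation (config_model n d) (\<lambda>P. real (ham_count n P))"

text \<open>The logarithm of a nonnegative real, with the convention that the logarithm of 0 is \<open>-\<infinity>\<close>.\<close>

definition log_ereal :: "real \<Rightarrow> ereal" where
  "log_ereal x = (if x = 0 then -\<infinity> else ereal (ln x))"

text \<open>
  Convergence in distribution, as in \<^const>\<open>weak_conv_m\<close>, except that the converging laws may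
  charge \<open>-\<infinity>\<close> and \<open>\<infinity>\<close>. The limit is a law on the reals, so pointwise convergence of the
  distribution functions at its finite continuity points forces those masses to vanish.
\<close>

definition weak_conv_ereal :: "(nat \<Rightarrow> ereal measure) \<Rightarrow> real measure \<Rightarrow> bool" where
  "weak_conv_ereal M_seq M \<longleftrightarrow>
     weak_conv (\<lambda>n x. measure (M_seq n) {..ereal x}) (cdf M)"

end

(*
A Hamiltonian cycle of a random pairing misses every loop, and when d grows the number L of loops is
what makes the number H of Hamiltonian cycles fluctuate. Fixing a cycle removes two prevertices from
each bin, so that the covariance of H / E H and L tends to -1, while Var L is asymptotic to d / 2. If
moreover E H^2 / (E H)^2 <= 1 + (2 + o(1)) / d, then H / E H - 1 + (2 / d) (L - E L) has second moment
o(1 / d). The loop count is asymptotically Poisson with mean growing like d / 2, hence asymptotically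
normal, and the logarithm of H / E H inherits the central limit theorem.

For the second moment, the pairs of Hamiltonian cycles are counted according to their common edges: a
cycle containing prescribed edges is a cyclic arrangement of the paths that they form. The sum over the
sets of common edges is the trace of a power of a 2 x 2 transfer matrix, and the remaining weights are
moments of a Beta distribution with parameters n and (n (d - 2) + 1) / 2. So the ratio of the moments is
an expectation of rho(U)^n, where rho is explicit, rho(2 / d) = 1 and rho'(2 / d) = 0, and only the
variance of U and large deviation bounds for U are needed.
*)

theory Submission
  imports Defs "HOL-Real_Asymp.Real_Asymp"
begin

section \<open>Perfect matchings\<close>

text \<open>Cycles are counted as rounds, which carry a starting point and an orientation: a list of
  visits has no symmetry to divide out, and its number is a product. Only upper bounds for the
  second and mixed moments are proved. They suffice because what they bound, the second moment of a
  residual, is nonnegative; so rounds with prescribed common edges need only be injected into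
  arrangements of contracted paths.

  The Beta integral is singular at u = 0, where the term with j common edges carries u^(- j). It is
  therefore taken over the terms with j at most n / 4, and larger overlaps are bounded by
  factorials. Near u = 2 / d the estimate must be exact in the order 1 / d, since this order cancels
  against the loops; elsewhere a bound exponentially small in n is good enough, because it still
  vanishes after multiplication by d / 2 when d is at most n.

  The mean of the loop count diverges, so its law is compared with a Poisson law whose mean depends
  on n. A random switching gives an approximate differential equation for the characteristic
  function, with a relative error of order 1 / n.\<close>

definition matching :: "'a set set \<Rightarrow> bool" where
  "matching F \<longleftrightarrow> disjoint F \<and> (\<forall>e\<in>F. card e = 2)"

definition perfect_matchings :: "'a set \<Rightarrow> 'a set set set" where
  "perfect_matchings X = {P. partition_on X P \<and> (\<forall>e\<in>P. card e = 2)}"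

lemma perfect_matchings_altdef: "perfect_matchings X = {P. matching P \<and> \<Union>P = X}"
  unfolding perfect_matchings_def matching_def partition_on_def by auto

lemma pairings_eq: "pairings n d = perfect_matchings (prevertices n d)"
  by (simp add: pairings_def perfect_matchings_def)

lemma finite_perfect_matchings: "finite X \<Longrightarrow> finite (perfect_matchings X)"
  by (rule finite_subset[of _ "Pow (Pow X)"]) (auto simp: perfect_matchings_altdef)

lemma matching_subset: "matching F \<Longrightarrow> G \<subseteq> F \<Longrightarrow> matching G"
  unfolding matching_def disjoint_def by blast

lemma matching_eqI: "matching F \<Longrightarrow> e \<in> F \<Longrightarrow> f \<in> F \<Longrightarrow> x \<in> e \<Longrightarrow> x \<in> f \<Longrightarrow> e = f"
  unfolding matching_def disjoint_def by blast

lemma matching_Un: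
  "matching F \<Longrightarrow> matching G \<Longrightarrow> \<Union>F \<inter> \<Union>G = {} \<Longrightarrow> matching (F \<union> G)"
  unfolding matching_def by (auto intro: disjoint_union)

lemma card_Union_matching:
  assumes "matching F"
  shows "card (\<Union>F) = 2 * card F"
proof -
  have "card (\<Union>F) = (\<Sum>e\<in>F. card e)"
    using assms by (intro card_Union_disjoint)
      (auto simp: matching_def intro: card_ge_0_finite)
  also have "\<dots> = 2 * card F"
    using assms by (simp add: matching_def)
  finally show ?thesis .
qed

text \<open>Deleting \<open>F\<close> is undone by adding it back, so for a given finite
  \<open>X\<close> the number of pairings that contain \<open>F\<close> depends on
  \<open>card F\<close> alone. All moments below rest on this.\<close>

lemma bij_betw_matchings_containing:
  assumes F: "matching F" and sub: "\<Union>F \<subseteq> X"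
  shows "bij_betw (\<lambda>Q. F \<union> Q) (perfect_matchings (X - \<Union>F)) {P \<in> perfect_matchings X. F \<subseteq> P}"
proof (rule bij_betw_byWitness[where f' = "\<lambda>P. P - F"])
  have ne: "{} \<notin> F" using F by (auto simp: matching_def)
  show "\<forall>Q\<in>perfect_matchings (X - \<Union> F). F \<union> Q - F = Q"
  proof
    fix Q assume "Q \<in> perfect_matchings (X - \<Union>F)"
    then have "\<Union>Q = X - \<Union>F"
      by (simp add: perfect_matchings_altdef)
    then have "e \<notin> F" if "e \<in> Q" for e
      using that ne by (metis DiffD2 UnionI equals0I)
    then show "F \<union> Q - F = Q" by auto
  qed
  show "\<forall>P\<in>{P \<in> perfect_matchings X. F \<subseteq> P}. F \<union> (P - F) = P" by auto
  show "(\<union>) F ` perfect_matchings (X - \<Union> F) \<subseteq> {P \<in> perfect_matchings X. F \<subseteq> P}"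
    using F sub by (auto simp: perfect_matchings_altdef intro!: matching_Un)
  show "(\<lambda>P. P - F) ` {P \<in> perfect_matchings X. F \<subseteq> P} \<subseteq> perfect_matchings (X - \<Union> F)"
  proof clarify
    fix P assume P: "P \<in> perfect_matchings X" "F \<subseteq> P"
    then have m: "matching P" and U: "\<Union>P = X" by (auto simp: perfect_matchings_altdef)
    have "\<Union>(P - F) = X - \<Union>F"
    proof (intro equalityI subsetI)
      fix x assume "x \<in> \<Union>(P - F)"
      then obtain e where e: "e \<in> P" "e \<notin> F" "x \<in> e" by blast
      then have "x \<notin> \<Union>F"
        using P(2) matching_eqI[OF m, of e _ x] by blast
      then show "x \<in> X - \<Union>F" using e U by blast
    next
      fix x assume "x \<in> X - \<Union>F"
      then show "x \<in> \<Union>(P - F)" using U by blast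
    qed
    then show "P - F \<in> perfect_matchings (X - \<Union>F)"
      using matching_subset[OF m] by (auto simp: perfect_matchings_altdef)
  qed
qed

text \<open>The double factorial (2 r - 1)!!, which is the number of perfect matchings of 2 r
  points.\<close>

definition odd_fact :: "nat \<Rightarrow> nat" where
  "odd_fact r = (\<Prod>i<r. 2 * i + 1)"

lemma odd_fact_0 [simp]: "odd_fact 0 = 1"
  by (simp add: odd_fact_def)

lemma odd_fact_Suc: "odd_fact (Suc r) = (2 * r + 1) * odd_fact r"
  by (simp add: odd_fact_def)

lemma odd_fact_pos [simp]: "odd_fact r > 0"
  by (simp add: odd_fact_def prod_pos)

lemma matching_containing_point:
  assumes "a \<in> X"
  shows "perfect_matchings X = (\<Union>y\<in>X - {a}. {P \<in> perfect_matchings X. {a, y} \<in> P})"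
proof -
  have "\<exists>y\<in>X - {a}. {a, y} \<in> P" if P: "P \<in> perfect_matchings X" for P
  proof -
    obtain e where e: "e \<in> P" "a \<in> e" using P assms by (auto simp: perfect_matchings_altdef)
    have "card e = 2" using P e by (simp add: perfect_matchings_altdef matching_def)
    then obtain y where y: "e = {a, y}" "y \<noteq> a"
      using e(2) unfolding card_2_iff by auto
    moreover have "e \<subseteq> X" using e P by (auto simp: perfect_matchings_altdef)
    ultimately show ?thesis using e by auto
  qed
  then show ?thesis by blast
qed

text \<open>Among 2 r + 2 points a fixed one has 2 r + 1 possible partners, and the remaining 2 r
  points are matched freely.\<close>

lemma card_perfect_matchings:
  "finite X \<Longrightarrow> card X = 2 * r \<Longrightarrow> card (perfect_matchings X) = odd_fact r"
proof (induction r arbitrary: X)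
  case 0
  then have "perfect_matchings X = {{}}"
    by (auto simp: perfect_matchings_altdef matching_def) (metis card.empty zero_neq_numeral)
  then show ?case by simp
next
  case (Suc r)
  then obtain a where a: "a \<in> X" by fastforce
  have one: "card {P \<in> perfect_matchings X. {a, y} \<in> P} = odd_fact r" if y: "y \<in> X - {a}" for y
  proof -
    have "matching {{a, y}}" using y by (auto simp: matching_def card_2_iff)
    then have "card {P \<in> perfect_matchings X. {{a, y}} \<subseteq> P} = card (perfect_matchings (X - {a, y}))"
      using bij_betw_same_card[OF bij_betw_matchings_containing[of "{{a,y}}" X]] y a by simp
    moreover have "card (X - {a, y}) = 2 * r"
      using Suc.prems a y by (auto simp: card_Diff_subset card_insert_if)
    ultimately show ?thesis using Suc.IH[of "X - {a, y}"] Suc.prems by simp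
  qed
  have "card (perfect_matchings X)
      = card (\<Union>y\<in>X - {a}. {P \<in> perfect_matchings X. {a, y} \<in> P})"
    using matching_containing_point[OF a] by simp
  also have "\<dots> = (\<Sum>y\<in>X - {a}. card {P \<in> perfect_matchings X. {a, y} \<in> P})"
  proof (rule card_UN_disjoint)
    show "\<forall>i\<in>X - {a}. \<forall>j\<in>X - {a}. i \<noteq> j \<longrightarrow>
       {P \<in> perfect_matchings X. {a, i} \<in> P} \<inter> {P \<in> perfect_matchings X. {a, j} \<in> P} = {}"
    proof (intro ballI impI)
      fix i j assume ij: "i \<in> X - {a}" "j \<in> X - {a}" "i \<noteq> j"
      have False if "P \<in> perfect_matchings X" "{a, i} \<in> P" "{a, j} \<in> P" for P
      proof -
        have "{a, i} = {a, j}"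
          using that by (intro matching_eqI[of P _ _ a]) (auto simp: perfect_matchings_altdef)
        then show False using ij by (auto simp: doubleton_eq_iff)
      qed
      then show "{P \<in> perfect_matchings X. {a, i} \<in> P} \<inter> {P \<in> perfect_matchings X. {a, j} \<in> P} = {}"
        by blast
    qed
  qed (use Suc.prems finite_perfect_matchings[of X] in auto)
  also have "\<dots> = (2 * r + 1) * odd_fact r"
    using one Suc.prems a by simp
  finally show ?case by (simp add: odd_fact_Suc)
qed

lemma card_matchings_containing:
  assumes "finite X" "card X = 2 * r" "matching F" "\<Union>F \<subseteq> X"
  shows "card {P \<in> perfect_matchings X. F \<subseteq> P} = odd_fact (r - card F)"
proof -
  have fin: "finite (\<Union>F)" using assms finite_subset by blast
  have "card (X - \<Union>F) = 2 * (r - card F)"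
    using assms fin card_Union_matching[of F] by (simp add: card_Diff_subset)
  then show ?thesis
    using bij_betw_same_card[OF bij_betw_matchings_containing[OF assms(3,4)]]
      card_perfect_matchings[of "X - \<Union>F" "r - card F"] assms(1) by simp
qed

lemma card_prevertices: "card (prevertices n d) = n * d" "finite (prevertices n d)"
  by (simp_all add: prevertices_def)

lemma card_pairings: "n * d = 2 * r \<Longrightarrow> card (pairings n d) = odd_fact r"
  using card_perfect_matchings[of "prevertices n d" r] by (simp add: pairings_eq card_prevertices)

lemma finite_pairings: "finite (pairings n d)"
  by (simp add: pairings_eq finite_perfect_matchings card_prevertices)

lemma pairings_nonempty: "even (n * d) \<Longrightarrow> pairings n d \<noteq> {}"
  using card_pairings[of n d "n * d div 2"] odd_fact_pos[of "n * d div 2"] by (auto simp del: odd_fact_pos)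

lemma expectation_config_model:
  "even (n * d) \<Longrightarrow> measure_pmf.expectation (config_model n d) f
     = (\<Sum>P\<in>pairings n d. f P) / real (card (pairings n d))"
  unfolding config_model_def by (rule integral_pmf_of_set[OF pairings_nonempty finite_pairings])

section \<open>Rounds through all vertices\<close>

text \<open>Serves twice: for rounds, whose blocks are the vertices, and for contracted rounds,
  whose blocks are the paths of common edges. The induction splits by the block of the first token;
  the hypothesis on \<open>blk\<close> makes the token sets of different blocks disjoint.\<close>

lemma card_token_lists:
  fixes W :: "'v \<Rightarrow> 't set" and blk :: "'t \<Rightarrow> 'v"
  assumes "finite V" "\<And>v. v \<in> V \<Longrightarrow> finite (W v)" "\<And>v t. v \<in> V \<Longrightarrow> t \<in> W v \<Longrightarrow> blk t = v"
  shows "finite {ts. distinct (map blk ts) \<and> blk ` set ts = V \<and> (\<forall>t\<in>set ts. t \<in> W (blk t))} \<and>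
    card {ts. distinct (map blk ts) \<and> blk ` set ts = V \<and> (\<forall>t\<in>set ts. t \<in> W (blk t))}
      = fact (card V) * (\<Prod>v\<in>V. card (W v))"
  using assms
proof (induction "card V" arbitrary: V)
  case 0
  then have "{ts. distinct (map blk ts) \<and> blk ` set ts = V \<and> (\<forall>t\<in>set ts. t \<in> W (blk t))} = {[]}"
    by auto
  then show ?case using 0 by simp
next
  case (Suc m)
  define T where "T V = {ts. distinct (map blk ts) \<and> blk ` set ts = V \<and> (\<forall>t\<in>set ts. t \<in> W (blk t))}" for V
  have IH: "finite (T (V - {v})) \<and> card (T (V - {v})) = fact m * (\<Prod>v\<in>V - {v}. card (W v))" if "v \<in> V" for v
  proof -
    have "m = card (V - {v})" using Suc that by simp
    then show ?thesis
      using Suc.hyps(1)[of "V - {v}"] Suc.prems unfolding T_def by auto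
  qed
  have eq: "T V = (\<Union>v\<in>V. (\<lambda>(t, ts). t # ts) ` (W v \<times> T (V - {v})))"
  proof (intro equalityI subsetI)
    fix ts assume ts: "ts \<in> T V"
    have "V \<noteq> {}" using Suc by auto
    then obtain t ts' where [simp]: "ts = t # ts'" using ts by (cases ts) (auto simp: T_def)
    have "blk t \<in> V" "t \<in> W (blk t)" "ts' \<in> T (V - {blk t})"
      using ts by (auto simp: T_def) (metis rev_image_eqI)
    then show "ts \<in> (\<Union>v\<in>V. (\<lambda>(t, ts). t # ts) ` (W v \<times> T (V - {v})))" by force
  next
    fix ts assume "ts \<in> (\<Union>v\<in>V. (\<lambda>(t, ts). t # ts) ` (W v \<times> T (V - {v})))"
    then obtain v t ts' where *: "v \<in> V" "t \<in> W v" "ts' \<in> T (V - {v})" "ts = t # ts'" by auto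
    have "blk t = v" using Suc.prems * by auto
    then show "ts \<in> T V" using * by (auto simp: T_def)
  qed
  have one: "finite ((\<lambda>(t, ts). t # ts) ` (W v \<times> T (V - {v})))"
      "card ((\<lambda>(t, ts). t # ts) ` (W v \<times> T (V - {v}))) = fact m * (\<Prod>v\<in>V. card (W v))"
    if "v \<in> V" for v
  proof -
    show "finite ((\<lambda>(t, ts). t # ts) ` (W v \<times> T (V - {v})))"
      using IH[OF that] Suc.prems that by auto
    have "card ((\<lambda>(t, ts). t # ts) ` (W v \<times> T (V - {v}))) = card (W v) * card (T (V - {v}))"
      by (subst card_image) (auto simp: inj_on_def card_cartesian_product)
    also have "\<dots> = fact m * (\<Prod>v\<in>V. card (W v))"
      using IH[OF that] prod.remove[OF Suc.prems(1) that, of "\<lambda>v. card (W v)"] by simp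
    finally show "card ((\<lambda>(t, ts). t # ts) ` (W v \<times> T (V - {v}))) = fact m * (\<Prod>v\<in>V. card (W v))" .
  qed
  have "card (T V) = (\<Sum>v\<in>V. card ((\<lambda>(t, ts). t # ts) ` (W v \<times> T (V - {v}))))"
    unfolding eq
  proof (rule card_UN_disjoint)
    show "\<forall>i\<in>V. \<forall>j\<in>V. i \<noteq> j \<longrightarrow> (\<lambda>(t, ts). t # ts) ` (W i \<times> T (V - {i}))
        \<inter> (\<lambda>(t, ts). t # ts) ` (W j \<times> T (V - {j})) = {}"
    proof (intro ballI impI)
      fix i j assume ij: "i \<in> V" "j \<in> V" "i \<noteq> j"
      have "W i \<inter> W j = {}" using Suc.prems(3)[OF ij(1)] Suc.prems(3)[OF ij(2)] ij(3) by auto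
      then show "(\<lambda>(t, ts). t # ts) ` (W i \<times> T (V - {i}))
        \<inter> (\<lambda>(t, ts). t # ts) ` (W j \<times> T (V - {j})) = {}" by auto
    qed
  qed (use one(1) Suc.prems(1) in blast)+
  also have "\<dots> = fact (Suc m) * (\<Prod>v\<in>V. card (W v))"
    using one(2) by (simp add: Suc.hyps(2)[symmetric] algebra_simps)
  finally have "card (T V) = fact (Suc m) * (\<Prod>v\<in>V. card (W v))" .
  moreover have "finite (T V)" unfolding eq using one(1) Suc.prems by blast
  ultimately show ?case using Suc.hyps(2) unfolding T_def by simp
qed

section \<open>Hamiltonian cycles as cyclic lists of visits\<close>

type_synonym prevertex = "nat \<times> nat"

definition bin_tokens :: "nat \<Rightarrow> nat \<Rightarrow> (prevertex \<times> prevertex) set" where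
  "bin_tokens d v = {(p, q). fst p = v \<and> fst q = v \<and> p \<noteq> q \<and> snd p < d \<and> snd q < d}"

text \<open>A Hamiltonian cycle with a chosen starting vertex and orientation. No condition links
  the prevertices of consecutive visits, so the visits can be chosen independently once the order of
  the vertices is fixed.\<close>

definition rounds :: "nat \<Rightarrow> nat \<Rightarrow> (prevertex \<times> prevertex) list set" where
  "rounds n d = {ws. distinct (map (fst \<circ> fst) ws) \<and> (fst \<circ> fst) ` set ws = {..<n} \<and>
     (\<forall>w\<in>set ws. w \<in> bin_tokens d ((fst \<circ> fst) w))}"

lemma card_bin_tokens: "finite (bin_tokens d v)" "card (bin_tokens d v) = d * (d - 1)"
proof -
  have eq: "bin_tokens d v = (\<lambda>(i, j). ((v, i), (v, j))) ` (SIGMA i:{..<d}. {..<d} - {i})"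
    by (auto simp: bin_tokens_def image_iff)
  show "finite (bin_tokens d v)" unfolding eq by auto
  have "card (bin_tokens d v) = card (SIGMA i:{..<d}. {..<d} - {i})"
    unfolding eq by (intro card_image) (auto simp: inj_on_def)
  also have "\<dots> = d * (d - 1)" by simp
  finally show "card (bin_tokens d v) = d * (d - 1)" .
qed

lemma bin_tokens_blk: "w \<in> bin_tokens d v \<Longrightarrow> (fst \<circ> fst) w = v"
  unfolding bin_tokens_def by (cases w) auto

lemma finite_rounds: "finite (rounds n d)"
  and card_rounds: "card (rounds n d) = fact n * (d * (d - 1)) ^ n"
proof -
  have *: "finite (rounds n d) \<and> card (rounds n d) = fact (card {..<n}) * (\<Prod>v<n. card (bin_tokens d v))"
    unfolding rounds_def
    by (rule card_token_lists) (use card_bin_tokens(1) bin_tokens_blk in blast)+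
  show "finite (rounds n d)" using * by blast
  show "card (rounds n d) = fact n * (d * (d - 1)) ^ n"
    using * by (simp add: card_bin_tokens(2))
qed

lemma length_rounds: "ws \<in> rounds n d \<Longrightarrow> length ws = n"
proof -
  assume "ws \<in> rounds n d"
  then have "distinct (map (fst \<circ> fst) ws)" and "set (map (fst \<circ> fst) ws) = {..<n}"
    unfolding rounds_def set_map by blast+
  then show "length ws = n"
    using distinct_card[of "map (fst \<circ> fst) ws"] by simp
qed

text \<open>The entry \<open>(p, q)\<close> of a round is a visit to a vertex, entered at \<open>p\<close> and left at \<open>q\<close>.\<close>

definition round_edges :: "(prevertex \<times> prevertex) list \<Rightarrow> prevertex set set" where
  "round_edges ws = (\<lambda>(x, y). {snd x, fst y}) ` set (zip ws (rotate1 ws))"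

definition round_points :: "(prevertex \<times> prevertex) list \<Rightarrow> prevertex set" where
  "round_points ws = fst ` set ws \<union> snd ` set ws"

lemma set_zip_rotate1: "set (zip ws (rotate1 ws)) = {(ws ! i, ws ! (Suc i mod length ws)) |i. i < length ws}"
  by (auto simp: set_zip nth_rotate1)

lemma round_edges_nth:
  "round_edges ws = {{snd (ws ! i), fst (ws ! (Suc i mod length ws))} |i. i < length ws}"
  unfolding round_edges_def set_zip_rotate1 by auto

lemma zip_rotate1: "length xs = length ys \<Longrightarrow> zip (rotate1 xs) (rotate1 ys) = rotate1 (zip xs ys)"
  by (cases xs; cases ys) auto

lemma round_edges_rotate1: "round_edges (rotate1 ws) = round_edges ws"
  by (simp add: round_edges_def zip_rotate1)

lemma round_edges_rotate: "round_edges (rotate k ws) = round_edges ws"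
  by (induction k) (simp_all add: round_edges_rotate1)

lemma rounds_rotate: "ws \<in> rounds n d \<Longrightarrow> rotate k ws \<in> rounds n d"
  by (auto simp: rounds_def rotate_map[symmetric])

lemma rounds_token:
  assumes "ws \<in> rounds n d" "w \<in> set ws"
  shows "fst (snd w) = fst (fst w)" "fst w \<noteq> snd w" "fst w \<in> prevertices n d" "snd w \<in> prevertices n d"
proof -
  have t: "w \<in> bin_tokens d (fst (fst w))" and "(fst \<circ> fst) w \<in> {..<n}"
    using assms unfolding rounds_def by auto
  then have v: "fst (fst w) < n" by simp
  obtain a b c e where w: "w = ((a, b), (c, e))" by (metis surj_pair)
  show "fst (snd w) = fst (fst w)" "fst w \<noteq> snd w" "fst w \<in> prevertices n d" "snd w \<in> prevertices n d"
    using t v unfolding w by (auto simp: bin_tokens_def prevertices_def)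
qed

lemma round_points_rounds: "ws \<in> rounds n d \<Longrightarrow> round_points ws \<subseteq> prevertices n d"
  using rounds_token(3,4) unfolding round_points_def by blast

lemma Union_round_edges: "\<Union>(round_edges ws) = round_points ws"
proof -
  have "\<Union>(round_edges ws) = snd ` fst ` set (zip ws (rotate1 ws)) \<union> fst ` snd ` set (zip ws (rotate1 ws))"
    unfolding round_edges_def by force
  also have "fst ` set (zip ws (rotate1 ws)) = set ws" 
    by (simp flip: set_map)
  also have "snd ` set (zip ws (rotate1 ws)) = set ws" 
    by (subst set_map[symmetric]) (simp add: map_snd_zip)
  finally show ?thesis by (auto simp: round_points_def)
qed

lemma rounds_bin_inj:
  assumes "ws \<in> rounds n d" "i < n" "j < n" "fst (fst (ws ! i)) = fst (fst (ws ! j))"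
  shows "i = j"
proof -
  have "distinct (map (fst \<circ> fst) ws)" using assms(1) unfolding rounds_def by blast
  moreover have "length ws = n" using length_rounds assms(1) by blast
  ultimately show ?thesis
    using assms nth_eq_iff_index_eq[of "map (fst \<circ> fst) ws" i j] by simp
qed

lemma rounds_nth_token:
  assumes "ws \<in> rounds n d" "i < n"
  shows "fst (snd (ws ! i)) = fst (fst (ws ! i))" "fst (ws ! i) \<noteq> snd (ws ! i)"
  using rounds_token[OF assms(1), of "ws ! i"] assms length_rounds[OF assms(1)] by simp_all

lemma rounds_point_eq:
  assumes "ws \<in> rounds n d" "i < n" "j < n"
  shows "fst (ws ! i) = fst (ws ! j) \<longleftrightarrow> i = j" "snd (ws ! i) = snd (ws ! j) \<longleftrightarrow> i = j"
    "fst (ws ! i) \<noteq> snd (ws ! j)"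
  using rounds_bin_inj[OF assms] rounds_nth_token[OF assms(1,2)] rounds_nth_token[OF assms(1,3)]
  by metis+

lemma rounds_bin_points:
  assumes "ws \<in> rounds n d" "k < n" "x \<in> round_points ws" "fst x = fst (fst (ws ! k))"
  shows "x = fst (ws ! k) \<or> x = snd (ws ! k)"
proof -
  obtain j where j: "j < n" "x = fst (ws ! j) \<or> x = snd (ws ! j)"
  proof -
    obtain w where w: "w \<in> set ws" "x = fst w \<or> x = snd w"
      using assms(3) unfolding round_points_def by blast
    then obtain j where "j < n" "w = ws ! j"
      using length_rounds[OF assms(1)] unfolding in_set_conv_nth by blast
    then show ?thesis using that w by blast
  qed
  then have "fst (fst (ws ! j)) = fst (fst (ws ! k))"
    using rounds_nth_token(1)[OF assms(1) j(1)] assms(4) by metis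
  then have "j = k" using rounds_bin_inj[OF assms(1) j(1) assms(2)] by blast
  then show ?thesis using j by blast
qed

lemma Suc_mod_inj: "i < n \<Longrightarrow> j < n \<Longrightarrow> Suc i mod n = Suc j mod n \<Longrightarrow> i = j"
  by (auto simp: mod_Suc split: if_splits)

text \<open>A prevertex occurs only once in a round, as an entry or as an exit, and cyclic
  succession of positions is injective; so a prevertex lies on one edge only.\<close>

lemma round_edge_meet:
  assumes "ws \<in> rounds n d" "i < n" "j < n"
    and "x \<in> {snd (ws ! i), fst (ws ! (Suc i mod n))}" "x \<in> {snd (ws ! j), fst (ws ! (Suc j mod n))}"
  shows "i = j"
proof -
  have m: "Suc i mod n < n" "Suc j mod n < n" using assms(2) by simp_all
  show ?thesis
    using assms(4,5) rounds_point_eq[OF assms(1) m] rounds_point_eq[OF assms(1-3)]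
      rounds_point_eq(3)[OF assms(1) m(1) assms(3)] rounds_point_eq(3)[OF assms(1) m(2) assms(2)]
      Suc_mod_inj[OF assms(2,3)] by auto
qed

lemma round_edges_image:
  "ws \<in> rounds n d \<Longrightarrow>
    round_edges ws = (\<lambda>i. {snd (ws ! i), fst (ws ! (Suc i mod n))}) ` {..<n}"
  unfolding round_edges_nth using length_rounds[of ws n d] by auto

lemma inj_on_round_edge:
  assumes "ws \<in> rounds n d"
  shows "inj_on (\<lambda>i. {snd (ws ! i), fst (ws ! (Suc i mod n))}) {..<n}"
  by (rule inj_onI) (use round_edge_meet[OF assms] in blast)

lemma card_round_edges: "ws \<in> rounds n d \<Longrightarrow> card (round_edges ws) = n"
  using card_image[OF inj_on_round_edge, of ws n d] round_edges_image[of ws n d] by simp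

lemma finite_round_edges: "finite (round_edges ws)"
  by (simp add: round_edges_def)

lemma matching_round_edges:
  assumes "ws \<in> rounds n d"
  shows "matching (round_edges ws)"
  unfolding matching_def disjoint_def
proof (intro conjI ballI impI)
  fix e assume "e \<in> round_edges ws"
  then obtain i where i: "i < n" "e = {snd (ws ! i), fst (ws ! (Suc i mod n))}"
    using round_edges_image[OF assms] by auto
  then have "fst (ws ! (Suc i mod n)) \<noteq> snd (ws ! i)"
    using rounds_point_eq(3)[OF assms, of "Suc i mod n" i] by simp
  then show "card e = 2" using i by simp
next
  fix e f assume "e \<in> round_edges ws" "f \<in> round_edges ws" "e \<noteq> f"
  then obtain i j where ij: "i < n" "e = {snd (ws ! i), fst (ws ! (Suc i mod n))}"
      "j < n" "f = {snd (ws ! j), fst (ws ! (Suc j mod n))}"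
    using round_edges_image[OF assms] by auto
  have "x \<notin> f" if "x \<in> e" for x
    using round_edge_meet[OF assms ij(1,3), of x] that \<open>e \<noteq> f\<close> unfolding ij(2,4) by auto
  then show "e \<inter> f = {}" by blast
qed

lemma projects_round_edges:
  assumes "ws \<in> rounds n d"
  shows "projects_to_ham_cycle n (round_edges ws)"
proof -
  have l: "length ws = n" using length_rounds assms by blast
  let ?v = "\<lambda>i. fst (fst (ws ! i))" and ?c = "\<lambda>i. {snd (ws ! i), fst (ws ! (Suc i mod n))}"
  have "?v ` {..<n} = (fst \<circ> fst) ` set ws"
    using l by (auto simp: set_conv_nth)
  then have "?v ` {..<n} = {..<n}" using assms unfolding rounds_def by simp
  moreover have "inj_on ?v {..<n}"
    by (rule inj_onI) (use rounds_bin_inj[OF assms] in blast)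
  ultimately have "bij_betw ?v {..<n} {..<n}" by (simp add: bij_betw_def)
  moreover have "bij_betw ?c {..<n} (round_edges ws)"
    using inj_on_round_edge[OF assms] round_edges_image[OF assms] by (simp add: bij_betw_def)
  moreover have "\<forall>i<n. endpoints (?c i) = {?v i, ?v (Suc i mod n)}"
    using rounds_nth_token(1)[OF assms] by (simp add: endpoints_def)
  ultimately show ?thesis unfolding projects_to_ham_cycle_def
    by (intro exI[of _ ?v] exI[of _ ?c]) blast
qed

text \<open>\<open>(i + n - 1) mod n\<close> is the cyclic predecessor of \<open>i\<close>; adding
  \<open>n\<close> first avoids the truncated subtraction at 0.\<close>

lemma pred_mod:
  assumes "i < n"
  shows "Suc ((i + n - 1) mod n) mod n = i" "(Suc i mod n + n - 1) mod n = i" "(i + n - 1) mod n < n"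
proof -
  show "Suc ((i + n - 1) mod n) mod n = i"
    using assms by (cases i) (auto simp: mod_Suc)
  show "(Suc i mod n + n - 1) mod n = i"
    using assms by (cases "Suc i = n") auto
  show "(i + n - 1) mod n < n" using assms by simp
qed

lemma ham_cycle_round:
  assumes n: "n \<ge> 2" and P: "P \<in> pairings n d" and C: "C \<subseteq> P" "projects_to_ham_cycle n C"
  shows "\<exists>ws\<in>rounds n d. round_edges ws = C"
proof -
  obtain v c where v: "bij_betw v {..<n} {..<n}" and c: "bij_betw c {..<n} C"
    and vc: "\<And>i. i < n \<Longrightarrow> endpoints (c i) = {v i, v (Suc i mod n)}"
    using C(2) unfolding projects_to_ham_cycle_def by blast
  have m: "matching P" and UP: "\<Union>P = prevertices n d"
    using P by (auto simp: pairings_eq perfect_matchings_altdef)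
  have cP: "c i \<in> P" if "i < n" for i using c that C(1) by (auto simp: bij_betw_def)
  have "\<exists>x y. c i = {x, y} \<and> fst x = v i \<and> fst y = v (Suc i mod n)" if i: "i < n" for i
  proof -
    have "card (c i) = 2" using cP[OF i] m unfolding matching_def by blast
    then obtain x y where xy: "c i = {x, y}" unfolding card_2_iff by blast
    then have "{fst x, fst y} = {v i, v (Suc i mod n)}" using vc[OF i] by (simp add: endpoints_def)
    then consider "fst x = v i" "fst y = v (Suc i mod n)" | "fst y = v i" "fst x = v (Suc i mod n)"
      by (auto simp: doubleton_eq_iff)
    then show ?thesis using xy by cases (blast, metis insert_commute)
  qed
  then obtain q p' where qp: "\<And>i. i < n \<Longrightarrow> c i = {q i, p' i}" "\<And>i. i < n \<Longrightarrow> fst (q i) = v i"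
      "\<And>i. i < n \<Longrightarrow> fst (p' i) = v (Suc i mod n)"
    by metis
  \<comment> \<open>\<open>p'\<close> is indexed by the arriving edge. The entry at position i is
    the far end of the edge before it, hence the shift to the predecessor.\<close>
  define p where "p i = p' ((i + n - 1) mod n)" for i
  define ws where "ws = map (\<lambda>i. (p i, q i)) [0..<n]"
  have fp: "fst (p i) = v i" if "i < n" for i
    using qp(3)[of "(i + n - 1) mod n"] pred_mod[OF that] by (simp add: p_def)
  have pq: "p i \<noteq> q i" if i: "i < n" for i
  proof
    assume eq: "p i = q i"
    let ?j = "(i + n - 1) mod n"
    have "p i \<in> c ?j" using qp(1)[of ?j] pred_mod(3)[OF i] by (simp add: p_def)
    moreover have "p i \<in> c i" using qp(1)[OF i] eq by simp
    ultimately have "c ?j = c i"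
      using matching_eqI[OF m cP[OF pred_mod(3)[OF i]] cP[OF i]] by blast
    then have "?j = i" using c i pred_mod(3)[OF i] by (auto simp: bij_betw_def inj_on_def)
    \<comment> \<open>Here \<open>n \<ge> 2\<close> is used: a position then differs from its cyclic
      predecessor.\<close>
    then show False using i n pred_mod(1)[OF i] by (auto simp: mod_Suc split: if_splits)
  qed
  have cd: "x \<in> prevertices n d" if "i < n" "x \<in> c i" for i x
    using cP[OF that(1)] that(2) UP by blast
  have qn: "q i \<in> prevertices n d" if "i < n" for i using cd[OF that] qp(1)[OF that] by simp
  have pn: "p i \<in> prevertices n d" if "i < n" for i
    using cd[OF pred_mod(3)[OF that]] qp(1)[OF pred_mod(3)[OF that]] by (simp add: p_def)
  have l: "length ws = n" by (simp add: ws_def)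
  have tok: "(p i, q i) \<in> bin_tokens d (v i)" if "i < n" for i
    using fp[OF that] qp(2)[OF that] pq[OF that] pn[OF that] qn[OF that]
    unfolding bin_tokens_def prevertices_def by auto
  have "map (fst \<circ> fst) ws = map v [0..<n]"
    using fp by (simp add: ws_def)
  moreover have "distinct (map v [0..<n])"
    using v by (simp add: distinct_map bij_betw_def atLeast0LessThan)
  moreover have "v ` {..<n} = {..<n}" using v by (simp add: bij_betw_def)
  moreover have "(fst \<circ> fst) ` set ws = set (map (fst \<circ> fst) ws)" by (rule set_map[symmetric])
  moreover have "\<forall>w\<in>set ws. w \<in> bin_tokens d ((fst \<circ> fst) w)"
    using tok fp by (simp add: ws_def)
  ultimately have ws: "ws \<in> rounds n d" unfolding rounds_def by (simp add: atLeast0LessThan)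
  have "round_edges ws = c ` {..<n}"
    unfolding round_edges_image[OF ws]
  proof (rule image_cong[OF refl])
    fix i assume "i \<in> {..<n}"
    then have i: "i < n" by simp
    then have s: "Suc i mod n < n" by simp
    have "p (Suc i mod n) = p' i" using pred_mod(2)[OF i] by (simp add: p_def)
    then show "{snd (ws ! i), fst (ws ! (Suc i mod n))} = c i"
      using i s qp(1)[OF i] by (simp add: ws_def)
  qed
  then have "round_edges ws = C" using c by (simp add: bij_betw_def)
  then show ?thesis using ws by blast
qed

lemma rotate1_rev_rotate1: "rotate1 (rev (rotate1 ws)) = rev ws"
  by (cases ws) auto

definition reverse_round :: "(prevertex \<times> prevertex) list \<Rightarrow> (prevertex \<times> prevertex) list" where
  "reverse_round ws = map prod.swap (rev ws)"

text \<open>Going backwards exchanges entry and exit in each visit, so every edge is read from its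
  other end. The auxiliary list \<open>us\<close> starts one place further on, which aligns the
  pairs of neighbours in the reversed list with the reversed pairs of neighbours.\<close>

lemma round_edges_reverse: "round_edges (reverse_round ws) = round_edges ws"
proof -
  define us where "us = rev (rotate1 ws)"
  have r: "rotate1 us = rev ws" by (simp add: us_def rotate1_rev_rotate1)
  have "round_edges (reverse_round ws) = round_edges (rotate1 (map prod.swap us))"
    by (simp add: reverse_round_def rotate1_map r)
  also have "\<dots> = round_edges (map prod.swap us)" by (rule round_edges_rotate1)
  also have "\<dots> = (\<lambda>(x, y). {snd x, fst y}) ` set (zip (map prod.swap us) (map prod.swap (rev ws)))"
    by (simp add: round_edges_def rotate1_map r)
  also have "\<dots> = (\<lambda>(x, y). {fst x, snd y}) ` set (zip us (rev ws))"
    by (simp add: zip_map_map image_image case_prod_unfold)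
  also have "set (zip us (rev ws)) = set (zip (rotate1 ws) ws)"
    unfolding us_def by (simp add: zip_rev)
  also have "set (zip (rotate1 ws) ws) = (\<lambda>(x, y). (y, x)) ` set (zip ws (rotate1 ws))"
    by (subst zip_commute) simp
  finally show ?thesis
    by (simp add: round_edges_def image_image case_prod_unfold insert_commute)
qed

lemma bin_tokens_swap: "w \<in> bin_tokens d v \<Longrightarrow> prod.swap w \<in> bin_tokens d v"
  by (cases w) (auto simp: bin_tokens_def)

lemma rounds_reverse:
  assumes "ws \<in> rounds n d"
  shows "reverse_round ws \<in> rounds n d"
proof -
  have eq: "(fst \<circ> fst) (prod.swap w) = (fst \<circ> fst) w" if "w \<in> set ws" for w
    using rounds_token(1)[OF assms that] by simp
  have "map (fst \<circ> fst) (reverse_round ws) = rev (map (fst \<circ> fst) ws)"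
    using eq by (simp add: reverse_round_def rev_map)
  moreover have "distinct (map (fst \<circ> fst) ws)" "set (map (fst \<circ> fst) ws) = {..<n}"
    using assms unfolding rounds_def set_map by blast+
  ultimately have "distinct (map (fst \<circ> fst) (reverse_round ws))"
      "set (map (fst \<circ> fst) (reverse_round ws)) = {..<n}" by simp_all
  moreover have "w \<in> bin_tokens d ((fst \<circ> fst) w)" if w: "w \<in> set (reverse_round ws)" for w
  proof -
    obtain u where u: "u \<in> set ws" "w = prod.swap u" using w by (auto simp: reverse_round_def)
    then have "u \<in> bin_tokens d ((fst \<circ> fst) u)" using assms unfolding rounds_def by blast
    then show ?thesis using u eq[OF u(1)] bin_tokens_swap by metis
  qed
  ultimately show ?thesis unfolding rounds_def set_map by blast
qed

text \<open>The edges and the first exit force the whole walk: an exit lies on a single edge, whose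
  other end is the next entry, and a bin contains only two points of the round, so the entry forces
  the next exit.\<close>

lemma round_determined:
  assumes ws: "ws \<in> rounds n d" and ws': "ws' \<in> rounds n d"
    and E: "round_edges ws = round_edges ws'" and hd: "snd (ws ! 0) = snd (ws' ! 0)" "n > 0"
  shows "ws = ws'"
proof -
  have pts: "round_points ws = round_points ws'" using E Union_round_edges by metis
  have nxt: "fst (ws ! (Suc i mod n)) = fst (ws' ! (Suc i mod n))"
    if i: "i < n" and q: "snd (ws ! i) = snd (ws' ! i)" for i
  proof -
    let ?e = "\<lambda>ws. {snd (ws ! i), fst (ws ! (Suc i mod n))}"
    have "?e ws \<in> round_edges ws" "?e ws' \<in> round_edges ws"
      using round_edges_image[OF ws] round_edges_image[OF ws'] i E by auto
    then have "?e ws = ?e ws'"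
      using matching_eqI[OF matching_round_edges[OF ws]] q by blast
    moreover have "fst (ws ! (Suc i mod n)) \<noteq> snd (ws ! i)"
      using rounds_point_eq(3)[OF ws, of "Suc i mod n" i] i by simp
    ultimately show ?thesis using q by (auto simp: doubleton_eq_iff)
  qed
  have q: "snd (ws ! i) = snd (ws' ! i)" if "i < n" for i
    using that
  proof (induction i)
    case 0 then show ?case using hd by simp
  next
    case (Suc i)
    have p: "fst (ws ! Suc i) = fst (ws' ! Suc i)" using nxt[of i] Suc by simp
    have "snd (ws' ! Suc i) \<in> round_points ws'"
      using Suc.prems length_rounds[OF ws'] unfolding round_points_def by simp
    then have "snd (ws' ! Suc i) \<in> round_points ws" unfolding pts .
    moreover have "fst (snd (ws' ! Suc i)) = fst (fst (ws ! Suc i))"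
      using rounds_nth_token(1)[OF ws' Suc.prems] p by simp
    ultimately have "snd (ws' ! Suc i) = fst (ws ! Suc i) \<or> snd (ws' ! Suc i) = snd (ws ! Suc i)"
      using rounds_bin_points[OF ws Suc.prems] by blast
    then show ?case using p rounds_nth_token(2)[OF ws' Suc.prems] by metis
  qed
  have p: "fst (ws ! i) = fst (ws' ! i)" if "i < n" for i
    using nxt[of "(i + n - 1) mod n"] pred_mod[OF that] q by simp
  show ?thesis
    using p q length_rounds[OF ws] length_rounds[OF ws'] by (intro nth_equalityI prod_eqI) auto
qed

text \<open>By rotation and reversal any of the 2 n endpoints can become the first exit, and the
  first exit determines the round. The factor stands for n starting points and two
  orientations.\<close>

lemma card_rounds_same_edges:
  assumes ws0: "ws0 \<in> rounds n d" and n: "n > 0"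
  shows "card {ws \<in> rounds n d. round_edges ws = round_edges ws0} = 2 * n"
proof -
  let ?R = "{ws \<in> rounds n d. round_edges ws = round_edges ws0}"
  have reach: "snd w \<in> (\<lambda>ws. snd (ws ! 0)) ` ?R" if ws: "ws \<in> ?R" and w: "w \<in> set ws" for ws w
  proof -
    have "length ws = n" using ws length_rounds by blast
    then obtain k where k: "k < n" "w = ws ! k" using w by (metis in_set_conv_nth)
    have "rotate k ws \<in> ?R" using ws rounds_rotate round_edges_rotate by blast
    moreover have "rotate k ws ! 0 = w" using k \<open>length ws = n\<close> n by (simp add: nth_rotate)
    ultimately show ?thesis by blast
  qed
  have "bij_betw (\<lambda>ws. snd (ws ! 0)) ?R (round_points ws0)"
    unfolding bij_betw_def
  proof
    show "inj_on (\<lambda>ws. snd (ws ! 0)) ?R"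
      by (rule inj_onI) (use round_determined n in auto)
    show "(\<lambda>ws. snd (ws ! 0)) ` ?R = round_points ws0"
    proof (intro equalityI subsetI)
      fix x assume "x \<in> (\<lambda>ws. snd (ws ! 0)) ` ?R"
      then obtain ws where ws: "ws \<in> rounds n d" "round_edges ws = round_edges ws0" "x = snd (ws ! 0)"
        by blast
      then have "x \<in> round_points ws" using n length_rounds[OF ws(1)] by (simp add: round_points_def)
      then show "x \<in> round_points ws0" using ws(2) Union_round_edges by metis
    next
      fix x assume "x \<in> round_points ws0"
      then consider w where "w \<in> set ws0" "x = snd w" | w where "w \<in> set ws0" "x = fst w"
        unfolding round_points_def by blast
      then show "x \<in> (\<lambda>ws. snd (ws ! 0)) ` ?R"
      proof cases
        case 1
        then show ?thesis using reach[of ws0 w] ws0 by blast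
      next
        case 2
        then have "prod.swap w \<in> set (reverse_round ws0)" by (simp add: reverse_round_def)
        moreover have "reverse_round ws0 \<in> ?R"
          using ws0 rounds_reverse round_edges_reverse by blast
        ultimately show ?thesis using reach[of "reverse_round ws0" "prod.swap w"] 2 by simp
      qed
    qed
  qed
  then have "card ?R = card (round_points ws0)" by (rule bij_betw_same_card)
  also have "\<dots> = 2 * n"
    using card_Union_matching[OF matching_round_edges[OF ws0]] card_round_edges[OF ws0]
    by (simp add: Union_round_edges)
  finally show ?thesis .
qed

lemma card_rounds_in_pairing:
  assumes n: "n \<ge> 2" and P: "P \<in> pairings n d"
  shows "card {ws \<in> rounds n d. round_edges ws \<subseteq> P} = 2 * n * ham_count n P"
proof -
  let ?H = "{C. C \<subseteq> P \<and> card C = n \<and> projects_to_ham_cycle n C}"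
  have "\<Union>P = prevertices n d" using P by (simp add: pairings_eq perfect_matchings_altdef)
  then have "finite (\<Union>P)" by (simp add: card_prevertices)
  then have "finite P" by (rule finite_UnionD)
  then have fin: "finite ?H" by simp
  have eq: "{ws \<in> rounds n d. round_edges ws \<subseteq> P} = (\<Union>C\<in>?H. {ws \<in> rounds n d. round_edges ws = C})"
    using projects_round_edges card_round_edges by (intro equalityI subsetI) (simp, auto)
  have "card {ws \<in> rounds n d. round_edges ws \<subseteq> P} = (\<Sum>C\<in>?H. card {ws \<in> rounds n d. round_edges ws = C})"
    unfolding eq
  proof (rule card_UN_disjoint[OF fin])
    show "\<forall>C\<in>?H. finite {ws \<in> rounds n d. round_edges ws = C}"
      using finite_rounds by simp
  qed blast
  also have "\<dots> = (\<Sum>C\<in>?H. 2 * n)"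
  proof (rule sum.cong[OF refl])
    fix C assume "C \<in> ?H"
    then obtain ws0 where "ws0 \<in> rounds n d" "round_edges ws0 = C"
      using ham_cycle_round[OF n P] by blast
    then show "card {ws \<in> rounds n d. round_edges ws = C} = 2 * n"
      using card_rounds_same_edges[of ws0 n d] n by auto
  qed
  also have "\<dots> = 2 * n * ham_count n P" by (simp add: ham_count_def)
  finally show ?thesis .
qed

section \<open>Moments of the number of loops\<close>

lemma sum_card_swap:
  assumes "finite A" "finite B"
  shows "(\<Sum>b\<in>B. card {a \<in> A. R a b}) = (\<Sum>a\<in>A. card {b \<in> B. R a b})"
proof -
  have "(\<Sum>b\<in>B. card {a \<in> A. R a b}) = (\<Sum>b\<in>B. \<Sum>a\<in>A. if R a b then 1 else 0)"
    using assms by (simp add: sum.If_cases Int_def)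
  also have "\<dots> = (\<Sum>a\<in>A. \<Sum>b\<in>B. if R a b then 1 else 0)" by (rule sum.swap)
  also have "\<dots> = (\<Sum>a\<in>A. card {b \<in> B. R a b})"
    using assms by (simp add: sum.If_cases Int_def)
  finally show ?thesis .
qed

lemma matching_pairing: "P \<in> pairings n d \<Longrightarrow> matching P"
  by (simp add: pairings_eq perfect_matchings_altdef)

lemma card_pairings_containing:
  assumes "n * d = 2 * r" "matching F" "\<Union>F \<subseteq> prevertices n d"
  shows "card {P \<in> pairings n d. F \<subseteq> P} = odd_fact (r - card F)"
  using card_matchings_containing[of "prevertices n d" r F] assms by (simp add: pairings_eq card_prevertices)

lemma card_pairings_not_matching:
  assumes "\<not> matching F"
  shows "card {P \<in> pairings n d. F \<subseteq> P} = 0"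
proof -
  have "{P \<in> pairings n d. F \<subseteq> P} = {}"
    using assms matching_subset matching_pairing by blast
  then show ?thesis by (metis card.empty)
qed

definition round_count :: "nat \<Rightarrow> nat \<Rightarrow> prevertex set set \<Rightarrow> nat" where
  "round_count n d P = card {ws \<in> rounds n d. round_edges ws \<subseteq> P}"

lemma sum_round_count:
  assumes "n * d = 2 * r"
  shows "(\<Sum>P\<in>pairings n d. round_count n d P) = fact n * (d * (d - 1)) ^ n * odd_fact (r - n)"
proof -
  have "(\<Sum>P\<in>pairings n d. round_count n d P)
      = (\<Sum>ws\<in>rounds n d. card {P \<in> pairings n d. round_edges ws \<subseteq> P})"
    unfolding round_count_def by (rule sum_card_swap[OF finite_rounds finite_pairings])
  also have "\<dots> = (\<Sum>ws\<in>rounds n d. odd_fact (r - n))"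
  proof (rule sum.cong[OF refl])
    fix ws assume ws: "ws \<in> rounds n d"
    show "card {P \<in> pairings n d. round_edges ws \<subseteq> P} = odd_fact (r - n)"
      using card_pairings_containing[OF assms matching_round_edges[OF ws]]
        round_points_rounds[OF ws] card_round_edges[OF ws] by (simp add: Union_round_edges)
  qed
  also have "\<dots> = fact n * (d * (d - 1)) ^ n * odd_fact (r - n)"
    by (simp add: card_rounds)
  finally show ?thesis .
qed

definition loops :: "nat \<Rightarrow> nat \<Rightarrow> prevertex set set" where
  "loops n d = {e. card e = 2 \<and> (\<exists>v<n. e \<subseteq> {v} \<times> {..<d})}"

definition loop_count :: "nat \<Rightarrow> nat \<Rightarrow> prevertex set set \<Rightarrow> nat" where
  "loop_count n d P = card {e \<in> loops n d. e \<in> P}"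

text \<open>Stated for subsets of the bins because it counts both the set of all loops and the loops
  that avoid a given round.\<close>

lemma card_pairs_in_bins:
  fixes B :: "nat \<Rightarrow> prevertex set"
  assumes "\<And>v. v < n \<Longrightarrow> B v \<subseteq> {v} \<times> {..<d}"
  shows "finite {e. card e = 2 \<and> (\<exists>v<n. e \<subseteq> B v)}"
    "card {e. card e = 2 \<and> (\<exists>v<n. e \<subseteq> B v)} = (\<Sum>v<n. card (B v) choose 2)"
proof -
  have fin: "finite (B v)" if "v < n" for v
    using finite_subset[OF assms[OF that]] by simp
  have eq: "{e. card e = 2 \<and> (\<exists>v<n. e \<subseteq> B v)} = (\<Union>v\<in>{..<n}. {e. e \<subseteq> B v \<and> card e = 2})"
    by auto
  show "finite {e. card e = 2 \<and> (\<exists>v<n. e \<subseteq> B v)}" unfolding eq using fin by auto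
  have "card {e. card e = 2 \<and> (\<exists>v<n. e \<subseteq> B v)} = (\<Sum>v<n. card {e. e \<subseteq> B v \<and> card e = 2})"
    unfolding eq
  proof (rule card_UN_disjoint)
    show "\<forall>v\<in>{..<n}. finite {e. e \<subseteq> B v \<and> card e = 2}" using fin by simp
    show "\<forall>v\<in>{..<n}. \<forall>w\<in>{..<n}. v \<noteq> w \<longrightarrow>
        {e. e \<subseteq> B v \<and> card e = 2} \<inter> {e. e \<subseteq> B w \<and> card e = 2} = {}"
    proof (intro ballI impI)
      fix v w assume vw: "v \<in> {..<n}" "w \<in> {..<n}" "v \<noteq> w"
      then have "B v \<inter> B w = {}" using assms[of v] assms[of w] by auto
      then have "e = {}" if "e \<subseteq> B v" "e \<subseteq> B w" for e using le_infI[OF that] by simp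
      then show "{e. e \<subseteq> B v \<and> card e = 2} \<inter> {e. e \<subseteq> B w \<and> card e = 2} = {}"
      proof (intro equals0I)
        fix e assume e: "e \<in> {e. e \<subseteq> B v \<and> card e = 2} \<inter> {e. e \<subseteq> B w \<and> card e = 2}"
        then have "e = {}" using \<open>\<And>e. e \<subseteq> B v \<Longrightarrow> e \<subseteq> B w \<Longrightarrow> e = {}\<close>[of e] by simp
        then show False using e by simp
      qed
    qed
  qed simp
  also have "\<dots> = (\<Sum>v<n. card (B v) choose 2)"
    using fin by (simp add: n_subsets)
  finally show "card {e. card e = 2 \<and> (\<exists>v<n. e \<subseteq> B v)} = (\<Sum>v<n. card (B v) choose 2)" .
qed

lemma finite_loops: "finite (loops n d)"
  and card_loops: "card (loops n d) = n * (d choose 2)"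
  using card_pairs_in_bins[of n "\<lambda>v. {v} \<times> {..<d}" d] unfolding loops_def by (simp_all add: card_cartesian_product_singleton)

lemma loops_prevertices: "e \<in> loops n d \<Longrightarrow> e \<subseteq> prevertices n d"
  unfolding loops_def prevertices_def by fastforce

lemma matching_singleton: "card e = 2 \<Longrightarrow> matching {e}"
  by (simp add: matching_def)

lemma sum_loop_count:
  assumes "n * d = 2 * r"
  shows "(\<Sum>P\<in>pairings n d. loop_count n d P) = n * (d choose 2) * odd_fact (r - 1)"
proof -
  have "(\<Sum>P\<in>pairings n d. loop_count n d P)
      = (\<Sum>e\<in>loops n d. card {P \<in> pairings n d. e \<in> P})"
    unfolding loop_count_def by (rule sum_card_swap[OF finite_loops finite_pairings])
  also have "\<dots> = (\<Sum>e\<in>loops n d. odd_fact (r - 1))"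
  proof (rule sum.cong[OF refl])
    fix e assume e: "e \<in> loops n d"
    then have "matching {e}" by (simp add: loops_def matching_def)
    then show "card {P \<in> pairings n d. e \<in> P} = odd_fact (r - 1)"
      using card_pairings_containing[OF assms, of "{e}"] loops_prevertices[OF e] by simp
  qed
  also have "\<dots> = n * (d choose 2) * odd_fact (r - 1)" by (simp add: card_loops)
  finally show ?thesis .
qed

text \<open>In an ordered pair of loops, a repeated loop gives the first term and two disjoint loops
  the second; distinct loops that overlap lie in no common pairing. The second term is summed over
  all pairs, which only enlarges the bound.\<close>

lemma sum_loop_count_sq:
  assumes "n * d = 2 * r"
  shows "(\<Sum>P\<in>pairings n d. (loop_count n d P)\<^sup>2)
    \<le> n * (d choose 2) * odd_fact (r - 1) + (n * (d choose 2))\<^sup>2 * odd_fact (r - 2)"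
proof -
  let ?L = "loops n d"
  have sq: "(loop_count n d P)\<^sup>2 = card {z \<in> ?L \<times> ?L. fst z \<in> P \<and> snd z \<in> P}" for P
  proof -
    have "{z \<in> ?L \<times> ?L. fst z \<in> P \<and> snd z \<in> P} = {e \<in> ?L. e \<in> P} \<times> {e \<in> ?L. e \<in> P}" by auto
    then show ?thesis by (simp add: loop_count_def card_cartesian_product power2_eq_square)
  qed
  have "(\<Sum>P\<in>pairings n d. (loop_count n d P)\<^sup>2)
      = (\<Sum>z\<in>?L \<times> ?L. card {P \<in> pairings n d. fst z \<in> P \<and> snd z \<in> P})"
    unfolding sq using finite_loops finite_pairings by (intro sum_card_swap) auto
  also have "\<dots> \<le> (\<Sum>z\<in>?L \<times> ?L. (if fst z = snd z then odd_fact (r - 1) else 0) + odd_fact (r - 2))"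
  proof (rule sum_mono)
    fix z assume z: "z \<in> ?L \<times> ?L"
    then have e: "fst z \<in> ?L" "snd z \<in> ?L" by auto
    then have c: "card (fst z) = 2" "card (snd z) = 2" by (auto simp: loops_def)
    have eq: "{P \<in> pairings n d. fst z \<in> P \<and> snd z \<in> P} = {P \<in> pairings n d. {fst z, snd z} \<subseteq> P}"
      by auto
    have U: "\<Union>{fst z, snd z} \<subseteq> prevertices n d" using loops_prevertices[OF e(1)] loops_prevertices[OF e(2)] by simp
    show "card {P \<in> pairings n d. fst z \<in> P \<and> snd z \<in> P}
        \<le> (if fst z = snd z then odd_fact (r - 1) else 0) + odd_fact (r - 2)"
    proof (cases "matching {fst z, snd z}")
      case True
      then show ?thesis
        unfolding eq card_pairings_containing[OF assms True U] by (simp add: card_insert_if numeral_2_eq_2)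
    next
      case False
      then show ?thesis unfolding eq card_pairings_not_matching[OF False] by simp
    qed
  qed
  also have "\<dots> = n * (d choose 2) * odd_fact (r - 1) + (n * (d choose 2))\<^sup>2 * odd_fact (r - 2)"
  proof -
    have "{z \<in> ?L \<times> ?L. fst z = snd z} = (\<lambda>e. (e, e)) ` ?L" by auto
    then have "card {z \<in> ?L \<times> ?L. fst z = snd z} = card ?L"
      by (simp add: card_image inj_on_def)
    then show ?thesis
      using finite_loops[of n d] unfolding sum.distrib
      by (simp add: sum.If_cases Int_def card_cartesian_product card_loops power2_eq_square)
  qed
  finally show ?thesis .
qed

text \<open>A round uses two prevertices of each bin and thus leaves room for at most (d - 2 choose
  2) loops there. This loss against (d choose 2) is the source of the covariance -1.\<close>

lemma sum_round_loop_count: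
  assumes r: "n * d = 2 * r" and n: "n \<ge> 2"
  shows "(\<Sum>P\<in>pairings n d. round_count n d P * loop_count n d P)
    \<le> fact n * (d * (d - 1)) ^ n * (n * ((d - 2) choose 2)) * odd_fact (r - (n + 1))"
proof -
  let ?L = "loops n d"
  have prod: "round_count n d P * loop_count n d P
      = card {z \<in> rounds n d \<times> ?L. round_edges (fst z) \<subseteq> P \<and> snd z \<in> P}" for P
  proof -
    have "{z \<in> rounds n d \<times> ?L. round_edges (fst z) \<subseteq> P \<and> snd z \<in> P}
        = {ws \<in> rounds n d. round_edges ws \<subseteq> P} \<times> {e \<in> ?L. e \<in> P}" by auto
    then show ?thesis by (simp add: loop_count_def round_count_def card_cartesian_product)
  qed
  have "(\<Sum>P\<in>pairings n d. round_count n d P * loop_count n d P)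
      = (\<Sum>z\<in>rounds n d \<times> ?L. card {P \<in> pairings n d. round_edges (fst z) \<subseteq> P \<and> snd z \<in> P})"
    unfolding prod using finite_loops finite_pairings finite_rounds by (intro sum_card_swap) auto
  also have "\<dots> = (\<Sum>ws\<in>rounds n d. \<Sum>e\<in>?L. card {P \<in> pairings n d. round_edges ws \<subseteq> P \<and> e \<in> P})"
    by (simp add: sum.cartesian_product case_prod_unfold)
  also have "\<dots> \<le> (\<Sum>ws\<in>rounds n d. n * ((d - 2) choose 2) * odd_fact (r - (n + 1)))"
  proof (rule sum_mono)
    fix ws assume ws: "ws \<in> rounds n d"
    let ?D = "{e \<in> ?L. e \<inter> round_points ws = {}}"
    have one: "card {P \<in> pairings n d. round_edges ws \<subseteq> P \<and> e \<in> P}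
        = (if e \<inter> round_points ws = {} then odd_fact (r - (n + 1)) else 0)" if e: "e \<in> ?L" for e
    proof -
      have eq: "{P \<in> pairings n d. round_edges ws \<subseteq> P \<and> e \<in> P} = {P \<in> pairings n d. insert e (round_edges ws) \<subseteq> P}"
        by auto
      have c: "card e = 2" using e by (simp add: loops_def)
      obtain v where v: "e \<subseteq> {v} \<times> {..<d}" using e by (auto simp: loops_def)
      \<comment> \<open>For \<open>n \<ge> 2\<close> an edge of a round joins two different bins. So
        a loop that meets the round meets an edge other than itself, and no pairing contains
        both.\<close>
      have nin: "e \<notin> round_edges ws"
      proof
        assume "e \<in> round_edges ws"
        then obtain i where i: "i < n" "e = {snd (ws ! i), fst (ws ! (Suc i mod n))}"
          using round_edges_image[OF ws] by auto
        have s: "Suc i mod n < n" using i by simp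
        have "fst (snd (ws ! i)) = v" "fst (fst (ws ! (Suc i mod n))) = v" using v i(2) by auto
        then have "i = Suc i mod n"
          using rounds_bin_inj[OF ws i(1) s] rounds_nth_token(1)[OF ws i(1)] by simp
        then show False using i(1) n by (auto simp: mod_Suc split: if_splits)
      qed
      show ?thesis
      proof (cases "e \<inter> round_points ws = {}")
        case True
        have "matching ({e} \<union> round_edges ws)"
          using True by (intro matching_Un matching_round_edges[OF ws] matching_singleton c)
            (simp add: Union_round_edges)
        then have m: "matching (insert e (round_edges ws))" by simp
        have "card (insert e (round_edges ws)) = n + 1"
          using nin card_round_edges[OF ws] finite_round_edges by simp
        moreover have "\<Union>(insert e (round_edges ws)) \<subseteq> prevertices n d"
          using loops_prevertices[OF e] round_points_rounds[OF ws] by (simp add: Union_round_edges)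
        ultimately show ?thesis unfolding eq using True card_pairings_containing[OF r m] by simp
      next
        case False
        then obtain x where x: "x \<in> e" "x \<in> \<Union>(round_edges ws)" by (auto simp: Union_round_edges)
        then obtain f where f: "f \<in> round_edges ws" "x \<in> f" by blast
        have "\<not> matching (insert e (round_edges ws))"
        proof
          assume m: "matching (insert e (round_edges ws))"
          have "e = f" by (rule matching_eqI[OF m _ _ x(1) f(2)]) (use f in auto)
          then show False using f nin by simp
        qed
        then have "card {P \<in> pairings n d. insert e (round_edges ws) \<subseteq> P} = 0"
          by (rule card_pairings_not_matching)
        then show ?thesis unfolding eq using False by (simp only: if_False)
      qed
    qed
    have "card ?D \<le> n * ((d - 2) choose 2)"
    proof -
      let ?B = "\<lambda>v. {v} \<times> {..<d} - round_points ws"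
      have "?D \<subseteq> {e. card e = 2 \<and> (\<exists>v<n. e \<subseteq> ?B v)}" unfolding loops_def by auto
      then have "card ?D \<le> card {e. card e = 2 \<and> (\<exists>v<n. e \<subseteq> ?B v)}"
        by (rule card_mono[rotated]) (rule card_pairs_in_bins(1)[of n _ d], auto)
      also have "\<dots> = (\<Sum>v<n. card (?B v) choose 2)"
        by (rule card_pairs_in_bins(2)[of n _ d]) auto
      also have "\<dots> \<le> (\<Sum>v<n. (d - 2) choose 2)"
      proof (rule sum_mono)
        fix v assume "v \<in> {..<n}"
        moreover have "(fst \<circ> fst) ` set ws = {..<n}" using ws unfolding rounds_def by blast
        ultimately have "v \<in> (fst \<circ> fst) ` set ws" by simp
        then obtain w where w: "w \<in> set ws" "(fst \<circ> fst) w = v" by blast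
        have pq: "fst w \<noteq> snd w" "fst w \<in> round_points ws" "snd w \<in> round_points ws"
            "{fst w, snd w} \<subseteq> {v} \<times> {..<d}"
          using rounds_token[OF ws w(1)] w unfolding round_points_def prevertices_def
          by (auto simp: mem_Times_iff)
        have "card (?B v) \<le> card ({v} \<times> {..<d} - {fst w, snd w})"
          by (rule card_mono) (use pq in auto)
        also have "\<dots> = d - 2"
          using pq by (subst card_Diff_subset) (auto simp: card_cartesian_product_singleton)
        finally have "card (?B v) \<le> d - 2" .
        then show "card (?B v) choose 2 \<le> (d - 2) choose 2" by (rule binomial_right_mono)
      qed
      finally show ?thesis by simp
    qed
    then have "(\<Sum>e\<in>?L. if e \<inter> round_points ws = {} then odd_fact (r - (n + 1)) else 0)
        \<le> n * ((d - 2) choose 2) * odd_fact (r - (n + 1))"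
      using finite_loops[of n d] by (simp add: sum.If_cases Int_def)
    then show "(\<Sum>e\<in>?L. card {P \<in> pairings n d. round_edges ws \<subseteq> P \<and> e \<in> P})
        \<le> n * ((d - 2) choose 2) * odd_fact (r - (n + 1))"
      using one by simp
  qed
  also have "\<dots> = fact n * (d * (d - 1)) ^ n * (n * ((d - 2) choose 2)) * odd_fact (r - (n + 1))"
    by (simp add: card_rounds)
  finally show ?thesis .
qed

section \<open>Contracting the common edges of two rounds\<close>

text \<open>
  \<open>contract U p ws\<close> merges the visits of a round along the edges whose endpoints lie in \<open>U\<close>:
  each maximal path of such edges becomes a single visit, entered at the first and left at the
  last of its prevertices. The argument \<open>p\<close> is the entry point of the current path.
\<close>

fun contract :: "'p set \<Rightarrow> 'p \<Rightarrow> ('p \<times> 'p) list \<Rightarrow> ('p \<times> 'p) list" where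
  "contract U p0 [] = []"
| "contract U p0 ((p, q) # ws) =
    (if q \<in> U then contract U p0 ws else (p0, q) # contract U (fst (hd ws)) ws)"

lemma length_contract: "length (contract U p0 ws) = length (filter (\<lambda>w. snd w \<notin> U) ws)"
  by (induction U p0 ws rule: contract.induct) auto

text \<open>If the last exit were in \<open>U\<close>, the path in progress would never be closed
  and \<open>contract\<close> would drop it; the condition on \<open>last ws\<close> excludes
  this.\<close>

lemma contract_hd:
  "ws \<noteq> [] \<Longrightarrow> snd (last ws) \<notin> U \<Longrightarrow> contract U p0 ws \<noteq> [] \<and> fst (hd (contract U p0 ws)) = p0"
  by (induction U p0 ws rule: contract.induct) (auto split: if_splits)

lemma snd_contract: "snd ` set (contract U p0 ws) = {q \<in> snd ` set ws. q \<notin> U}"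
  by (induction U p0 ws rule: contract.induct) auto

lemma fst_contract:
  "t \<in> set (contract U p0 ws) \<Longrightarrow>
    fst t = p0 \<or> (\<exists>i. Suc i < length ws \<and> snd (ws ! i) \<notin> U \<and> fst t = fst (ws ! Suc i))"
proof (induction U p0 ws rule: contract.induct)
  case (2 U p0 p q ws)
  show ?case
  proof (cases "q \<in> U")
    case True
    then have "fst t = p0 \<or> (\<exists>i. Suc i < length ws \<and> snd (ws ! i) \<notin> U \<and> fst t = fst (ws ! Suc i))"
      using 2 by simp
    then show ?thesis
    proof
      assume "\<exists>i. Suc i < length ws \<and> snd (ws ! i) \<notin> U \<and> fst t = fst (ws ! Suc i)"
      then obtain i where "Suc i < length ws" "snd (ws ! i) \<notin> U" "fst t = fst (ws ! Suc i)" by blast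
      then show ?thesis by (intro disjI2 exI[of _ "Suc i"]) simp
    qed simp
  next
    case False
    then consider "t = (p0, q)" | "t \<in> set (contract U (fst (hd ws)) ws)" using 2 by auto
    then show ?thesis
    proof cases
      case 2
      then have ne: "ws \<noteq> []" by auto
      from 2 "2.IH"(2)[OF False] consider "fst t = fst (hd ws)"
        | i where "Suc i < length ws" "snd (ws ! i) \<notin> U" "fst t = fst (ws ! Suc i)" by blast
      then show ?thesis
      proof cases
        case 1
        then show ?thesis using ne False by (intro disjI2 exI[of _ 0]) (simp add: hd_conv_nth)
      next
        case 2
        then show ?thesis by (intro disjI2 exI[of _ "Suc i"]) simp
      qed
    qed simp
  qed
qed simp

lemma contract_covers:
  "snd (last ws) \<notin> U \<Longrightarrow> Suc i < length ws \<Longrightarrow> snd (ws ! i) \<notin> U \<Longrightarrow>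
    fst (ws ! Suc i) \<in> fst ` set (contract U p0 ws)"
proof (induction U p0 ws arbitrary: i rule: contract.induct)
  case (2 U p0 p q ws)
  have ne: "ws \<noteq> []" using 2 by auto
  then have l: "snd (last ws) \<notin> U" using 2 by simp
  show ?case
  proof (cases i)
    case 0
    then have "q \<notin> U" using 2 by simp
    moreover have "fst (ws ! 0) \<in> fst ` set (contract U (fst (hd ws)) ws)"
      using contract_hd[OF ne l, of "fst (hd ws)"] ne by (metis hd_conv_nth hd_in_set imageI)
    ultimately show ?thesis using 0 by simp
  next
    case (Suc j)
    then show ?thesis using 2 l by (cases "q \<in> U") auto
  qed
qed simp

text \<open>The induction carries the label of \<open>p0\<close> along the path that is being
  merged. It is used with the label that names the path of common edges through a bin.\<close>

lemma contract_blocks: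
  assumes "\<And>w. w \<in> set ws \<Longrightarrow> b (fst w) = b (snd w)"
    and "\<And>i. Suc i < length ws \<Longrightarrow> snd (ws ! i) \<in> U \<Longrightarrow> b (snd (ws ! i)) = b (fst (ws ! Suc i))"
    and "ws \<noteq> [] \<Longrightarrow> b p0 = b (fst (hd ws))" "t \<in> set (contract U p0 ws)"
  shows "b (fst t) = b (snd t)"
  using assms
proof (induction U p0 ws rule: contract.induct)
  case (2 U p0 p q ws)
  have bq: "b p0 = b q" using 2(3)[of "(p, q)"] 2(5) by simp
  have s: "b (snd (ws ! i)) = b (fst (ws ! Suc i))" if "Suc i < length ws" "snd (ws ! i) \<in> U" for i
    using 2(4)[of "Suc i"] that by simp
  have w: "b (fst w) = b (snd w)" if "w \<in> set ws" for w using 2(3) that by simp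
  show ?case
  proof (cases "q \<in> U")
    case True
    have "b p0 = b (fst (hd ws))" if "ws \<noteq> []"
      using 2(4)[of 0] True that bq by (simp add: hd_conv_nth)
    then show ?thesis using 2(1)[OF True w s] 2(6) True by simp
  next
    case False
    then show ?thesis using 2(2)[OF False w s] 2(6) bq by auto
  qed
qed simp

text \<open>Read from the left, the entry of the current visit is always known. If its exit is in
  \<open>U\<close>, the last two hypotheses force that exit and the next entry; otherwise the
  contracted list displays the exit, and its next token displays the next entry.\<close>

lemma contract_inj:
  assumes "xs \<noteq> []" "ys \<noteq> []" "fst (hd xs) = fst (hd ys)" "contract U p0 xs = contract U p0 ys"
    and "snd (last xs) \<notin> U" "snd (last ys) \<notin> U"
    and "\<And>x y. x \<in> set xs \<Longrightarrow> y \<in> set ys \<Longrightarrow> fst x = fst y \<Longrightarrow> snd x \<in> U \<or> snd y \<in> U \<Longrightarrow> snd x = snd y"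
    and "\<And>i j. Suc i < length xs \<Longrightarrow> Suc j < length ys \<Longrightarrow> snd (xs ! i) = snd (ys ! j) \<Longrightarrow>
           snd (xs ! i) \<in> U \<Longrightarrow> fst (xs ! Suc i) = fst (ys ! Suc j)"
  shows "xs = ys"
  using assms
proof (induction xs arbitrary: ys p0)
  case (Cons x xs)
  obtain p q where x: "x = (p, q)" by (cases x)
  from Cons(3) obtain y ys' where ys: "ys = y # ys'" by (cases ys) auto
  obtain q' where y: "y = (p, q')" using Cons(4) x ys by (cases y) auto
  have qU: "q = q'" if "q \<in> U \<or> q' \<in> U" using Cons(8)[of x y] that by (simp add: x y ys)
  have tok: "\<And>x y. x \<in> set xs \<Longrightarrow> y \<in> set ys' \<Longrightarrow> fst x = fst y \<Longrightarrow> snd x \<in> U \<or> snd y \<in> U \<Longrightarrow> snd x = snd y"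
    using Cons(8) by (simp add: ys)
  have nxt: "fst (xs ! Suc i) = fst (ys' ! Suc j)"
    if "Suc i < length xs" "Suc j < length ys'" "snd (xs ! i) = snd (ys' ! j)" "snd (xs ! i) \<in> U" for i j
    using Cons(9)[of "Suc i" "Suc j"] that by (simp add: ys)
  have lx: "snd (last xs) \<notin> U" if "xs \<noteq> []" using Cons(6) that by simp
  have ly: "snd (last ys') \<notin> U" if "ys' \<noteq> []" using Cons(7) that ys by simp
  show ?case
  proof (cases "q \<in> U")
    case True
    then have qq: "q = q'" using qU by blast
    have ne: "xs \<noteq> []" "ys' \<noteq> []" using Cons(6,7) True qq by (auto simp: x y ys)
    have "fst (hd xs) = fst (hd ys')"
      using Cons(9)[of 0 0] ne True qq by (simp add: x y ys hd_conv_nth)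
    moreover have "contract U p0 xs = contract U p0 ys'" using Cons(5) True qq by (simp add: x y ys)
    ultimately have "xs = ys'" using Cons(1)[OF ne _ _ lx[OF ne(1)] ly[OF ne(2)] tok nxt] by blast
    then show ?thesis using qq by (simp add: x y ys)
  next
    case False
    then have "q' \<notin> U" using qU by blast
    then have qq: "q = q'" and c: "contract U (fst (hd xs)) xs = contract U (fst (hd ys')) ys'"
      using Cons(5) False by (auto simp: x y ys)
    have "xs = ys'"
    proof (cases "xs = [] \<or> ys' = []")
      case True
      then show ?thesis using c contract_hd lx ly by (metis contract.simps(1))
    next
      case False
      then have ne: "xs \<noteq> []" "ys' \<noteq> []" by auto
      have h: "fst (hd xs) = fst (hd ys')"
        using contract_hd[OF ne(1) lx[OF ne(1)]] contract_hd[OF ne(2) ly[OF ne(2)]] c by metis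
      have c': "contract U (fst (hd xs)) xs = contract U (fst (hd xs)) ys'" using c h by simp
      show ?thesis
        by (rule Cons(1)[OF ne h c' lx[OF ne(1)] ly[OF ne(2)]])
          ((rule tok; assumption) | (rule nxt; assumption))+
    qed
    then show ?thesis using qq by (simp add: x y ys)
  qed
qed simp

section \<open>Maximal runs in a cyclic set of positions\<close>

lemma mod_add_right_cancel_less:
  "(a + k) mod n = (b + k) mod n \<Longrightarrow> n > 0 \<Longrightarrow> a mod n = (b::nat) mod n"
proof (induction k)
  case (Suc k)
  have "Suc ((a + k) mod n) mod n = Suc ((b + k) mod n) mod n"
    using Suc.prems by (simp add: mod_Suc_eq)
  then have "(a + k) mod n = (b + k) mod n"
    using Suc_mod_inj[of "(a + k) mod n" n "(b + k) mod n"] Suc.prems(2) by simp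
  then show ?case using Suc by blast
qed simp

text \<open>With \<open>I\<close> the set of positions whose outgoing edge is common to both rounds,
  this is the final position of the path of common edges through \<open>i\<close>. It serves as the
  name of that path.\<close>

definition next_outside :: "nat \<Rightarrow> nat set \<Rightarrow> nat \<Rightarrow> nat" where
  "next_outside n I i = (i + (LEAST k. (i + k) mod n \<notin> I)) mod n"

context
  fixes n :: nat and I :: "nat set"
  assumes I: "I \<subset> {..<n}"
begin

lemma next_outside_ex: 
  assumes "i < n"
  shows "\<exists>k. (i + k) mod n \<notin> I"
proof -
  obtain j where j: "j < n" "j \<notin> I" using I by auto
  have "(i + (n + j - i)) mod n = j" using assms j by simp
  then show ?thesis using j by metis
qed

lemma next_outside_notin: "i < n \<Longrightarrow> next_outside n I i \<notin> I"
  unfolding next_outside_def using LeastI_ex[OF next_outside_ex] by blast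

lemma next_outside_less: "i < n \<Longrightarrow> next_outside n I i < n"
  unfolding next_outside_def by simp

lemma next_outside_self: "i < n \<Longrightarrow> i \<notin> I \<Longrightarrow> next_outside n I i = i"
proof -
  assume i: "i < n" "i \<notin> I"
  then have "(LEAST k. (i + k) mod n \<notin> I) = 0" by (intro Least_equality) auto
  then show ?thesis using i by (simp add: next_outside_def)
qed

lemma next_outside_step:
  assumes i: "i < n" "i \<in> I"
  shows "next_outside n I (Suc i mod n) = next_outside n I i"
proof -
  have "(LEAST k. (i + k) mod n \<notin> I) = Suc (LEAST k. (i + Suc k) mod n \<notin> I)"
  proof -
    obtain k where "(i + k) mod n \<notin> I" using next_outside_ex[OF i(1)] by blast
    then show ?thesis by (rule Least_Suc) (use i in simp)
  qed
  moreover have "(Suc i mod n + k) mod n = (i + Suc k) mod n" for k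
    by (simp add: mod_add_left_eq)
  ultimately show ?thesis by (simp add: next_outside_def)
qed

lemma next_outside_dist:
  assumes "i < n"
  obtains k where "next_outside n I i = (i + k) mod n" "\<And>l. l < k \<Longrightarrow> (i + l) mod n \<in> I"
  using not_less_Least[of _ "\<lambda>k. (i + k) mod n \<notin> I"] unfolding next_outside_def by blast

lemma pred_eq: "i < n \<Longrightarrow> (j + 1) mod n = i \<Longrightarrow> (i + n - 1) mod n = j mod n"
  using Suc_mod_inj[of "(i + n - 1) mod n" n "j mod n"] pred_mod[of i n] by (simp add: mod_Suc_eq)

lemma next_outside_pred:
  assumes "i < n" "next_outside n I i = B" "i \<noteq> B"
  shows "(B + n - 1) mod n \<in> I"
proof -
  obtain k where k: "next_outside n I i = (i + k) mod n" "\<And>l. l < k \<Longrightarrow> (i + l) mod n \<in> I"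
    using next_outside_dist[OF assms(1)] by blast
  have "k \<noteq> 0" by (rule notI) (use k(1) assms in simp)
  then obtain l where l: "k = Suc l" by (cases k) auto
  have "(B + n - 1) mod n = (i + l) mod n"
    by (rule pred_eq) (use assms k(1) l next_outside_less in auto)
  then show ?thesis using k(2)[of l] l by simp
qed

text \<open>If two walks reach the same end after different numbers of steps, the longer one passes
  through the predecessor of the start of the shorter one, so that predecessor would be in
  \<open>I\<close>.\<close>

lemma next_outside_start_unique:
  assumes i: "i < n" "(i + n - 1) mod n \<notin> I" and j: "j < n" "(j + n - 1) mod n \<notin> I"
    and eq: "next_outside n I i = next_outside n I j"
  shows "i = j"
proof -
  have no: False
    if a: "a < n" "b < n" "(a + n - 1) mod n \<notin> I" "(a + k) mod n = (b + m) mod n" "k < m"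
      "\<And>l. l < m \<Longrightarrow> (b + l) mod n \<in> I" for a b k m :: nat
  proof -
    have "(a + k) mod n = (b + (m - k) + k) mod n" using a by simp
    then have "a = (b + (m - k)) mod n" using mod_add_right_cancel_less[of a k n "b + (m - k)"] a by simp
    then have "(a + n - 1) mod n = (b + (m - k - 1)) mod n"
    proof -
      have "b + (m - k - 1) + 1 = b + (m - k)" using a(5) by simp
      then have "(b + (m - k - 1) + 1) mod n = a" using \<open>a = (b + (m - k)) mod n\<close> by metis
      then show ?thesis using pred_eq[of a "b + (m - k - 1)"] a(1) by blast
    qed
    then show False using a(3) a(6)[of "m - k - 1"] a(5) by simp
  qed
  obtain k where k: "next_outside n I i = (i + k) mod n" "\<And>l. l < k \<Longrightarrow> (i + l) mod n \<in> I"
    using next_outside_dist[OF i(1)] by blast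
  obtain m where m: "next_outside n I j = (j + m) mod n" "\<And>l. l < m \<Longrightarrow> (j + l) mod n \<in> I"
    using next_outside_dist[OF j(1)] by blast
  consider "k < m" | "m < k" | "k = m" by linarith
  then show ?thesis
  proof cases
    case 1
    then show ?thesis using no[OF i(1) j(1) i(2) _ 1 m(2)] k m eq by simp
  next
    case 2
    then show ?thesis using no[OF j(1) i(1) j(2) _ 2 k(2)] k m eq by simp
  next
    case 3
    then show ?thesis using mod_add_right_cancel_less[of i k n j] k(1) m(1) eq i j by simp
  qed
qed

end

section \<open>Rounds that share prescribed edges with a given round\<close>

lemma rounds_visit:
  assumes "ws \<in> rounds n d" "v < n"
  obtains k where "k < n" "fst (fst (ws ! k)) = v"
proof -
  have "v \<in> (fst \<circ> fst) ` set ws" using assms unfolding rounds_def by simp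
  then obtain w where "w \<in> set ws" "fst (fst w) = v" by auto
  then show ?thesis using that length_rounds[OF assms(1)] by (metis in_set_conv_nth)
qed

lemma rounds_three_points:
  assumes ws: "ws \<in> rounds n d" and "x \<in> round_points ws" "y \<in> round_points ws" "z \<in> round_points ws"
    and "fst x = fst y" "fst y = fst z"
  shows "x = y \<or> y = z \<or> x = z"
proof -
  have "x \<in> prevertices n d" using round_points_rounds[OF ws] assms by blast
  then have "fst x < n" by (auto simp: prevertices_def)
  then obtain k where k: "k < n" "fst (fst (ws ! k)) = fst x" using rounds_visit[OF ws] by blast
  show ?thesis
    using rounds_bin_points[OF ws k(1), of x] rounds_bin_points[OF ws k(1), of y]
      rounds_bin_points[OF ws k(1), of z] assms k by metis
qed

lemma inj_rotate: "inj (rotate k :: 'a list \<Rightarrow> 'a list)"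
proof -
  have "inj (rotate1 :: 'a list \<Rightarrow> 'a list)"
  proof (rule injI)
    fix xs ys :: "'a list" assume "rotate1 xs = rotate1 ys"
    then show "xs = ys" by (cases xs; cases ys) auto
  qed
  then show ?thesis unfolding rotate_def by (rule inj_fn)
qed

text \<open>The ways to traverse the path of common edges ending at position \<open>B\<close>. A
  path with an edge has d - 2 free prevertices at either end and two orientations; a lone vertex
  offers an ordered pair of distinct free prevertices. The two prevertices that the given round uses
  in each bin are never free at these places.\<close>

definition block_weight :: "nat \<Rightarrow> nat \<Rightarrow> nat set \<Rightarrow> nat \<Rightarrow> nat" where
  "block_weight n d I B = (if (B + n - 1) mod n \<in> I then 2 * (d - 2) ^ 2 else (d - 2) * (d - 3))"

locale overlap =
  fixes n d :: nat and ws0 :: "(prevertex \<times> prevertex) list" and I :: "nat set"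
  assumes ws0: "ws0 \<in> rounds n d" and I: "I \<subset> {..<n}"
begin

definition edge :: "nat \<Rightarrow> prevertex set" where
  "edge i = {snd (ws0 ! i), fst (ws0 ! (Suc i mod n))}"

definition U :: "prevertex set" where "U = \<Union>(edge ` I)"

text \<open>Two rounds whose union is not a matching lie in no common pairing, so only the rounds
  satisfying the last condition contribute to the second moment.\<close>

definition A :: "(prevertex \<times> prevertex) list set" where
  "A = {ws \<in> rounds n d. round_edges ws \<inter> round_edges ws0 = edge ` I \<and>
     matching (round_edges ws \<union> round_edges ws0)}"

lemma n_pos: "n > 0" using I by auto

lemma I_less: "i \<in> I \<Longrightarrow> i < n" using I by auto

lemma edge_meet: "i < n \<Longrightarrow> j < n \<Longrightarrow> x \<in> edge i \<Longrightarrow> x \<in> edge j \<Longrightarrow> i = j"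
  unfolding edge_def by (rule round_edge_meet[OF ws0])

lemma edge_round_edges: "i < n \<Longrightarrow> edge i \<in> round_edges ws0"
  unfolding round_edges_image[OF ws0] edge_def by simp

lemma edge_U: "i < n \<Longrightarrow> x \<in> edge i \<Longrightarrow> x \<in> U \<longleftrightarrow> i \<in> I"
  unfolding U_def using edge_meet I_less by blast

lemma snd_U: "i < n \<Longrightarrow> snd (ws0 ! i) \<in> U \<longleftrightarrow> i \<in> I"
  by (rule edge_U) (auto simp: edge_def)

lemma fst_U: "i < n \<Longrightarrow> fst (ws0 ! i) \<in> U \<longleftrightarrow> (i + n - 1) mod n \<in> I"
  using edge_U[of "(i + n - 1) mod n" "fst (ws0 ! i)"] pred_mod[of i n] by (simp add: edge_def)

lemma ws0_points: "i < n \<Longrightarrow> fst (ws0 ! i) \<in> round_points ws0 \<and> snd (ws0 ! i) \<in> round_points ws0"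
  using length_rounds[OF ws0] by (simp add: round_points_def)

lemma U_sub_ws0: "U \<subseteq> round_points ws0"
  unfolding U_def using edge_round_edges I_less Union_round_edges[of ws0] by blast

lemma A_rounds: "ws \<in> A \<Longrightarrow> ws \<in> rounds n d" by (simp add: A_def)

text \<open>In a matching two edges through the same point coincide, so the two rounds can share a
  prevertex only on a shared edge.\<close>

lemma A_common_point: "ws \<in> A \<Longrightarrow> x \<in> round_points ws \<Longrightarrow> x \<in> round_points ws0 \<Longrightarrow> x \<in> U"
proof -
  assume ws: "ws \<in> A" and x: "x \<in> round_points ws" "x \<in> round_points ws0"
  then obtain e f where ef: "e \<in> round_edges ws" "f \<in> round_edges ws0" "x \<in> e" "x \<in> f"
    unfolding Union_round_edges[symmetric] by blast
  have m: "matching (round_edges ws \<union> round_edges ws0)" using ws by (simp add: A_def)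
  have "e = f" by (rule matching_eqI[OF m _ _ ef(3,4)]) (use ef in auto)
  then have "e \<in> edge ` I" using ws ef by (auto simp: A_def)
  then show "x \<in> U" using ef unfolding U_def by blast
qed

lemma A_U_sub: "ws \<in> A \<Longrightarrow> U \<subseteq> round_points ws"
proof -
  assume ws: "ws \<in> A"
  then have "edge ` I \<subseteq> round_edges ws" by (auto simp: A_def)
  then show ?thesis unfolding U_def Union_round_edges[symmetric] by (rule Union_mono)
qed

lemma A_edge:
  assumes ws: "ws \<in> A" and e: "e \<in> round_edges ws" "x \<in> e" "x \<in> U"
  shows "e \<in> edge ` I"
proof -
  obtain f where f: "f \<in> edge ` I" "x \<in> f" using e unfolding U_def by blast
  moreover have "f \<in> round_edges ws" using ws f(1) by (auto simp: A_def)
  ultimately show ?thesis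
    using matching_eqI[OF matching_round_edges[OF A_rounds[OF ws]] e(1) _ e(2) f(2)] by blast
qed

lemma A_edge_sub:
  assumes "ws \<in> A" "e \<in> round_edges ws" "x \<in> e" "x \<in> U" "y \<in> e"
  shows "y \<in> U"
  using A_edge[OF assms(1-4)] assms(5) unfolding U_def by blast

lemma A_step_edge:
  assumes "ws \<in> A" "i < n"
  shows "{snd (ws ! i), fst (ws ! (Suc i mod n))} \<in> round_edges ws"
  unfolding round_edges_image[OF A_rounds[OF assms(1)]] using assms(2) by simp

lemma A_step: "ws \<in> A \<Longrightarrow> i < n \<Longrightarrow> snd (ws ! i) \<in> U \<longleftrightarrow> fst (ws ! (Suc i mod n)) \<in> U"
  using A_edge_sub[OF _ A_step_edge] by blast

lemma card_A_U:
  assumes ws: "ws \<in> A"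
  shows "card {i. i < n \<and> snd (ws ! i) \<in> U} = card I"
proof -
  let ?e = "\<lambda>i. {snd (ws ! i), fst (ws ! (Suc i mod n))}"
  have "?e ` {i. i < n \<and> snd (ws ! i) \<in> U} = edge ` I"
  proof (intro equalityI subsetI)
    fix e assume "e \<in> ?e ` {i. i < n \<and> snd (ws ! i) \<in> U}"
    then obtain i where i: "i < n" "snd (ws ! i) \<in> U" "e = ?e i" by blast
    show "e \<in> edge ` I" unfolding i(3) by (rule A_edge[OF ws A_step_edge[OF ws i(1)] _ i(2)]) simp
  next
    fix e assume e: "e \<in> edge ` I"
    then have "e \<in> round_edges ws" using ws by (auto simp: A_def)
    then obtain i where i: "i < n" "e = ?e i" using round_edges_image[OF A_rounds[OF ws]] by auto
    then have "snd (ws ! i) \<in> U" using e unfolding U_def by blast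
    then show "e \<in> ?e ` {i. i < n \<and> snd (ws ! i) \<in> U}" using i by blast
  qed
  moreover have "inj_on ?e {i. i < n \<and> snd (ws ! i) \<in> U}"
    by (rule inj_on_subset[OF inj_on_round_edge[OF A_rounds[OF ws]]]) auto
  moreover have "inj_on edge I"
  proof (rule inj_onI)
    fix i j assume "i \<in> I" "j \<in> I" "edge i = edge j"
    then show "i = j" using edge_meet[of i j "snd (ws0 ! i)"] I_less by (auto simp: edge_def)
  qed
  ultimately have "card (edge ` I) = card {i. i < n \<and> snd (ws ! i) \<in> U}" "card (edge ` I) = card I"
    using card_image[of ?e "{i. i < n \<and> snd (ws ! i) \<in> U}"] card_image[of edge I] by simp_all
  then show ?thesis by simp
qed

text \<open>Inverts the order in which \<open>ws0\<close> visits the vertices. Blocks are labelled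
  by positions along \<open>ws0\<close> instead of vertices, because the paths of common edges are
  then cyclic intervals.\<close>

definition pos :: "nat \<Rightarrow> nat" where
  "pos v = (SOME i. i < n \<and> fst (fst (ws0 ! i)) = v)"

lemma pos: "v < n \<Longrightarrow> pos v < n \<and> fst (fst (ws0 ! pos v)) = v"
  unfolding pos_def by (rule someI_ex) (use rounds_visit[OF ws0] in blast)

lemma pos_ws0: "i < n \<Longrightarrow> pos (fst (fst (ws0 ! i))) = i"
proof -
  assume i: "i < n"
  then have "fst (fst (ws0 ! i)) < n"
    using rounds_token(3)[OF ws0, of "ws0 ! i"] length_rounds[OF ws0] by (auto simp: prevertices_def)
  then show ?thesis using pos rounds_bin_inj[OF ws0] i by blast
qed

lemma pos_ws0_snd: "i < n \<Longrightarrow> pos (fst (snd (ws0 ! i))) = i"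
  using pos_ws0 rounds_nth_token(1)[OF ws0] by simp

definition block :: "prevertex \<Rightarrow> nat" where
  "block x = next_outside n I (pos (fst x))"

lemma block_edge:
  assumes "e \<in> edge ` I" "x \<in> e" "y \<in> e"
  shows "block x = block y"
proof -
  obtain i where i: "i \<in> I" "e = edge i" using assms(1) by blast
  have b: "block z = next_outside n I i" if "z \<in> e" for z
  proof -
    have "z = snd (ws0 ! i) \<or> z = fst (ws0 ! (Suc i mod n))" using that i by (simp add: edge_def)
    then show ?thesis
    proof
      assume "z = snd (ws0 ! i)"
      then show ?thesis using pos_ws0_snd[of i] I_less[OF i(1)] by (simp add: block_def)
    next
      assume "z = fst (ws0 ! (Suc i mod n))"
      then show ?thesis
        using pos_ws0[of "Suc i mod n"] n_pos next_outside_step[OF I I_less[OF i(1)] i(1)]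
        by (simp add: block_def)
    qed
  qed
  show ?thesis using b assms by simp
qed

text \<open>At a vertex interior to a path of common edges both prevertices of \<open>ws0\<close>
  are in \<open>U\<close>, hence used by the other round too, which has no third prevertex
  there.\<close>

lemma A_free_pos:
  assumes ws: "ws \<in> A" and x: "x \<in> round_points ws" "x \<notin> U"
  shows "pos (fst x) < n" "fst (fst (ws0 ! pos (fst x))) = fst x"
    "pos (fst x) \<notin> I \<or> (pos (fst x) + n - 1) mod n \<notin> I"
proof -
  have "x \<in> prevertices n d" using round_points_rounds[OF A_rounds[OF ws]] x by blast
  then have v: "fst x < n" by (auto simp: prevertices_def)
  let ?i = "pos (fst x)"
  show i: "?i < n" and v': "fst (fst (ws0 ! ?i)) = fst x" using pos[OF v] by auto
  show "?i \<notin> I \<or> (?i + n - 1) mod n \<notin> I"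
  proof (rule ccontr)
    assume "\<not> (?i \<notin> I \<or> (?i + n - 1) mod n \<notin> I)"
    then have U: "fst (ws0 ! ?i) \<in> U" "snd (ws0 ! ?i) \<in> U" using fst_U[OF i] snd_U[OF i] by auto
    then have "fst (ws0 ! ?i) \<in> round_points ws" "snd (ws0 ! ?i) \<in> round_points ws"
      using A_U_sub[OF ws] by auto
    then have "x = fst (ws0 ! ?i) \<or> fst (ws0 ! ?i) = snd (ws0 ! ?i) \<or> x = snd (ws0 ! ?i)"
      using rounds_three_points[OF A_rounds[OF ws] x(1)] v' rounds_nth_token(1)[OF ws0 i] by metis
    then show False using U x(2) rounds_nth_token(2)[OF ws0 i] by metis
  qed
qed

definition free :: "nat \<Rightarrow> prevertex set" where
  "free i = {x \<in> prevertices n d. pos (fst x) = i} - round_points ws0"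

lemma card_free:
  assumes "i < n"
  shows "finite (free i)" "card (free i) = d - 2"
proof -
  let ?v = "fst (fst (ws0 ! i))"
  have pq: "fst (ws0 ! i) \<in> prevertices n d" "snd (ws0 ! i) \<in> prevertices n d"
    using ws0_points[OF assms] round_points_rounds[OF ws0] by auto
  have b: "fst (snd (ws0 ! i)) = ?v" "fst (ws0 ! i) \<noteq> snd (ws0 ! i)"
    using rounds_nth_token[OF ws0 assms] by auto
  have eq: "free i = {?v} \<times> {..<d} - {fst (ws0 ! i), snd (ws0 ! i)}"
  proof (intro equalityI subsetI)
    fix x assume x: "x \<in> free i"
    then have "fst x < n" "snd x < d" by (auto simp: free_def prevertices_def)
    then have "fst x = ?v" using pos[of "fst x"] x by (simp add: free_def)
    moreover have "x \<noteq> fst (ws0 ! i)" "x \<noteq> snd (ws0 ! i)"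
      using x ws0_points[OF assms] by (auto simp: free_def)
    ultimately show "x \<in> {?v} \<times> {..<d} - {fst (ws0 ! i), snd (ws0 ! i)}"
      using \<open>snd x < d\<close> by (simp add: mem_Times_iff)
  next
    fix x assume x: "x \<in> {?v} \<times> {..<d} - {fst (ws0 ! i), snd (ws0 ! i)}"
    then have xv: "fst x = ?v" "snd x < d" by (auto simp: mem_Times_iff)
    have "x \<notin> round_points ws0" using rounds_bin_points[OF ws0 assms, of x] x xv by blast
    moreover have "x \<in> prevertices n d" using xv pq(1) by (simp add: prevertices_def mem_Times_iff)
    ultimately show "x \<in> free i" using xv(1) pos_ws0[OF assms] by (simp add: free_def)
  qed
  show "finite (free i)" unfolding eq by simp
  have "{fst (ws0 ! i), snd (ws0 ! i)} \<subseteq> {?v} \<times> {..<d}"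
    using pq b by (auto simp: prevertices_def mem_Times_iff)
  then show "card (free i) = d - 2"
    unfolding eq using b(2) by (subst card_Diff_subset) (auto simp: card_cartesian_product_singleton)
qed

text \<open>The first position of the path that ends at \<open>B\<close>. The guard
  \<open>start B < n\<close> in \<open>W\<close> keeps the bound for \<open>card (W B)\<close> valid
  without a proof of existence; existence is shown in \<open>token_in_W\<close>, where an actual
  token provides it.\<close>

definition start :: "nat \<Rightarrow> nat" where
  "start B = (SOME s. s < n \<and> (s + n - 1) mod n \<notin> I \<and> next_outside n I s = B)"

text \<open>The intersection with the tokens labelled \<open>B\<close> makes these sets disjoint, as
  \<open>card_token_lists\<close> demands; the bound on the cardinality comes from the other
  factor.\<close>

definition W :: "nat \<Rightarrow> (prevertex \<times> prevertex) set" where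
  "W B = {t. block (fst t) = B} \<inter>
     (if (B + n - 1) mod n \<in> I
      then if start B < n then free B \<times> free (start B) \<union> free (start B) \<times> free B else {}
      else (SIGMA p:free B. free B - {p}))"

lemma card_W:
  assumes "B < n"
  shows "finite (W B)" "card (W B) \<le> block_weight n d I B"
proof -
  let ?X = "if (B + n - 1) mod n \<in> I
      then if start B < n then free B \<times> free (start B) \<union> free (start B) \<times> free B else {}
      else (SIGMA p:free B. free B - {p})"
  have fin: "finite ?X" using card_free(1)[OF assms] card_free(1)[of "start B"] by auto
  then show "finite (W B)" by (simp add: W_def)
  have "card (W B) \<le> card ?X" unfolding W_def by (rule card_mono[OF fin]) simp
  also have "\<dots> \<le> block_weight n d I B"
  proof (cases "(B + n - 1) mod n \<in> I")
    case True
    have "card (free B \<times> free (start B) \<union> free (start B) \<times> free B) \<le> 2 * (d - 2) ^ 2" if "start B < n"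
      using card_Un_le[of "free B \<times> free (start B)" "free (start B) \<times> free B"]
        card_free(2)[OF assms] card_free(2)[OF that]
      by (simp add: card_cartesian_product power2_eq_square)
    then show ?thesis using True by (simp add: block_weight_def)
  next
    case False
    then show ?thesis using card_free[OF assms] by (simp add: block_weight_def card_Diff_singleton)
  qed
  finally show "card (W B) \<le> block_weight n d I B" .
qed

text \<open>Free prevertices occur only at the two ends of a path. If the path has an edge, both
  points of the token cannot be in the same bin: that bin already has a point in \<open>U\<close>,
  and the round uses only two points of each bin.\<close>

lemma token_in_W:
  assumes ws: "ws \<in> A" and p: "p \<in> round_points ws" "p \<notin> U" and q: "q \<in> round_points ws" "q \<notin> U"
    and pq: "p \<noteq> q" "block p = block q"
  shows "(p, q) \<in> W (block p)"
proof -
  let ?i = "pos (fst p)" and ?j = "pos (fst q)"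
  define B where "B = block p"
  note ip = A_free_pos[OF ws p] and jq = A_free_pos[OF ws q]
  have no0: "x \<notin> round_points ws0" if "x \<in> round_points ws" "x \<notin> U" for x
    using A_common_point[OF ws] that by blast
  have pv: "x \<in> prevertices n d" if "x \<in> round_points ws" for x
    using round_points_rounds[OF A_rounds[OF ws]] that by blast
  have fp: "p \<in> free ?i" and fq: "q \<in> free ?j"
    using no0[OF p] no0[OF q] pv[OF p(1)] pv[OF q(1)] by (auto simp: free_def)
  have nB: "next_outside n I ?i = B" "next_outside n I ?j = B"
    using pq(2) by (auto simp: B_def block_def)
  have BI: "B \<notin> I" "B < n"
    using next_outside_notin[OF I ip(1)] next_outside_less[OF I ip(1)] nB by auto
  show ?thesis
  proof (cases "(B + n - 1) mod n \<in> I")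
    case False
    then have "?i = B" "?j = B" using next_outside_pred[OF I] ip(1) jq(1) nB by blast+
    then show ?thesis using fp fq pq(1) False by (auto simp: W_def B_def[symmetric])
  next
    case True
    have pos_cases: "i = B \<or> i \<in> I \<and> i = start B \<and> start B < n"
      if i: "i < n" "next_outside n I i = B" "i \<notin> I \<or> (i + n - 1) mod n \<notin> I" for i
    proof (cases "i \<in> I")
      case True
      then have pr: "(i + n - 1) mod n \<notin> I" using i by blast
      have s: "start B < n \<and> (start B + n - 1) mod n \<notin> I \<and> next_outside n I (start B) = B"
        unfolding start_def by (rule someI[of _ i]) (use i pr in blast)
      then have "i = start B" using next_outside_start_unique[OF I i(1) pr, of "start B"] i(2) by simp
      then show ?thesis using s True by simp
    next
      case False
      then show ?thesis using next_outside_self[OF I i(1)] i(2) by simp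
    qed
    have ne: "?i \<noteq> ?j"
    proof
      assume eq: "?i = ?j"
      then have bin: "fst p = fst q" using ip(2) jq(2) by metis
      have "\<exists>u\<in>U. fst u = fst p"
      proof (cases "?i = B")
        case True
        then have "fst (ws0 ! ?i) \<in> U" using fst_U[OF ip(1)] \<open>(B + n - 1) mod n \<in> I\<close> by simp
        then show ?thesis using ip(2) by blast
      next
        case False
        then have "?i \<in> I" using pos_cases[OF ip(1) nB(1) ip(3)] by blast
        then have "snd (ws0 ! ?i) \<in> U" using snd_U[OF ip(1)] by simp
        then show ?thesis using ip(2) rounds_nth_token(1)[OF ws0 ip(1)] by metis
      qed
      then obtain u where u: "u \<in> U" "fst u = fst p" by blast
      have "u \<in> round_points ws" using A_U_sub[OF ws] u(1) by (rule subsetD)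
      then have "p = q \<or> q = u \<or> p = u"
        by (rule rounds_three_points[OF A_rounds[OF ws] p(1) q(1)]) (use u(2) bin in simp_all)
      then show False using pq(1) u(1) p(2) q(2) by blast
    qed
    have "?i = B \<and> ?j = start B \<and> start B < n \<or> ?i = start B \<and> ?j = B \<and> start B < n"
      using pos_cases[OF ip(1) nB(1) ip(3)] pos_cases[OF jq(1) nB(2) jq(3)] ne by auto
    then have "(p, q) \<in> free B \<times> free (start B) \<union> free (start B) \<times> free B" "start B < n"
      using fp fq by auto
    then show ?thesis using True by (simp add: W_def B_def[symmetric])
  qed
qed

text \<open>Meant for rounds whose first entry is outside \<open>U\<close>: then no path of common
  edges wraps around the end of the list.\<close>

definition tokens :: "(prevertex \<times> prevertex) list \<Rightarrow> (prevertex \<times> prevertex) list" where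
  "tokens ws = contract U (fst (hd ws)) ws"

context
  fixes ws
  assumes ws: "ws \<in> A" and first: "fst (ws ! 0) \<notin> U"
begin

lemma len: "length ws = n" using length_rounds[OF A_rounds[OF ws]] .

lemma ne: "ws \<noteq> []" using len n_pos by auto

lemma last_notin: "snd (last ws) \<notin> U"
  using A_step[OF ws, of "n - 1"] first n_pos len ne by (simp add: last_conv_nth)

lemma points: "k < n \<Longrightarrow> fst (ws ! k) \<in> round_points ws \<and> snd (ws ! k) \<in> round_points ws"
  using len by (simp add: round_points_def)

lemma fst_token:
  assumes "t \<in> set (tokens ws)"
  obtains k where "k < n" "fst t = fst (ws ! k)" "fst t \<notin> U"
proof -
  from fst_contract[OF assms[unfolded tokens_def]]
  consider "fst t = fst (hd ws)" | i where "Suc i < n" "snd (ws ! i) \<notin> U" "fst t = fst (ws ! Suc i)"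
    using len by auto
  then show ?thesis
  proof cases
    case 1
    then show ?thesis using that[of 0] first ne n_pos by (simp add: hd_conv_nth)
  next
    case 2
    then show ?thesis using that[of "Suc i"] A_step[OF ws, of i] by simp
  qed
qed

lemma snd_token:
  assumes "t \<in> set (tokens ws)"
  obtains k where "k < n" "snd t = snd (ws ! k)" "snd t \<notin> U"
proof -
  have "snd t \<in> {q \<in> snd ` set ws. q \<notin> U}"
    using assms snd_contract[of U "fst (hd ws)" ws] unfolding tokens_def by blast
  then show ?thesis using that len by (auto simp: in_set_conv_nth)
qed

lemma token_block:
  assumes "t \<in> set (tokens ws)"
  shows "block (fst t) = block (snd t)"
proof (rule contract_blocks[OF _ _ _ assms[unfolded tokens_def]])
  show "block (fst w) = block (snd w)" if "w \<in> set ws" for w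
    using rounds_token(1)[OF A_rounds[OF ws] that] by (simp add: block_def)
  show "block (snd (ws ! i)) = block (fst (ws ! Suc i))"
    if i: "Suc i < length ws" "snd (ws ! i) \<in> U" for i
  proof -
    have e: "{snd (ws ! i), fst (ws ! Suc i)} \<in> round_edges ws"
      using A_step_edge[OF ws, of i] i(1) len by simp
    have "{snd (ws ! i), fst (ws ! Suc i)} \<in> edge ` I"
      by (rule A_edge[OF ws e _ i(2)]) simp
    then show ?thesis by (rule block_edge) auto
  qed
qed simp

lemma token_W:
  assumes "t \<in> set (tokens ws)"
  shows "t \<in> W (block (fst t))"
proof -
  obtain k l where k: "k < n" "fst t = fst (ws ! k)" "fst t \<notin> U"
    and l: "l < n" "snd t = snd (ws ! l)" "snd t \<notin> U"
    using fst_token[OF assms] snd_token[OF assms] by metis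
  have "fst t \<noteq> snd t"
    using rounds_point_eq(3)[OF A_rounds[OF ws] k(1) l(1)] k(2) l(2) by simp
  then have "(fst t, snd t) \<in> W (block (fst t))"
    using token_in_W[OF ws _ k(3) _ l(3)] points[OF k(1)] points[OF l(1)] token_block[OF assms] k(2) l(2)
    by simp
  then show ?thesis by simp
qed

text \<open>The vertex at a position \<open>B\<close> outside \<open>I\<close> has at most one
  prevertex in \<open>U\<close>, so the round has another prevertex there, at which a token begins
  or ends.\<close>

lemma block_tokens: "(block \<circ> fst) ` set (tokens ws) = {..<n} - I"
proof (intro equalityI subsetI)
  fix B assume "B \<in> (block \<circ> fst) ` set (tokens ws)"
  then obtain t where t: "t \<in> set (tokens ws)" "B = block (fst t)" by auto
  obtain k where k: "k < n" "fst t = fst (ws ! k)" "fst t \<notin> U" using fst_token[OF t(1)] .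
  have "pos (fst (fst t)) < n" using A_free_pos(1)[OF ws _ k(3)] points[OF k(1)] k(2) by simp
  then show "B \<in> {..<n} - I"
    using next_outside_notin[OF I] next_outside_less[OF I] t(2) by (simp add: block_def)
next
  fix B assume B: "B \<in> {..<n} - I"
  then have Bn: "B < n" by simp
  let ?v = "fst (fst (ws0 ! B))"
  have "?v < n"
    using rounds_token(3)[OF ws0, of "ws0 ! B"] length_rounds[OF ws0] Bn by (auto simp: prevertices_def)
  then obtain k where k: "k < n" "fst (fst (ws ! k)) = ?v" using rounds_visit[OF A_rounds[OF ws]] by blast
  have ksnd: "fst (snd (ws ! k)) = ?v" using rounds_nth_token(1)[OF A_rounds[OF ws] k(1)] k(2) by simp
  have blk: "block x = B" if "fst x = ?v" for x
    using that pos_ws0[OF Bn] next_outside_self[OF I Bn] B by (simp add: block_def)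
  have q0: "snd (ws0 ! B) \<notin> U" using snd_U[OF Bn] B by simp
  have "snd (ws ! k) \<notin> U \<or> fst (ws ! k) \<notin> U"
  proof (rule ccontr)
    assume "\<not> (snd (ws ! k) \<notin> U \<or> fst (ws ! k) \<notin> U)"
    then have U: "snd (ws ! k) \<in> U" "fst (ws ! k) \<in> U" by auto
    then have "snd (ws ! k) = fst (ws0 ! B)" "fst (ws ! k) = fst (ws0 ! B)"
      using rounds_bin_points[OF ws0 Bn] U_sub_ws0 k(2) ksnd q0 by (metis subsetD)+
    then show False using rounds_nth_token(2)[OF A_rounds[OF ws] k(1)] by metis
  qed
  then show "B \<in> (block \<circ> fst) ` set (tokens ws)"
  proof
    assume "snd (ws ! k) \<notin> U"
    then have "snd (ws ! k) \<in> snd ` set (tokens ws)"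
      unfolding tokens_def snd_contract using k(1) len by simp
    then obtain t where t: "t \<in> set (tokens ws)" "snd t = snd (ws ! k)" by auto
    then have "block (fst t) = B" using token_block blk ksnd by metis
    then show ?thesis using t(1) by force
  next
    assume f: "fst (ws ! k) \<notin> U"
    have "fst (ws ! k) \<in> fst ` set (tokens ws)"
    proof (cases k)
      case 0
      then show ?thesis
        using contract_hd[OF ne last_notin, of "fst (hd ws)"] ne unfolding tokens_def
        by (metis hd_conv_nth hd_in_set imageI)
    next
      case (Suc j)
      then have "snd (ws ! j) \<notin> U" using A_step[OF ws, of j] k(1) f by simp
      then show ?thesis
        using contract_covers[OF last_notin, of j] Suc k(1) len unfolding tokens_def by simp
    qed
    then obtain t where t: "t \<in> set (tokens ws)" "fst t = fst (ws ! k)" by auto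
    then have "block (fst t) = B" using blk k(2) by metis
    then show ?thesis using t(1) by force
  qed
qed

lemma length_tokens: "length (tokens ws) = n - card I"
proof -
  have "length (tokens ws) = card {i. i < n \<and> snd (ws ! i) \<notin> U}"
    unfolding tokens_def length_contract length_filter_conv_card len ..
  also have "{i. i < n \<and> snd (ws ! i) \<notin> U} = {..<n} - {i. i < n \<and> snd (ws ! i) \<in> U}" by auto
  also have "card \<dots> = n - card I" using card_A_U[OF ws] by (subst card_Diff_subset) auto
  finally show ?thesis .
qed

lemma tokens_mem:
  "tokens ws \<in> {ts. distinct (map (block \<circ> fst) ts) \<and> (block \<circ> fst) ` set ts = {..<n} - I \<and>
     (\<forall>t\<in>set ts. t \<in> W ((block \<circ> fst) t))}"
proof -
  have fI: "finite I" using I finite_subset by blast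
  have "card (set (map (block \<circ> fst) (tokens ws))) = length (map (block \<circ> fst) (tokens ws))"
    unfolding set_map block_tokens using I fI length_tokens by (simp add: card_Diff_subset)
  then have "distinct (map (block \<circ> fst) (tokens ws))" by (rule card_distinct)
  then show ?thesis using block_tokens token_W by simp
qed

end

text \<open>Within \<open>U\<close> the rounds of \<open>A\<close> have no freedom. All of them
  contain the edges indexed by \<open>I\<close>, and in a bin entered at a point different from a
  given point of \<open>U\<close> the exit must be that point. These are the hypotheses of
  \<open>contract_inj\<close>.\<close>

lemma tokens_inj: "inj_on tokens {ws \<in> A. fst (ws ! 0) \<notin> U}"
proof (rule inj_onI)
  fix xs ys assume xs: "xs \<in> {ws \<in> A. fst (ws ! 0) \<notin> U}" and ys: "ys \<in> {ws \<in> A. fst (ws ! 0) \<notin> U}"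
    and eq: "tokens xs = tokens ys"
  then have X: "xs \<in> A" "fst (xs ! 0) \<notin> U" and Y: "ys \<in> A" "fst (ys ! 0) \<notin> U" by auto
  note xr = A_rounds[OF X(1)] and yr = A_rounds[OF Y(1)]
  have h: "fst (hd xs) = fst (hd ys)"
    using contract_hd[OF ne[OF X] last_notin[OF X], of "fst (hd xs)"]
      contract_hd[OF ne[OF Y] last_notin[OF Y], of "fst (hd ys)"] eq unfolding tokens_def by metis
  have tok: "snd x = snd y"
    if A: "us \<in> A" "vs \<in> A" and xy: "x \<in> set us" "y \<in> set vs" "fst x = fst y" "snd x \<in> U" for us vs x y
  proof -
    obtain k where k: "k < n" "y = vs ! k"
      using xy(2) length_rounds[OF A_rounds[OF A(2)]] by (metis in_set_conv_nth)
    have "snd x \<in> round_points vs" using xy(4) A_U_sub[OF A(2)] by blast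
    moreover have "fst (snd x) = fst (fst (vs ! k))"
      using rounds_token(1)[OF A_rounds[OF A(1)] xy(1)] xy(3) k(2) by simp
    ultimately have "snd x = fst y \<or> snd x = snd y"
      using rounds_bin_points[OF A_rounds[OF A(2)] k(1)] k(2) by blast
    then show ?thesis using xy(3) rounds_token(2)[OF A_rounds[OF A(1)] xy(1)] by metis
  qed
  show "xs = ys"
  proof (rule contract_inj[where U = U and ?p0.0 = "fst (hd xs)"])
    show "contract U (fst (hd xs)) xs = contract U (fst (hd xs)) ys"
      using eq h unfolding tokens_def by simp
    show "snd x = snd y" if "x \<in> set xs" "y \<in> set ys" "fst x = fst y" "snd x \<in> U \<or> snd y \<in> U" for x y
      using tok[OF X(1) Y(1) that(1,2,3)] tok[OF Y(1) X(1) that(2,1) that(3)[symmetric]] that(4) by metis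
    show "fst (xs ! Suc i) = fst (ys ! Suc j)"
      if ij: "Suc i < length xs" "Suc j < length ys" "snd (xs ! i) = snd (ys ! j)" "snd (xs ! i) \<in> U" for i j
    proof -
      let ?e = "{snd (xs ! i), fst (xs ! Suc i)}" and ?f = "{snd (ys ! j), fst (ys ! Suc j)}"
      have il: "Suc i < n" "Suc j < n" using ij length_rounds[OF xr] length_rounds[OF yr] by auto
      have e: "?e \<in> round_edges xs" "?f \<in> round_edges ys"
        using A_step_edge[OF X(1), of i] A_step_edge[OF Y(1), of j] il by auto
      have "?e \<in> edge ` I" by (rule A_edge[OF X(1) e(1) _ ij(4)]) simp
      then have "?e \<in> round_edges ys" using Y(1) by (auto simp: A_def)
      then have "?e = ?f"
        by (rule matching_eqI[OF matching_round_edges[OF yr] _ e(2), of _ "snd (xs ! i)"]) (use ij in auto)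
      moreover have "fst (xs ! Suc i) \<noteq> snd (xs ! i)" using rounds_point_eq(3)[OF xr, of "Suc i" i] il by simp
      ultimately show ?thesis using ij(3) by (auto simp: doubleton_eq_iff)
    qed
  qed (use ne[OF X] ne[OF Y] last_notin[OF X] last_notin[OF Y] h in auto)
qed

lemma finite_A: "finite A"
  by (rule finite_subset[OF _ finite_rounds[of n d]]) (use A_rounds in blast)

lemma card_A_start:
  "card {ws \<in> A. fst (ws ! 0) \<notin> U} \<le> fact (n - card I) * (\<Prod>B\<in>{..<n} - I. block_weight n d I B)"
proof -
  let ?V = "{..<n} - I"
  let ?T = "{ts. distinct (map (block \<circ> fst) ts) \<and> (block \<circ> fst) ` set ts = ?V \<and>
     (\<forall>t\<in>set ts. t \<in> W ((block \<circ> fst) t))}"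
  have T: "finite ?T \<and> card ?T = fact (card ?V) * (\<Prod>v\<in>?V. card (W v))"
  proof (rule card_token_lists)
    show "finite (W v)" if "v \<in> ?V" for v using card_W(1)[of v] that by simp
    show "(block \<circ> fst) t = v" if "v \<in> ?V" "t \<in> W v" for v t using that by (simp add: W_def)
  qed simp
  have "card {ws \<in> A. fst (ws ! 0) \<notin> U} \<le> card ?T"
  proof (rule card_inj_on_le[OF tokens_inj])
    show "tokens ` {ws \<in> A. fst (ws ! 0) \<notin> U} \<subseteq> ?T" using tokens_mem by blast
  qed (use T in blast)
  also have "card ?T = fact (card ?V) * (\<Prod>v\<in>?V. card (W v))" using T by blast
  also have "\<dots> \<le> fact (card ?V) * (\<Prod>B\<in>?V. block_weight n d I B)"
    by (intro mult_left_mono prod_mono) (use card_W(2) in auto)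
  also have "card ?V = n - card I" using I finite_subset[of I "{..<n}"] by (simp add: card_Diff_subset)
  finally show ?thesis .
qed

lemma A_rotate: "ws \<in> A \<Longrightarrow> rotate k ws \<in> A"
  by (simp add: A_def rounds_rotate round_edges_rotate)

text \<open>Exactly n - card I of the n rotations of a round begin at the start of a token. Double
  counting of rounds and rotations therefore replaces the factorial of n - card I by n times the
  factorial of n - card I - 1.\<close>

lemma card_A: "card A \<le> n * fact (n - card I - 1) * (\<Prod>B\<in>{..<n} - I. block_weight n d I B)"
proof -
  let ?m = "n - card I"
  let ?A0 = "{ws \<in> A. fst (ws ! 0) \<notin> U}"
  have fI: "finite I" using I finite_subset by blast
  have m: "?m > 0" using psubset_card_mono[OF _ I] by simp
  have cnt: "card {k \<in> {..<n}. rotate k ws \<in> ?A0} = ?m" if ws: "ws \<in> A" for ws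
  proof -
    have l: "length ws = n" using length_rounds[OF A_rounds[OF ws]] .
    have "{k \<in> {..<n}. rotate k ws \<in> ?A0} = {k. k < n \<and> fst (ws ! k) \<notin> U}"
      using A_rotate[OF ws] l n_pos by (auto simp: nth_rotate)
    also have "\<dots> = (\<lambda>i. Suc i mod n) ` {i. i < n \<and> snd (ws ! i) \<notin> U}"
    proof (intro equalityI subsetI)
      fix k assume k: "k \<in> {k. k < n \<and> fst (ws ! k) \<notin> U}"
      then have kn: "k < n" by simp
      let ?i = "(k + n - 1) mod n"
      have "snd (ws ! ?i) \<notin> U" using A_step[OF ws pred_mod(3)[OF kn]] pred_mod(1)[OF kn] k by simp
      then have "?i \<in> {i. i < n \<and> snd (ws ! i) \<notin> U}" using pred_mod(3)[OF kn] by simp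
      then show "k \<in> (\<lambda>i. Suc i mod n) ` {i. i < n \<and> snd (ws ! i) \<notin> U}"
        using pred_mod(1)[OF kn] by (metis (mono_tags, lifting) image_eqI)
    next
      fix k assume "k \<in> (\<lambda>i. Suc i mod n) ` {i. i < n \<and> snd (ws ! i) \<notin> U}"
      then show "k \<in> {k. k < n \<and> fst (ws ! k) \<notin> U}" using A_step[OF ws] n_pos by auto
    qed
    also have "card \<dots> = card {i. i < n \<and> snd (ws ! i) \<notin> U}"
      by (rule card_image) (auto intro!: inj_onI dest: Suc_mod_inj)
    also have "{i. i < n \<and> snd (ws ! i) \<notin> U} = {..<n} - {i. i < n \<and> snd (ws ! i) \<in> U}" by auto
    also have "card \<dots> = ?m" using card_A_U[OF ws] by (subst card_Diff_subset) auto
    finally show ?thesis .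
  qed
  have "card A * ?m = (\<Sum>ws\<in>A. card {k \<in> {..<n}. rotate k ws \<in> ?A0})" using cnt by simp
  also have "\<dots> = (\<Sum>k<n. card {ws \<in> A. rotate k ws \<in> ?A0})"
    by (rule sum_card_swap[OF _ finite_A]) simp
  also have "\<dots> \<le> (\<Sum>k<n. card ?A0)"
  proof (rule sum_mono)
    fix k
    have fin: "finite ?A0" using finite_A by simp
    have "inj_on (rotate k) {ws \<in> A. rotate k ws \<in> ?A0}"
      by (rule inj_on_subset[OF _ subset_UNIV]) (rule inj_rotate)
    then show "card {ws \<in> A. rotate k ws \<in> ?A0} \<le> card ?A0"
      by (rule card_inj_on_le[OF _ _ fin]) blast
  qed
  also have "\<dots> \<le> n * (fact ?m * (\<Prod>B\<in>{..<n} - I. block_weight n d I B))" using card_A_start by simp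
  also have "fact ?m = ?m * (fact (?m - 1) :: nat)" using m by (simp add: fact_reduce)
  finally have "?m * card A \<le> ?m * (n * fact (?m - 1) * (\<Prod>B\<in>{..<n} - I. block_weight n d I B))"
    by (simp add: mult_ac)
  then show ?thesis using m by simp
qed

end

section \<open>The second moment and the transfer matrix\<close>

text \<open>Rounds are grouped by the index set \<open>I\<close> of the edges of \<open>ws0\<close>
  that they contain; the union then has 2 n - card I edges. The case where all edges are common,
  which \<open>overlap\<close> excludes, is the set of 2 n rounds with the edges of
  \<open>ws0\<close>.\<close>

lemma card_rounds_overlap:
  assumes r: "n * d = 2 * r" and n: "n > 0" and ws0: "ws0 \<in> rounds n d"
  shows "(\<Sum>ws\<in>rounds n d. card {P \<in> pairings n d. round_edges ws \<union> round_edges ws0 \<subseteq> P})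
    \<le> 2 * n * odd_fact (r - n) +
      (\<Sum>I\<in>Pow {..<n} - {{..<n}}. n * fact (n - card I - 1) * (\<Prod>B\<in>{..<n} - I. block_weight n d I B)
         * odd_fact (r - (2 * n - card I)))"
proof -
  define edge where "edge i = {snd (ws0 ! i), fst (ws0 ! (Suc i mod n))}" for i
  note edge_eq = edge_def
  define M where "M = {ws \<in> rounds n d. matching (round_edges ws \<union> round_edges ws0)}"
  define g where "g ws = {i. i < n \<and> edge i \<in> round_edges ws}" for ws
  let ?c = "\<lambda>ws. card {P \<in> pairings n d. round_edges ws \<union> round_edges ws0 \<subseteq> P}"
  have E0: "round_edges ws0 = edge ` {..<n}"
    unfolding edge_def by (rule round_edges_image[OF ws0])
  have inj: "inj_on edge {..<n}" unfolding edge_def by (rule inj_on_round_edge[OF ws0])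
  have finM: "finite M" unfolding M_def using finite_rounds by simp
  have int: "round_edges ws \<inter> round_edges ws0 = edge ` g ws" for ws
    unfolding E0 g_def by auto
  have cg: "card (edge ` g ws) = card (g ws)" for ws
    by (rule card_image, rule inj_on_subset[OF inj]) (auto simp: g_def)
  have c: "?c ws = odd_fact (r - (2 * n - card (g ws)))" if "ws \<in> M" for ws
  proof -
    have ws: "ws \<in> rounds n d" and m: "matching (round_edges ws \<union> round_edges ws0)"
      using that by (auto simp: M_def)
    have "card (round_edges ws \<union> round_edges ws0) + card (round_edges ws \<inter> round_edges ws0) = n + n"
      using card_Un_Int[OF finite_round_edges[of ws] finite_round_edges[of ws0]]
        card_round_edges[OF ws] card_round_edges[OF ws0] by simp
    then have "card (round_edges ws \<union> round_edges ws0) = 2 * n - card (g ws)"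
      unfolding int cg by simp
    moreover have "\<Union>(round_edges ws \<union> round_edges ws0) \<subseteq> prevertices n d"
      using round_points_rounds[OF ws] round_points_rounds[OF ws0]
      by (simp add: Union_Un_distrib Union_round_edges)
    ultimately show ?thesis using card_pairings_containing[OF r m] by simp
  qed
  have "(\<Sum>ws\<in>rounds n d. ?c ws) = (\<Sum>ws\<in>M. ?c ws)"
  proof (rule sum.mono_neutral_right[OF finite_rounds])
    show "\<forall>ws\<in>rounds n d - M. ?c ws = 0"
      using card_pairings_not_matching unfolding M_def by blast
  qed (simp add: M_def)
  also have "\<dots> = (\<Sum>I\<in>Pow {..<n}. \<Sum>ws\<in>{ws \<in> M. g ws = I}. ?c ws)"
    by (rule sum.group[symmetric, OF finM]) (auto simp: g_def)
  also have "\<dots> = (\<Sum>I\<in>Pow {..<n}. card {ws \<in> M. g ws = I} * odd_fact (r - (2 * n - card I)))"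
  proof (rule sum.cong[OF refl])
    fix I assume "I \<in> Pow {..<n}"
    have "(\<Sum>ws\<in>{ws \<in> M. g ws = I}. ?c ws) = (\<Sum>ws\<in>{ws \<in> M. g ws = I}. odd_fact (r - (2 * n - card I)))"
      by (rule sum.cong[OF refl]) (use c in simp)
    then show "(\<Sum>ws\<in>{ws \<in> M. g ws = I}. ?c ws) = card {ws \<in> M. g ws = I} * odd_fact (r - (2 * n - card I))"
      by simp
  qed
  also have "\<dots> = card {ws \<in> M. g ws = {..<n}} * odd_fact (r - (2 * n - card {..<n}))
      + (\<Sum>I\<in>Pow {..<n} - {{..<n}}. card {ws \<in> M. g ws = I} * odd_fact (r - (2 * n - card I)))"
    by (rule sum.remove) auto
  also have "\<dots> \<le> 2 * n * odd_fact (r - n)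
      + (\<Sum>I\<in>Pow {..<n} - {{..<n}}. n * fact (n - card I - 1) * (\<Prod>B\<in>{..<n} - I. block_weight n d I B)
         * odd_fact (r - (2 * n - card I)))"
  proof (rule add_mono)
    have "{ws \<in> M. g ws = {..<n}} \<subseteq> {ws \<in> rounds n d. round_edges ws = round_edges ws0}"
    proof
      fix ws assume ws: "ws \<in> {ws \<in> M. g ws = {..<n}}"
      then have w: "ws \<in> rounds n d" by (simp add: M_def)
      have "round_edges ws \<inter> round_edges ws0 = round_edges ws0" using int[of ws] ws E0 by simp
      then have "round_edges ws0 \<subseteq> round_edges ws" by blast
      then have "round_edges ws0 = round_edges ws"
        using card_subset_eq[OF finite_round_edges] card_round_edges[OF w] card_round_edges[OF ws0] by metis
      then show "ws \<in> {ws \<in> rounds n d. round_edges ws = round_edges ws0}" using w by simp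
    qed
    then have "card {ws \<in> M. g ws = {..<n}} \<le> card {ws \<in> rounds n d. round_edges ws = round_edges ws0}"
      by (rule card_mono[rotated]) (use finite_rounds in simp)
    also have "\<dots> = 2 * n" by (rule card_rounds_same_edges[OF ws0 n])
    finally have "card {ws \<in> M. g ws = {..<n}} \<le> 2 * n" .
    then show "card {ws \<in> M. g ws = {..<n}} * odd_fact (r - (2 * n - card {..<n})) \<le> 2 * n * odd_fact (r - n)"
      by simp
    show "(\<Sum>I\<in>Pow {..<n} - {{..<n}}. card {ws \<in> M. g ws = I} * odd_fact (r - (2 * n - card I)))
      \<le> (\<Sum>I\<in>Pow {..<n} - {{..<n}}. n * fact (n - card I - 1) * (\<Prod>B\<in>{..<n} - I. block_weight n d I B)
         * odd_fact (r - (2 * n - card I)))"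
    proof (rule sum_mono, rule mult_right_mono)
      fix I assume "I \<in> Pow {..<n} - {{..<n}}"
      then interpret overlap n d ws0 I by unfold_locales (use ws0 in auto)
      have e: "overlap.edge n ws0 = edge" by (intro ext) (simp add: edge_def edge_eq)
      have "{ws \<in> M. g ws = I} \<subseteq> A" using int unfolding A_def M_def e by auto
      then have "card {ws \<in> M. g ws = I} \<le> card A" by (rule card_mono[OF finite_A])
      then show "card {ws \<in> M. g ws = I}
          \<le> n * fact (n - card I - 1) * (\<Prod>B\<in>{..<n} - I. block_weight n d I B)"
        using card_A by linarith
    qed simp
  qed
  finally show ?thesis .
qed

lemma sum_round_count_sq:
  assumes r: "n * d = 2 * r" and n: "n > 0"
  shows "(\<Sum>P\<in>pairings n d. (round_count n d P)\<^sup>2)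
    \<le> fact n * (d * (d - 1)) ^ n * (2 * n * odd_fact (r - n) +
      (\<Sum>I\<in>Pow {..<n} - {{..<n}}. n * fact (n - card I - 1) * (\<Prod>B\<in>{..<n} - I. block_weight n d I B)
         * odd_fact (r - (2 * n - card I))))"
proof -
  let ?R = "rounds n d"
  have sq: "(round_count n d P)\<^sup>2 = card {z \<in> ?R \<times> ?R. round_edges (snd z) \<union> round_edges (fst z) \<subseteq> P}" for P
  proof -
    have "{z \<in> ?R \<times> ?R. round_edges (snd z) \<union> round_edges (fst z) \<subseteq> P}
        = {ws \<in> ?R. round_edges ws \<subseteq> P} \<times> {ws \<in> ?R. round_edges ws \<subseteq> P}" by auto
    then show ?thesis by (simp add: round_count_def card_cartesian_product power2_eq_square)
  qed
  have "(\<Sum>P\<in>pairings n d. (round_count n d P)\<^sup>2)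
      = (\<Sum>z\<in>?R \<times> ?R. card {P \<in> pairings n d. round_edges (snd z) \<union> round_edges (fst z) \<subseteq> P})"
    unfolding sq using finite_pairings finite_rounds by (intro sum_card_swap) auto
  also have "\<dots> = (\<Sum>ws0\<in>?R. \<Sum>ws\<in>?R. card {P \<in> pairings n d. round_edges ws \<union> round_edges ws0 \<subseteq> P})"
    by (simp add: sum.cartesian_product case_prod_unfold)
  also have "\<dots> \<le> (\<Sum>ws0\<in>?R. 2 * n * odd_fact (r - n) +
      (\<Sum>I\<in>Pow {..<n} - {{..<n}}. n * fact (n - card I - 1) * (\<Prod>B\<in>{..<n} - I. block_weight n d I B)
         * odd_fact (r - (2 * n - card I))))"
    by (rule sum_mono) (rule card_rounds_overlap[OF r n])
  finally show ?thesis by (simp add: card_rounds)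
qed

section \<open>Sums over cyclic words and their transfer matrix\<close>

definition runs :: "nat \<Rightarrow> nat set \<Rightarrow> nat" where
  "runs n I = card {B \<in> {..<n} - I. (B + n - 1) mod n \<in> I}"

text \<open>\<open>runs n I\<close> counts the paths with at least one edge, and the quotient of
  their weight by that of a lone vertex is 2 (d - 2) / (d - 3).\<close>

lemma prod_block_weight:
  assumes d: "d \<ge> 4" and I: "I \<subseteq> {..<n}"
  shows "real (\<Prod>B\<in>{..<n} - I. block_weight n d I B)
    = ((real d - 2) * (real d - 3)) ^ (n - card I) * (2 * (real d - 2) / (real d - 3)) ^ runs n I"
proof -
  let ?V = "{..<n} - I" and ?c = "(real d - 2) * (real d - 3)" and ?b = "2 * (real d - 2) / (real d - 3)"
  have V: "card ?V = n - card I" using I finite_subset[of I "{..<n}"] by (simp add: card_Diff_subset)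
  have "real (\<Prod>B\<in>?V. block_weight n d I B) = (\<Prod>B\<in>?V. ?c * (if (B + n - 1) mod n \<in> I then ?b else 1))"
    unfolding of_nat_prod
    by (rule prod.cong[OF refl]) (use d in \<open>simp add: block_weight_def of_nat_diff power2_eq_square\<close>)
  also have "\<dots> = ?c ^ (n - card I) * (\<Prod>B\<in>?V. if (B + n - 1) mod n \<in> I then ?b else 1)"
    by (simp add: prod.distrib V)
  also have "(\<Prod>B\<in>?V. if (B + n - 1) mod n \<in> I then ?b else 1) = ?b ^ runs n I"
    unfolding runs_def by (subst prod.If_cases) (simp_all add: Int_def)
  finally show ?thesis .
qed

text \<open>
  \<open>linear_runs a n I\<close> reads \<open>I\<close> as a word of length \<open>n\<close> preceded by the letter \<open>a\<close> and counts the
  letters outside \<open>I\<close> that follow a letter in \<open>I\<close>; the transfer matrix acts on the last letter.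
\<close>

definition linear_runs :: "bool \<Rightarrow> nat \<Rightarrow> nat set \<Rightarrow> nat" where
  "linear_runs a n I = card {i. i < n \<and> i \<notin> I \<and> (if i = 0 then a else i - 1 \<in> I)}"

definition last_letter :: "bool \<Rightarrow> nat \<Rightarrow> nat set \<Rightarrow> bool" where
  "last_letter a n I = (if n = 0 then a else n - 1 \<in> I)"

text \<open>An entry of the n-th power of the transfer matrix: \<open>a\<close> is the letter before
  the word, \<open>e\<close> its last letter, \<open>x\<close> marks the letters in \<open>I\<close>
  and \<open>b\<close> the ends of runs.\<close>

definition transfer :: "real \<Rightarrow> real \<Rightarrow> bool \<Rightarrow> bool \<Rightarrow> nat \<Rightarrow> real" where
  "transfer b x a e n = (\<Sum>I\<in>Pow {..<n}. if last_letter a n I = e then x ^ card I * b ^ linear_runs a n I else 0)"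

lemma sum_Pow_Suc: "(\<Sum>I\<in>Pow {..<Suc n}. f I) = (\<Sum>I\<in>Pow {..<n}. f I + (f (insert n I) :: real))"
proof -
  have "Pow {..<Suc n} = Pow {..<n} \<union> insert n ` Pow {..<n}"
    by (simp add: lessThan_Suc Pow_insert)
  moreover have "Pow {..<n} \<inter> insert n ` Pow {..<n} = {}" by auto
  moreover have "inj_on (insert n) (Pow {..<n})"
    by (rule inj_onI) (metis Pow_iff insert_ident lessThan_iff less_irrefl subsetD)
  ultimately show ?thesis by (simp add: sum.union_disjoint sum.reindex sum.distrib)
qed

lemma linear_runs_Suc:
  assumes "I \<subseteq> {..<n}"
  shows "linear_runs a (Suc n) I = linear_runs a n I + of_bool (last_letter a n I)"
    "linear_runs a (Suc n) (insert n I) = linear_runs a n I"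
proof -
  let ?S = "{i. i < n \<and> i \<notin> I \<and> (if i = 0 then a else i - 1 \<in> I)}"
  have n: "n \<notin> I" using assms by auto
  have "{i. i < Suc n \<and> i \<notin> I \<and> (if i = 0 then a else i - 1 \<in> I)}
      = (if last_letter a n I then insert n ?S else ?S)"
    using n by (auto simp: last_letter_def less_Suc_eq)
  then show "linear_runs a (Suc n) I = linear_runs a n I + of_bool (last_letter a n I)"
    by (simp add: linear_runs_def)
  have "{i. i < Suc n \<and> i \<notin> insert n I \<and> (if i = 0 then a else i - 1 \<in> insert n I)} = ?S"
    by (auto simp: less_Suc_eq)
  then show "linear_runs a (Suc n) (insert n I) = linear_runs a n I" by (simp add: linear_runs_def)
qed

lemma transfer_Suc:
  "transfer b x a True (Suc n) = x * (transfer b x a True n + transfer b x a False n)"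
  "transfer b x a False (Suc n) = b * transfer b x a True n + transfer b x a False n"
proof -
  have last: "last_letter a (Suc n) I = False" "last_letter a (Suc n) (insert n I) = True"
    if "I \<subseteq> {..<n}" for I
    using that by (auto simp: last_letter_def)
  have card: "card (insert n I) = Suc (card I)" if "I \<subseteq> {..<n}" for I
    using that finite_subset[OF that] by (subst card_insert_disjoint) auto
  show "transfer b x a True (Suc n) = x * (transfer b x a True n + transfer b x a False n)"
    unfolding transfer_def sum_Pow_Suc sum.distrib[symmetric] sum_distrib_left
    by (rule sum.cong[OF refl]) (use last card linear_runs_Suc(2) in \<open>auto simp: mult_ac\<close>)
  show "transfer b x a False (Suc n) = b * transfer b x a True n + transfer b x a False n"
    unfolding transfer_def sum_Pow_Suc sum.distrib[symmetric] sum_distrib_left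
    by (rule sum.cong[OF refl]) (use last linear_runs_Suc(1) in \<open>auto simp: mult_ac\<close>)
qed

definition run_sum :: "real \<Rightarrow> nat \<Rightarrow> real \<Rightarrow> real" where
  "run_sum b n x = (\<Sum>I\<in>Pow {..<n}. x ^ card I * b ^ runs n I)"

lemma runs_linear:
  assumes "n > 0" "I \<subseteq> {..<n}"
  shows "runs n I = linear_runs (n - 1 \<in> I) n I"
proof -
  have "(B + n - 1) mod n = (if B = 0 then n - 1 else B - 1)" if "B < n" for B
    using that by (cases B) auto
  then have "{B \<in> {..<n} - I. (B + n - 1) mod n \<in> I}
      = {i. i < n \<and> i \<notin> I \<and> (if i = 0 then n - 1 \<in> I else i - 1 \<in> I)}"
    by auto
  then show ?thesis by (simp add: runs_def linear_runs_def)
qed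

text \<open>A cyclic word is a linear word preceded by its own last letter, which is what makes the
  sum a trace.\<close>

lemma run_sum_transfer:
  assumes "n > 0"
  shows "run_sum b n x = transfer b x True True n + transfer b x False False n"
  unfolding run_sum_def transfer_def sum.distrib[symmetric]
  by (rule sum.cong[OF refl]) (use assms in \<open>auto simp: runs_linear last_letter_def\<close>)

text \<open>The matrix has trace 1 + x and determinant - (b - 1) x. By Cayley-Hamilton the traces of
  its powers satisfy the recursion of the power sums of the eigenvalues.\<close>

lemma run_sum_eigenvalues:
  assumes "n > 0" "l + m = 1 + x" "l * m = - (b - 1) * x"
  shows "run_sum b n x = l ^ n + m ^ n"
proof -
  let ?T = "\<lambda>n. transfer b x True True n + transfer b x False False n"
  have rec: "?T (Suc (Suc n)) = (l + m) * ?T (Suc n) - l * m * ?T n" for n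
    unfolding assms(2,3) by (simp add: transfer_Suc algebra_simps)
  have "?T n = l ^ n + m ^ n \<and> ?T (Suc n) = l ^ Suc n + m ^ Suc n" for n
  proof (induction n)
    case 0
    have "?T 0 = 2" by (simp add: transfer_def last_letter_def linear_runs_def)
    moreover have "transfer b x True True 0 = 1" "transfer b x True False 0 = 0"
        "transfer b x False True 0 = 0" "transfer b x False False 0 = 1"
      by (simp_all add: transfer_def last_letter_def linear_runs_def)
    ultimately show ?case using assms(2) by (simp add: transfer_Suc)
  next
    case (Suc n)
    then show ?case unfolding rec by (simp add: algebra_simps)
  qed
  then show ?thesis using run_sum_transfer[OF assms(1)] by simp
qed

section \<open>The Beta distribution\<close>

definition beta_density :: "real \<Rightarrow> real \<Rightarrow> real \<Rightarrow> real" where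
  "beta_density a b u = indicator {0..1} u * (u powr (a - 1) * (1 - u) powr (b - 1)) / Beta a b"

definition beta_dist :: "real \<Rightarrow> real \<Rightarrow> real measure" where
  "beta_dist a b = density lborel (\<lambda>u. ennreal (beta_density a b u))"

lemma Beta_real_pos: "a > 0 \<Longrightarrow> b > 0 \<Longrightarrow> Beta a b > (0::real)"
  by (simp add: Beta_def Gamma_real_pos)

lemma sets_beta_dist [simp, measurable_cong]: "sets (beta_dist a b) = sets borel"
  by (simp add: beta_dist_def)

lemma space_beta_dist [simp]: "space (beta_dist a b) = UNIV"
  by (simp add: beta_dist_def)

lemma beta_density_measurable [measurable]: "beta_density a b \<in> borel_measurable borel"
  unfolding beta_density_def by measurable

lemma beta_density_nonneg: "a > 0 \<Longrightarrow> b > 0 \<Longrightarrow> beta_density a b u \<ge> 0"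
  using Beta_real_pos[of a b] by (simp add: beta_density_def)

lemma has_bochner_integral_Beta:
  fixes a b :: real
  assumes "a > 0" "b > 0"
  shows "has_bochner_integral lborel (\<lambda>u::real. indicator {0..1} u * (u powr (a - 1) * (1 - u) powr (b - 1))) (Beta a b)"
proof (rule has_bochner_integral_nn_integral)
  show "(\<integral>\<^sup>+ u. ennreal (indicator {0..1} u * (u powr (a - 1) * (1 - u) powr (b - 1))) \<partial>lborel)
      = ennreal (Beta a b)"
    by (rule nn_integral_has_integral_lebesgue[OF _ has_integral_Beta_real[OF assms]]) simp
qed (use Beta_real_pos[OF assms] in auto)

text \<open>The extra factors only shift the parameters of the density. Negative exponents are
  needed, because common edges bring inverse powers of u and 1 - u.\<close>

lemma beta_dist_powr:
  assumes ab: "a > 0" "b > 0" and st: "a + s > 0" "b + t > 0"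
  shows "has_bochner_integral (beta_dist a b) (\<lambda>u. u powr s * (1 - u) powr t) (Beta (a + s) (b + t) / Beta a b)"
  unfolding beta_dist_def
proof (rule has_bochner_integral_density)
  have "has_bochner_integral lborel
      (\<lambda>u. (indicator {0..1} u * (u powr (a + s - 1) * (1 - u) powr (b + t - 1))) / Beta a b)
      (Beta (a + s) (b + t) / Beta a b)"
    by (rule has_bochner_integral_divide_zero[OF has_bochner_integral_Beta[OF st]])
  moreover have "beta_density a b u *\<^sub>R (u powr s * (1 - u) powr t)
      = (indicator {0..1} u * (u powr (a + s - 1) * (1 - u) powr (b + t - 1))) / Beta a b" for u
  proof -
    have "u powr (a + s - 1) = u powr (a - 1) * u powr s"
      "(1 - u) powr (b + t - 1) = (1 - u) powr (b - 1) * (1 - u) powr t"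
      by (simp_all add: algebra_simps flip: powr_add)
    then show ?thesis by (simp add: beta_density_def)
  qed
  ultimately show "has_bochner_integral lborel (\<lambda>u. beta_density a b u *\<^sub>R (u powr s * (1 - u) powr t))
      (Beta (a + s) (b + t) / Beta a b)" by simp
qed (use beta_density_nonneg[OF ab] in auto)

lemma AE_beta_dist:
  assumes "a > 0" "b > 0"
  shows "AE u in beta_dist a b. 0 < u \<and> u < 1"
proof -
  have "AE u in lborel. u \<noteq> (0::real)" "AE u in lborel. u \<noteq> (1::real)" by (rule AE_lborel_singleton)+
  then have "AE u in lborel. 0 < ennreal (beta_density a b u) \<longrightarrow> 0 < u \<and> u < 1"
    by eventually_elim (auto simp: beta_density_def indicator_def split: if_splits)
  then show ?thesis unfolding beta_dist_def by (subst AE_density) auto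
qed

text \<open>Quotients of ordinary powers express exponents of either sign. They agree with
  \<open>powr\<close> strictly inside the unit interval, hence almost everywhere.\<close>

lemma beta_dist_monomial:
  assumes ab: "a > 0" "b > 0" and pq: "a + real p > real q" "b + real p' > real q'"
  shows "has_bochner_integral (beta_dist a b) (\<lambda>u. u ^ p / u ^ q * ((1 - u) ^ p' / (1 - u) ^ q'))
    (Beta (a + real p - real q) (b + real p' - real q') / Beta a b)"
proof -
  have "has_bochner_integral (beta_dist a b) (\<lambda>u. u powr (real p - real q) * (1 - u) powr (real p' - real q'))
      (Beta (a + (real p - real q)) (b + (real p' - real q')) / Beta a b)"
    by (rule beta_dist_powr[OF ab]) (use pq in auto)
  moreover have "AE u in beta_dist a b. u powr (real p - real q) * (1 - u) powr (real p' - real q')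
      = u ^ p / u ^ q * ((1 - u) ^ p' / (1 - u) ^ q')"
    using AE_beta_dist[OF ab] by eventually_elim (simp add: powr_diff powr_realpow)
  ultimately show ?thesis
    by (subst (asm) has_bochner_integral_cong_AE[of _ _ "\<lambda>u. u ^ p / u ^ q * ((1 - u) ^ p' / (1 - u) ^ q')"])
      (auto simp: algebra_simps)
qed

lemma prob_space_beta_dist: "a > 0 \<Longrightarrow> b > 0 \<Longrightarrow> prob_space (beta_dist a b)"
proof (rule prob_spaceI)
  assume ab: "a > 0" "b > 0"
  have "emeasure (beta_dist a b) (space (beta_dist a b)) = (\<integral>\<^sup>+u. ennreal (beta_density a b u) \<partial>lborel)"
    unfolding beta_dist_def by (subst emeasure_density) simp_all
  also have "\<dots> = ennreal 1"
  proof -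
    have "has_bochner_integral lborel
        (\<lambda>u. (indicator {0..1} u * (u powr (a - 1) * (1 - u) powr (b - 1))) / Beta a b) (Beta a b / Beta a b)"
      by (rule has_bochner_integral_divide_zero[OF has_bochner_integral_Beta[OF ab]])
    then have "has_bochner_integral lborel (beta_density a b) 1"
      using Beta_real_pos[OF ab] unfolding beta_density_def by simp
    then have "integrable lborel (beta_density a b)" "integral\<^sup>L lborel (beta_density a b) = 1"
      by (simp_all add: has_bochner_integral_iff)
    then show ?thesis
      using nn_integral_eq_integral[of lborel "beta_density a b"] beta_density_nonneg[OF ab] by simp
  qed
  finally show "emeasure (beta_dist a b) (space (beta_dist a b)) = 1" by simp
qed

lemma Gamma_pochhammer:
  assumes "(z::real) > 0"
  shows "Gamma (z + real k) = pochhammer z k * Gamma z"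
proof -
  have "z \<notin> \<int>\<^sub>\<le>\<^sub>0" using assms by (auto elim!: nonpos_Ints_cases)
  then show ?thesis using pochhammer_Gamma[of z k] Gamma_real_pos[OF assms] by (simp add: field_simps)
qed

lemma beta_dist_power:
  assumes "a > 0" "b > 0"
  shows "has_bochner_integral (beta_dist a b) (\<lambda>u. u ^ k) (pochhammer a k / pochhammer (a + b) k)"
proof -
  have "Beta (a + real k) b / Beta a b = pochhammer a k / pochhammer (a + b) k"
  proof -
    have "Gamma (a + real k + b) = pochhammer (a + b) k * Gamma (a + b)"
      using Gamma_pochhammer[of "a + b" k] assms by (simp add: algebra_simps)
    moreover have "Gamma a > 0" "Gamma b > 0" "Gamma (a + b) > 0"
      using assms by (auto intro!: Gamma_real_pos)
    then have "Gamma a \<noteq> 0" "Gamma b \<noteq> 0" "Gamma (a + b) \<noteq> 0" by auto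
    ultimately show ?thesis
      using assms by (simp add: Beta_def Gamma_pochhammer)
  qed
  then show ?thesis using beta_dist_monomial[OF assms, of 0 k 0 0] assms by simp
qed

lemma beta_dist_inverse_power:
  assumes "a > real k" "b > 0"
  shows "has_bochner_integral (beta_dist a b) (\<lambda>u. 1 / u ^ k)
    (pochhammer (a + b - real k) k / pochhammer (a - real k) k)"
proof -
  have a: "a > 0" using assms by linarith
  have "Gamma a = pochhammer (a - real k) k * Gamma (a - real k)"
    using Gamma_pochhammer[of "a - real k" k] assms by simp
  moreover have "Gamma (a + b) = pochhammer (a + b - real k) k * Gamma (a + b - real k)"
    using Gamma_pochhammer[of "a + b - real k" k] assms by simp
  moreover have "Gamma (a - real k) > 0" "Gamma (a + b - real k) > 0" "Gamma b > 0"
      "pochhammer (a - real k) k > 0" "pochhammer (a + b - real k) k > 0"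
    using assms by (auto intro!: Gamma_real_pos pochhammer_pos)
  moreover have "a - real k + b = a + b - real k" by simp
  ultimately have "Beta (a - real k) b / Beta a b = pochhammer (a + b - real k) k / pochhammer (a - real k) k"
    unfolding Beta_def by (simp add: field_simps)
  then show ?thesis using beta_dist_monomial[OF a assms(2), of k 0 0 0] assms by simp
qed

lemma beta_dist_upper_tail_moment:
  assumes "a > 0" "b > real m"
  shows "has_bochner_integral (beta_dist a b) (\<lambda>u. u ^ k / (1 - u) ^ m)
    (pochhammer a k * pochhammer (a + b - real m + real k) m
      / (pochhammer (b - real m) m * pochhammer (a + b) k))"
proof -
  let ?p = "real k"
  have b: "b > 0" using assms by linarith
  have 1: "Gamma (a + ?p) = pochhammer a k * Gamma a" by (rule Gamma_pochhammer[OF assms(1)])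
  have 2: "Gamma b = pochhammer (b - real m) m * Gamma (b - real m)"
    using Gamma_pochhammer[of "b - real m" m] assms by simp
  have 3: "Gamma (a + b + ?p) = pochhammer (a + b) k * Gamma (a + b)"
    by (rule Gamma_pochhammer) (use assms b in simp)
  have 4: "Gamma (a + b + ?p) = pochhammer (a + b - real m + ?p) m * Gamma (a + b - real m + ?p)"
    using Gamma_pochhammer[of "a + b - real m + ?p" m] assms by (simp add: algebra_simps)
  have pos: "Gamma a > 0" "Gamma (b - real m) > 0" "Gamma (a + b) > 0" "Gamma (a + b - real m + ?p) > 0"
      "pochhammer (b - real m) m > 0" "pochhammer (a + b) k > 0" "pochhammer (a + b - real m + ?p) m > 0"
    using assms b by (auto intro!: Gamma_real_pos pochhammer_pos)
  have e: "a + ?p + (b - real m) = a + b - real m + ?p" by simp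
  \<comment> \<open>Items 3 and 4 expand the same Gamma value from below and from above; comparing
    them removes the Gamma values that do not cancel directly.\<close>
  have g: "Gamma (a + b) = pochhammer (a + b - real m + ?p) m * Gamma (a + b - real m + ?p) / pochhammer (a + b) k"
    using 3 4 pos by (simp add: field_simps)
  have "Beta (a + ?p) (b - real m) / Beta a b
      = (Gamma (a + ?p) * Gamma (b - real m) / Gamma (a + b - real m + ?p)) / (Gamma a * Gamma b / Gamma (a + b))"
    unfolding Beta_def e ..
  also have "\<dots> = pochhammer a k * pochhammer (a + b - real m + ?p) m
      / (pochhammer (b - real m) m * pochhammer (a + b) k)"
    unfolding 1 2 g using pos by (simp add: field_simps)
  finally show ?thesis
    using beta_dist_monomial[OF assms(1) b, of 0 k m 0] assms by (simp add: algebra_simps)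
qed

section \<open>Laplace analysis of the second moment\<close>

lemma prod_le_power_real:
  fixes f :: "nat \<Rightarrow> real"
  assumes "\<And>i. i < k \<Longrightarrow> 0 \<le> f i" "\<And>i. i < k \<Longrightarrow> f i \<le> c"
  shows "(\<Prod>i<k. f i) \<le> c ^ k"
  using prod_mono[of "{..<k}" f "\<lambda>_. c"] assms by simp

lemma pochhammer_prod_less: "pochhammer (a::real) k = (\<Prod>i<k. a + real i)"
  by (simp add: pochhammer_prod atLeast0LessThan)

lemma power_pochhammer_quotient:
  "c ^ k * (pochhammer a k / pochhammer b k) = (\<Prod>i<k. c * ((a + real i) / (b + real i)))"
  unfolding pochhammer_prod_less prod.distrib prod_dividef prod_constant card_lessThan ..

lemma exp_minus_two_le: "0 \<le> y \<Longrightarrow> y \<le> 1 / 2 \<Longrightarrow> exp (- 2 * y) \<le> 1 - (y::real)"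
proof -
  assume y: "0 \<le> y" "y \<le> 1 / 2"
  have "- 2 * y \<le> - y - 2 * y\<^sup>2" using y mult_right_mono[of y "1/2" y] by (simp add: power2_eq_square)
  also have "\<dots> \<le> ln (1 - y)" using ln_one_minus_pos_lower_bound[OF y] .
  finally have "exp (- 2 * y) \<le> exp (ln (1 - y))" by (simp only: exp_le_cancel_iff)
  then show ?thesis using y by simp
qed

lemma exp_half_le: "0 \<le> w \<Longrightarrow> w \<le> 1 / 2 \<Longrightarrow> exp (w / 2) \<le> 1 + (w::real)"
proof -
  assume w: "0 \<le> w" "w \<le> 1 / 2"
  have "w / 2 \<le> w - w\<^sup>2" using w mult_right_mono[of w "1/2" w] by (simp add: power2_eq_square)
  also have "\<dots> \<le> ln (1 + w)" using ln_one_plus_pos_lower_bound[of w] w by simp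
  finally have "exp (w / 2) \<le> exp (ln (1 + w))" by simp
  then show ?thesis using w by simp
qed

locale beta_laplace =
  fixes n :: nat and D :: real
  assumes n: "n \<ge> 8" and D: "D \<ge> 100"
begin

text \<open>The second Beta parameter. If D is the degree d and n d = 2 r, it is r - n + 1 / 2, so
  Gamma values at \<open>A\<close> are double factorials up to powers of 2 and
  \<open>Gamma (1 / 2)\<close>. The mean n / (n + A) is close to 2 / D, from which
  \<open>dev\<close> measures the relative deviation.\<close>

definition A :: real where "A = (real n * (D - 2) + 1) / 2"
definition M :: "real measure" where "M = beta_dist (real n) A"
definition dev :: "real \<Rightarrow> real" where "dev u = u * D / 2 - 1"

lemma n_pos: "real n > 0" using n by simp

lemma A_pos: "A > 0"
  unfolding A_def using D n_pos by (simp add: add_pos_pos)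

lemma nA: "real n + A = (real n * D + 1) / 2"
  by (simp add: A_def field_simps)

lemma sets_M [simp, measurable_cong]: "sets M = sets borel"
  and space_M [simp]: "space M = UNIV"
  by (simp_all add: M_def)

lemma AE_M: "AE u in M. 0 < u \<and> u < 1"
  unfolding M_def by (rule AE_beta_dist[OF n_pos A_pos])

lemma prob_M: "prob_space M"
  unfolding M_def by (rule prob_space_beta_dist[OF n_pos A_pos])

text \<open>Each of the k factors of the Pochhammer quotient, scaled by D / 2, is at most 1 + k /
  n.\<close>

lemma upper_moment:
  shows "integrable M (\<lambda>u. (u * D / 2) ^ k)" "integral\<^sup>L M (\<lambda>u. (u * D / 2) ^ k) \<le> exp (real k ^ 2 / real n)"
proof -
  have eq: "(u * D / 2) ^ k = (D / 2) ^ k * u ^ k" for u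
    by (simp add: power_mult_distrib power_divide)
  have hb: "has_bochner_integral M (\<lambda>u. (u * D / 2) ^ k)
      ((D / 2) ^ k * (pochhammer (real n) k / pochhammer (real n + A) k))"
    unfolding eq M_def by (rule has_bochner_integral_mult_right[OF beta_dist_power[OF n_pos A_pos]])
  show "integrable M (\<lambda>u. (u * D / 2) ^ k)" using hb by (simp add: has_bochner_integral_iff)
  have "(D / 2) ^ k * (pochhammer (real n) k / pochhammer (real n + A) k)
      = (\<Prod>i<k. D / 2 * ((real n + real i) / (real n + A + real i)))"
    by (rule power_pochhammer_quotient)
  also have "\<dots> \<le> exp (real k / real n) ^ k"
  proof (rule prod_le_power_real)
    fix i assume i: "i < k"
    show "0 \<le> D / 2 * ((real n + real i) / (real n + A + real i))" using D A_pos by simp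
    have "D / 2 * ((real n + real i) / (real n + A + real i))
        \<le> D / 2 * ((real n + real i) / (real n * D / 2))"
    proof (intro mult_left_mono divide_left_mono)
      have "real n + A \<ge> real n * D / 2" unfolding nA by simp
      then show "real n * D / 2 \<le> real n + A + real i" by simp
      show "0 < (real n + A + real i) * (real n * D / 2)" using n_pos D A_pos by (simp add: add_pos_nonneg)
    qed (use D in auto)
    also have "\<dots> = 1 + real i / real n" using n_pos D by (simp add: field_simps)
    also have "\<dots> \<le> 1 + real k / real n" using i n_pos by (simp add: divide_right_mono)
    also have "\<dots> \<le> exp (real k / real n)" by (rule exp_ge_add_one_self)
    finally show "D / 2 * ((real n + real i) / (real n + A + real i)) \<le> exp (real k / real n)" .
  qed
  also have "\<dots> = exp (real k ^ 2 / real n)"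
    by (simp add: power2_eq_square flip: exp_of_nat_mult)
  finally show "integral\<^sup>L M (\<lambda>u. (u * D / 2) ^ k) \<le> exp (real k ^ 2 / real n)"
    using hb by (simp add: has_bochner_integral_iff)
qed

text \<open>The scaled factors are now at most 1 / (1 - k / n); \<open>2 * k \<le> n\<close> allows
  this to be bounded by exp (2 k / n).\<close>

lemma lower_moment:
  assumes k: "2 * k \<le> n"
  shows "integrable M (\<lambda>u. (2 / (D * u)) ^ k)"
    "integral\<^sup>L M (\<lambda>u. (2 / (D * u)) ^ k) \<le> exp (2 * real k ^ 2 / real n)"
proof -
  have kn: "real n > real k" using k n by simp
  have eq: "(2 / (D * u)) ^ k = (2 / D) ^ k * (1 / u ^ k)" for u
    by (simp add: power_divide power_mult_distrib)
  have hb: "has_bochner_integral M (\<lambda>u. (2 / (D * u)) ^ k)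
      ((2 / D) ^ k * (pochhammer (real n + A - real k) k / pochhammer (real n - real k) k))"
    unfolding eq M_def by (rule has_bochner_integral_mult_right[OF beta_dist_inverse_power[OF kn A_pos]])
  show "integrable M (\<lambda>u. (2 / (D * u)) ^ k)" using hb by (simp add: has_bochner_integral_iff)
  have "(2 / D) ^ k * (pochhammer (real n + A - real k) k / pochhammer (real n - real k) k)
      = (\<Prod>i<k. 2 / D * ((real n + A - real k + real i) / (real n - real k + real i)))"
    by (rule power_pochhammer_quotient)
  also have "\<dots> \<le> exp (2 * (real k / real n)) ^ k"
  proof (rule prod_le_power_real)
    fix i assume i: "i < k"
    then have i1: "real i + 1 \<le> real k" by linarith
    show "0 \<le> 2 / D * ((real n + A - real k + real i) / (real n - real k + real i))"
      using D A_pos kn by simp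
    have "2 / D * ((real n + A - real k + real i) / (real n - real k + real i))
        \<le> 2 / D * ((real n * D / 2) / (real n - real k))"
    proof (intro mult_left_mono frac_le)
      have "A + real n \<le> real n * D / 2 + 1" using nA by simp
      then show "real n + A - real k + real i \<le> real n * D / 2" using i1 by linarith
    qed (use D kn in auto)
    also have "\<dots> = 1 / (1 - real k / real n)" using D n_pos kn by (simp add: field_simps)
    also have "\<dots> \<le> 1 / exp (- 2 * (real k / real n))"
    proof (intro divide_left_mono)
      show "exp (- 2 * (real k / real n)) \<le> 1 - real k / real n"
        using k n_pos by (intro exp_minus_two_le) (auto simp: field_simps)
    qed (use kn n_pos in \<open>auto simp: field_simps\<close>)
    also have "\<dots> = exp (2 * (real k / real n))" by (simp add: exp_minus field_simps)
    finally show "2 / D * ((real n + A - real k + real i) / (real n - real k + real i)) \<le> exp (2 * (real k / real n))" .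
  qed
  also have "\<dots> = exp (2 * real k ^ 2 / real n)"
    by (simp add: power2_eq_square mult_ac flip: exp_of_nat_mult)
  finally show "integral\<^sup>L M (\<lambda>u. (2 / (D * u)) ^ k) \<le> exp (2 * real k ^ 2 / real n)"
    using hb by (simp add: has_bochner_integral_iff)
qed

text \<open>Controls the region u > 4 / D, about twice the mean, where (D u / 4)^k is at least 1.
  Each of the k factors is at most 5 / 8, while the power of 1 - u costs only a factor 1 + 6 / D for
  each of its n factors.\<close>

lemma right_moment:
  assumes k: "4 * k \<le> n"
  shows "integrable M (\<lambda>u. (D * u / 4) ^ k / (1 - u) ^ n)"
    "integral\<^sup>L M (\<lambda>u. (D * u / 4) ^ k / (1 - u) ^ n) \<le> (5 / 8) ^ k * exp (6 * real n / D)"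
proof -
  have An: "A - real n \<ge> real n * (D - 4) / 2" by (simp add: A_def field_simps)
  have An0: "real n * (D - 4) / 2 > 0" using D n_pos by simp
  have An': "A > real n" using An An0 by linarith
  have eq: "(D * u / 4) ^ k / (1 - u) ^ n = (D / 4) ^ k * (u ^ k / (1 - u) ^ n)" for u
    by (simp add: power_divide power_mult_distrib)
  let ?m = "pochhammer (real n) k * pochhammer (real n + A - real n + real k) n
      / (pochhammer (A - real n) n * pochhammer (real n + A) k)"
  have hb: "has_bochner_integral M (\<lambda>u. (D * u / 4) ^ k / (1 - u) ^ n) ((D / 4) ^ k * ?m)"
    unfolding eq M_def by (rule has_bochner_integral_mult_right[OF beta_dist_upper_tail_moment[OF n_pos An']])
  show "integrable M (\<lambda>u. (D * u / 4) ^ k / (1 - u) ^ n)" using hb by (simp add: has_bochner_integral_iff)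
  have "(D / 4) ^ k * ?m = (\<Prod>i<k. D / 4 * ((real n + real i) / (real n + A + real i)))
      * (\<Prod>i<n. (A + real k + real i) / (A - real n + real i))"
  proof -
    have "(\<Prod>i<n. (A + real k + real i) / (A - real n + real i))
        = pochhammer (A + real k) n / pochhammer (A - real n) n"
      using power_pochhammer_quotient[of 1 n "A + real k" "A - real n"] by simp
    then show ?thesis unfolding power_pochhammer_quotient[symmetric] by (simp add: mult_ac)
  qed
  also have "\<dots> \<le> (5 / 8) ^ k * exp (6 / D) ^ n"
  proof (intro mult_mono prod_le_power_real)
    fix i assume i: "i < k"
    show "0 \<le> D / 4 * ((real n + real i) / (real n + A + real i))" using D A_pos by simp
    have "D / 4 * ((real n + real i) / (real n + A + real i)) \<le> D / 4 * ((5 / 4 * real n) / (real n * D / 2))"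
    proof (intro mult_left_mono frac_le)
      show "real n + real i \<le> 5 / 4 * real n" using i k by simp
      have "real n + A \<ge> real n * D / 2" unfolding nA by simp
      then show "real n * D / 2 \<le> real n + A + real i" by simp
    qed (use D n_pos in auto)
    also have "\<dots> = 5 / 8" using D n_pos by (simp add: field_simps)
    finally show "D / 4 * ((real n + real i) / (real n + A + real i)) \<le> 5 / 8" .
  next
    fix i assume i: "i < n"
    show "0 \<le> (A + real k + real i) / (A - real n + real i)" using A_pos An' by simp
    have "(A + real k + real i) / (A - real n + real i) = 1 + (real k + real n) / (A - real n + real i)"
      using An' by (simp add: field_simps)
    also have "\<dots> \<le> 1 + (5 / 4 * real n) / (real n * (D - 4) / 2)"
    proof (intro add_left_mono frac_le)
      show "real k + real n \<le> 5 / 4 * real n" using k by simp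
      show "real n * (D - 4) / 2 \<le> A - real n + real i" using An by simp
    qed (use An0 in auto)
    also have "(5 / 4 * real n) / (real n * (D - 4) / 2) = (5 / 2) / (D - 4)"
      using n_pos D by (simp add: field_simps)
    also have "1 + (5 / 2) / (D - 4) \<le> 1 + 6 / D" using D by (simp add: field_simps)
    also have "\<dots> \<le> exp (6 / D)" by (rule exp_ge_add_one_self)
    finally show "(A + real k + real i) / (A - real n + real i) \<le> exp (6 / D)" by simp
  qed (use A_pos An' in \<open>auto intro!: prod_nonneg\<close>)
  also have "exp (6 / D) ^ n = exp (6 * real n / D)"
    by (simp add: mult_ac flip: exp_of_nat_mult)
  finally show "integral\<^sup>L M (\<lambda>u. (D * u / 4) ^ k / (1 - u) ^ n) \<le> (5 / 8) ^ k * exp (6 * real n / D)"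
    using hb by (simp add: has_bochner_integral_iff)
qed

text \<open>The leading constant 1 matters here: multiplied by n K with K close to 2 / D, it becomes
  the term 2 / D in the ratio of the moments.\<close>

lemma dev_sq:
  shows "integrable M (\<lambda>u. dev u ^ 2)" "integral\<^sup>L M (\<lambda>u. dev u ^ 2) \<le> (1 + 2 / D) / real n"
proof -
  interpret prob_space M by (rule prob_M)
  have eq: "dev u ^ 2 = (D / 2) ^ 2 * u ^ 2 - D * u ^ 1 + 1" for u
    by (simp add: dev_def power2_eq_square field_simps)
  let ?I = "(D / 2) ^ 2 * (pochhammer (real n) 2 / pochhammer (real n + A) 2)
      - D * (pochhammer (real n) 1 / pochhammer (real n + A) 1) + 1"
  have one: "has_bochner_integral M (\<lambda>u. 1) (1::real)"
    using prob_space by (simp add: has_bochner_integral_iff)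
  have hb: "has_bochner_integral M (\<lambda>u. dev u ^ 2) ?I"
    unfolding eq
    by (intro has_bochner_integral_add has_bochner_integral_diff has_bochner_integral_mult_right one)
      (unfold M_def, (rule beta_dist_power[OF n_pos A_pos])+)
  show "integrable M (\<lambda>u. dev u ^ 2)" using hb by (simp add: has_bochner_integral_iff)
  have nD: "real n * D > 0" using n_pos D by simp
  have "(D / 2) ^ 2 * (pochhammer (real n) 2 / pochhammer (real n + A) 2) \<le> 1 + 1 / real n"
  proof -
    let ?N = "real n * D / 2"
    have N: "?N > 0" using nD by simp
    have "(D / 2) ^ 2 * (pochhammer (real n) 2 / pochhammer (real n + A) 2)
        = (D / 2) ^ 2 * (real n * (real n + 1)) / ((real n + A) * (real n + A + 1))"
      by (simp add: pochhammer_prod_less numeral_2_eq_2)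
    also have "\<dots> \<le> (D / 2) ^ 2 * (real n * (real n + 1)) / (?N * ?N)"
    proof (intro divide_left_mono mult_mono)
      show "?N \<le> real n + A" "?N \<le> real n + A + 1" unfolding nA by (simp_all add: add_divide_distrib)
      show "0 < (real n + A) * (real n + A + 1) * (?N * ?N)"
        using N A_pos by (intro mult_pos_pos) auto
    qed (use N A_pos in auto)
    also have "\<dots> = 1 + 1 / real n" using n_pos D by (simp add: power2_eq_square field_simps)
    finally show ?thesis .
  qed
  moreover have "D * (pochhammer (real n) 1 / pochhammer (real n + A) 1) \<ge> 2 - 2 / (real n * D)"
  proof -
    have "D * (pochhammer (real n) 1 / pochhammer (real n + A) 1) = 2 * (real n * D) / (real n * D + 1)"
      unfolding nA by simp
    also have "\<dots> = 2 - 2 / (real n * D + 1)" using nD by (simp add: field_simps)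
    also have "\<dots> \<ge> 2 - 2 / (real n * D)" using nD by (intro diff_left_mono divide_left_mono) (auto simp: add_pos_pos)
    finally show ?thesis .
  qed
  ultimately have "?I \<le> 1 / real n + 2 / (real n * D)" by linarith
  also have "\<dots> = (1 + 2 / D) / real n" using n_pos D by (simp add: field_simps)
  finally show "integral\<^sup>L M (\<lambda>u. dev u ^ 2) \<le> (1 + 2 / D) / real n"
    using hb by (simp add: has_bochner_integral_iff)
qed

lemma markov:
  assumes "integrable M f" "\<And>u. 0 < u \<Longrightarrow> u < 1 \<Longrightarrow> P u \<Longrightarrow> 1 \<le> f u" "\<And>u. 0 < u \<Longrightarrow> u < 1 \<Longrightarrow> 0 \<le> f u"
    and [measurable]: "Measurable.pred borel P"
  shows "measure M {u. P u} \<le> integral\<^sup>L M f"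
proof -
  interpret prob_space M by (rule prob_M)
  have "measure M {u. P u} = integral\<^sup>L M (indicator {u. P u})" by simp
  also have "\<dots> \<le> integral\<^sup>L M f"
  proof (rule integral_mono_AE[OF _ assms(1)])
    show "integrable M (indicator {u. P u} :: real \<Rightarrow> real)"
      by (rule integrable_real_indicator) (auto simp: emeasure_eq_measure)
    show "AE u in M. indicator {u. P u} u \<le> f u"
      using AE_M by eventually_elim (use assms(2,3) in \<open>auto simp: indicator_def\<close>)
  qed
  finally show ?thesis .
qed

lemma dev_tail:
  assumes w: "0 \<le> w" "w \<le> 1 / 2"
  shows "measure M {u. w \<le> \<bar>dev u\<bar>} \<le> 4 * exp (- (real n * w\<^sup>2 / 16))"
proof -
  interpret prob_space M by (rule prob_M)
  have [measurable]: "dev \<in> borel_measurable borel" unfolding dev_def by measurable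
  \<comment> \<open>This choice balances the moment bound exp (k^2 / n) against the gain exp (- k w
    / 2) from Markov's inequality: k^2 / n is at most k w / 4, so the exponent is at most - k w /
    4.\<close>
  define k where "k = nat \<lfloor>real n * w / 4\<rfloor>"
  have k1: "real k \<le> real n * w / 4" using w of_int_floor_le[of "real n * w / 4"] by (simp add: k_def)
  have k2: "real k \<ge> real n * w / 4 - 1"
  proof -
    have "real k = of_int \<lfloor>real n * w / 4\<rfloor>" using w by (simp add: k_def)
    then show ?thesis by linarith
  qed
  have kn: "2 * k \<le> n"
  proof -
    have "real n * w \<le> real n * (1 / 2)" using w by (intro mult_left_mono) auto
    then have "real (2 * k) \<le> real n" using k1 n_pos unfolding of_nat_mult of_nat_numeral by linarith
    then show ?thesis by linarith
  qed
  have kk: "real k ^ 2 / real n \<le> real k * w / 4"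
  proof -
    have "real k * real k \<le> real k * (real n * w / 4)" using k1 by (intro mult_left_mono) auto
    then show ?thesis using n_pos by (simp add: power2_eq_square field_simps)
  qed
  \<comment> \<open>Rounding k down costs w / 4 in the exponent, at most 1 / 8; the constant 2 in
    each of the one-sided bounds absorbs it.\<close>
  have kw: "real k * w / 4 \<ge> real n * w\<^sup>2 / 16 - 1 / 8"
  proof -
    have "(real n * w / 4 - 1) * w \<le> real k * w" using k2 w by (intro mult_right_mono) auto
    then have "real n * w\<^sup>2 / 4 - w \<le> real k * w" by (simp add: power2_eq_square field_simps)
    then show ?thesis using w by linarith
  qed
  have e2: "exp (- (real n * w\<^sup>2 / 16) + 1 / 8) \<le> 2 * exp (- (real n * w\<^sup>2 / 16))"
  proof -
    have "exp (1 / 8 :: real) \<le> 2" using exp_half_le[of "1/4"] by simp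
    then have "exp (- (real n * w\<^sup>2 / 16)) * exp (1 / 8) \<le> exp (- (real n * w\<^sup>2 / 16)) * 2"
      by (rule mult_left_mono) simp
    then show ?thesis unfolding exp_add by simp
  qed
  have up: "measure M {u. w \<le> dev u} \<le> 2 * exp (- (real n * w\<^sup>2 / 16))"
  proof -
    have "measure M {u. w \<le> dev u} \<le> integral\<^sup>L M (\<lambda>u. (u * D / 2) ^ k * exp (- (real k * w / 2)))"
    proof (rule markov)
      show "integrable M (\<lambda>u. (u * D / 2) ^ k * exp (- (real k * w / 2)))"
        using upper_moment(1)[of k] by simp
      fix u :: real assume u: "0 < u" "u < 1"
      show "0 \<le> (u * D / 2) ^ k * exp (- (real k * w / 2))" using u D by simp
      assume "w \<le> dev u"
      then have "1 + w \<le> u * D / 2" by (simp add: dev_def)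
      then have "exp (w / 2) \<le> u * D / 2" using exp_half_le[OF w] by linarith
      then have "exp (w / 2) ^ k \<le> (u * D / 2) ^ k" by (intro power_mono) auto
      then have "exp (real k * w / 2) \<le> (u * D / 2) ^ k" by (simp flip: exp_of_nat_mult)
      then have "exp (real k * w / 2) * exp (- (real k * w / 2)) \<le> (u * D / 2) ^ k * exp (- (real k * w / 2))"
        by (rule mult_right_mono) simp
      then show "1 \<le> (u * D / 2) ^ k * exp (- (real k * w / 2))" by (simp flip: exp_add)
    qed measurable
    also have "\<dots> = integral\<^sup>L M (\<lambda>u. (u * D / 2) ^ k) * exp (- (real k * w / 2))" by simp
    also have "\<dots> \<le> exp (real k ^ 2 / real n) * exp (- (real k * w / 2))"
      using upper_moment(2) by (intro mult_right_mono) auto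
    also have "\<dots> \<le> exp (- (real n * w\<^sup>2 / 16) + 1 / 8)"
      using kk kw by (simp flip: exp_add)
    finally show ?thesis using e2 by linarith
  qed
  have lo: "measure M {u. dev u \<le> - w} \<le> 2 * exp (- (real n * w\<^sup>2 / 16))"
  proof -
    have "measure M {u. dev u \<le> - w} \<le> integral\<^sup>L M (\<lambda>u. (2 / (D * u)) ^ k * exp (- (real k * w)))"
    proof (rule markov)
      show "integrable M (\<lambda>u. (2 / (D * u)) ^ k * exp (- (real k * w)))"
        using lower_moment(1)[OF kn] by simp
      fix u :: real assume u: "0 < u" "u < 1"
      show "0 \<le> (2 / (D * u)) ^ k * exp (- (real k * w))" using u D by simp
      assume "dev u \<le> - w"
      then have "u * D / 2 \<le> 1 - w" by (simp add: dev_def)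
      also have "1 - w \<le> exp (- w)" using exp_ge_add_one_self[of "- w"] by simp
      finally have "1 / exp (- w) \<le> 1 / (u * D / 2)" using u D by (intro divide_left_mono) auto
      then have "exp w \<le> 2 / (D * u)" by (simp add: exp_minus field_simps)
      then have "exp w ^ k \<le> (2 / (D * u)) ^ k" by (intro power_mono) auto
      then have "exp (real k * w) \<le> (2 / (D * u)) ^ k" by (simp flip: exp_of_nat_mult)
      then have "exp (real k * w) * exp (- (real k * w)) \<le> (2 / (D * u)) ^ k * exp (- (real k * w))"
        by (rule mult_right_mono) simp
      then show "1 \<le> (2 / (D * u)) ^ k * exp (- (real k * w))" by (simp flip: exp_add)
    qed measurable
    also have "\<dots> = integral\<^sup>L M (\<lambda>u. (2 / (D * u)) ^ k) * exp (- (real k * w))" by simp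
    also have "\<dots> \<le> exp (2 * real k ^ 2 / real n) * exp (- (real k * w))"
      using lower_moment(2)[OF kn] by (intro mult_right_mono) auto
    also have "\<dots> \<le> exp (- (real n * w\<^sup>2 / 16) + 1 / 8)"
    proof -
      have "2 * real k ^ 2 / real n = 2 * (real k ^ 2 / real n)" by simp
      moreover have "0 \<le> real k * w" using w by simp
      ultimately show ?thesis using kk kw by (simp flip: exp_add)
    qed
    finally show ?thesis using e2 by linarith
  qed
  have "measure M {u. w \<le> \<bar>dev u\<bar>} \<le> measure M ({u. w \<le> dev u} \<union> {u. dev u \<le> - w})"
    by (rule finite_measure_mono) auto
  also have "\<dots> \<le> measure M {u. w \<le> dev u} + measure M {u. dev u \<le> - w}"
    by (rule measure_Un_le) auto
  finally show ?thesis using up lo by linarith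
qed

end

text \<open>Bounds the expectation of Q^2 exp (K Q) for Q = n dev^2 and K \<le> 1 / 32 on the
  central region by unit shells: for r \<le> Q \<le> r + 1 the value is at most (r + 1)^2 exp ((r +
  1) / 32), and Q \<ge> r has probability at most 4 exp (- r / 16).\<close>

definition tail_const :: real where
  "tail_const = 4 * (\<Sum>r. (real r + 1)\<^sup>2 * exp ((real r + 1) / 32 - real r / 16))"

lemma summable_tail_const: "summable (\<lambda>r. (real r + 1)\<^sup>2 * exp ((real r + 1) / 32 - real r / 16))"
proof (rule summable_comparison_test_bigo)
  show "summable (\<lambda>r. norm (inverse (real r ^ 2)))"
    using inverse_power_summable[of 2, where 'a = real] by simp
  show "(\<lambda>r. (real r + 1)\<^sup>2 * exp ((real r + 1) / 32 - real r / 16)) \<in> O(\<lambda>r. inverse (real r ^ 2))"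
    by real_asymp
qed

lemma exp_le_quadratic: "0 \<le> y \<Longrightarrow> exp y \<le> 1 + y + y\<^sup>2 * exp (y::real)"
proof -
  assume y: "0 \<le> y"
  have "exp y * exp (- y) \<ge> exp y * (1 - y)"
    using exp_ge_add_one_self[of "- y"] by (intro mult_left_mono) auto
  then have 1: "exp y - 1 \<le> y * exp y" by (simp add: algebra_simps flip: exp_add)
  then have "y * (exp y - 1) \<le> y * (y * exp y)" using y by (intro mult_left_mono) auto
  then show ?thesis using 1 by (simp add: algebra_simps power2_eq_square)
qed

text \<open>The polynomial condition says that (s - l) (s - m) is nonnegative for the eigenvalues l
  \<ge> 1 and m \<le> 0, so s is at least l. As the product of l and the modulus of m is at most 1 /
  2, that modulus is at most 1 / 2 and hence at most s / 2.\<close>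

lemma eigenvalue_bound:
  fixes b x s :: real
  assumes "b > 1" "x > 0" "s > 0" "s\<^sup>2 - (1 + x) * s - (b - 1) * x \<ge> 0" "(b - 1) * x \<le> 1 / 2"
  obtains l m where "l + m = 1 + x" "l * m = - (b - 1) * x" "l ^ n + m ^ n \<le> (1 + (1 / 2) ^ n) * s ^ n"
proof -
  define \<Delta> where "\<Delta> = (1 + x)\<^sup>2 + 4 * (b - 1) * x"
  define l m where "l = (1 + x + sqrt \<Delta>) / 2" and "m = (1 + x - sqrt \<Delta>) / 2"
  have bx: "(b - 1) * x > 0" using assms by simp
  have D0: "\<Delta> \<ge> (1 + x)\<^sup>2" unfolding \<Delta>_def using bx by (simp only: mult.assoc)
  then have D1: "\<Delta> \<ge> 0" using zero_le_power2[of "1 + x"] by linarith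
  have sq: "sqrt \<Delta> \<ge> 1 + x" using D0 by (rule real_le_rsqrt)
  have lm: "l + m = 1 + x" by (simp add: l_def m_def field_simps)
  have "l * m = ((1 + x)\<^sup>2 - (sqrt \<Delta>)\<^sup>2) / 4"
    by (simp add: l_def m_def field_simps power2_eq_square)
  also have "\<dots> = - (b - 1) * x" unfolding real_sqrt_pow2[OF D1] by (simp add: \<Delta>_def field_simps)
  finally have p: "l * m = - (b - 1) * x" .
  have l1: "l \<ge> 1" using sq assms(2) by (simp add: l_def)
  have m0: "m \<le> 0" using sq by (simp add: m_def)
  have "(s - l) * (s - m) = s\<^sup>2 - (l + m) * s + l * m" by (simp add: algebra_simps power2_eq_square)
  then have "(s - l) * (s - m) \<ge> 0" using assms(4) unfolding lm p by (simp add: algebra_simps)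
  moreover have "s - m > 0" using assms(3) m0 by simp
  ultimately have ls: "l \<le> s" by (simp add: zero_le_mult_iff)
  have "l * \<bar>m\<bar> = (b - 1) * x" using p m0 by (simp add: abs_of_nonpos algebra_simps)
  then have "l * \<bar>m\<bar> \<le> 1 / 2" using assms(5) by simp
  moreover have "1 * \<bar>m\<bar> \<le> l * \<bar>m\<bar>" using l1 by (intro mult_right_mono) auto
  ultimately have "\<bar>m\<bar> \<le> s / 2" using l1 ls by linarith
  then have "\<bar>m\<bar> ^ n \<le> (s / 2) ^ n" by (intro power_mono) auto
  moreover have "m ^ n \<le> \<bar>m\<bar> ^ n" by (metis abs_ge_self power_abs)
  moreover have "l ^ n \<le> s ^ n" using ls l1 by (intro power_mono) auto
  ultimately have "l ^ n + m ^ n \<le> (1 + (1 / 2) ^ n) * s ^ n"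
    by (simp add: power_divide algebra_simps)
  then show thesis using that lm p by blast
qed

context beta_laplace
begin

lemma dev_measurable [measurable]: "dev \<in> borel_measurable borel"
  unfolding dev_def by measurable

text \<open>An expansion in K with exact first order and a remainder of order K^2. As K is of order
  1 / D, a bound by a constant factor would destroy the term 2 / D. The condition K \<le> 1 / 32
  makes the exponential grow more slowly than the tail exp (- Q / 16) of Q = n dev^2 decays.\<close>

lemma exp_dev_sq:
  assumes K: "0 \<le> K" "K \<le> 1 / 32" and \<eta>: "0 \<le> \<eta>" "\<eta> \<le> 1 / 4"
  shows "integrable M (\<lambda>u. indicator {u. \<bar>dev u\<bar> \<le> \<eta>} u * exp (K * (real n * dev u ^ 2)))" (is ?I)
    "integral\<^sup>L M (\<lambda>u. indicator {u. \<bar>dev u\<bar> \<le> \<eta>} u * exp (K * (real n * dev u ^ 2)))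
      \<le> 1 + K * (1 + 2 / D) + K\<^sup>2 * tail_const"
proof -
  interpret prob_space M by (rule prob_M)
  let ?Q = "\<lambda>u. real n * dev u ^ 2"
  let ?a = "\<lambda>r::nat. (real r + 1)\<^sup>2 * exp ((real r + 1) / 32)"
  \<comment> \<open>For dev u at most 1 / 4 in modulus Q is at most n / 16, so the shells r < R
    cover the region, and \<open>dev_tail\<close> is applied in its admissible range only.\<close>
  define R where "R = Suc (nat \<lfloor>real n / 16\<rfloor>)"
  let ?S = "\<lambda>u. \<Sum>r<R. ?a r * indicator {u. real r \<le> ?Q u} u"
  have Q16: "?Q u \<le> real n / 16" if "\<bar>dev u\<bar> \<le> \<eta>" for u
  proof -
    have "dev u ^ 2 \<le> (1 / 4)\<^sup>2" using that \<eta> by (intro abs_le_square_iff[THEN iffD1]) auto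
    then have "real n * dev u ^ 2 \<le> real n * (1 / 4)\<^sup>2" by (intro mult_left_mono) auto
    then show ?thesis by (simp add: power2_eq_square)
  qed
  have ptw: "indicator {u. \<bar>dev u\<bar> \<le> \<eta>} u * exp (K * ?Q u) \<le> 1 + K * ?Q u + K\<^sup>2 * ?S u" for u
  proof (cases "\<bar>dev u\<bar> \<le> \<eta>")
    case True
    define r where "r = nat \<lfloor>?Q u\<rfloor>"
    have Q0: "?Q u \<ge> 0" by simp
    have r1: "real r \<le> ?Q u" using of_int_floor_le[of "?Q u"] Q0 by (simp add: r_def)
    have r2: "?Q u \<le> real r + 1"
    proof -
      have "real r = of_int \<lfloor>?Q u\<rfloor>" by (simp add: r_def)
      then show ?thesis by linarith
    qed
    have rR: "r < R" using Q16[OF True] by (simp add: r_def R_def less_Suc_eq_le nat_mono floor_mono)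
    have "?Q u ^ 2 * exp (K * ?Q u) \<le> ?a r"
    proof (intro mult_mono)
      show "?Q u ^ 2 \<le> (real r + 1)\<^sup>2" using r2 Q0 by (intro power_mono) auto
      have "K * ?Q u \<le> 1 / 32 * (real r + 1)" using K r2 Q0 by (intro mult_mono) auto
      then show "exp (K * ?Q u) \<le> exp ((real r + 1) / 32)" by simp
    qed auto
    also have "\<dots> = ?a r * indicator {u. real r \<le> ?Q u} u" using r1 by simp
    also have "\<dots> \<le> ?S u"
      by (rule member_le_sum[where f = "\<lambda>r. ?a r * indicator {u. real r \<le> ?Q u} u"]) (use rR in auto)
    finally have "?Q u ^ 2 * exp (K * ?Q u) \<le> ?S u" .
    then have "K\<^sup>2 * (?Q u ^ 2 * exp (K * ?Q u)) \<le> K\<^sup>2 * ?S u" by (intro mult_left_mono) auto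
    moreover have "exp (K * ?Q u) \<le> 1 + K * ?Q u + (K * ?Q u)\<^sup>2 * exp (K * ?Q u)"
      using K by (intro exp_le_quadratic) auto
    ultimately show ?thesis using True by (simp add: power_mult_distrib mult_ac)
  next
    case False
    then show ?thesis using K by (auto intro!: add_nonneg_nonneg mult_nonneg_nonneg sum_nonneg)
  qed
  have int_ind: "integrable M (indicator {u. real r \<le> ?Q u} :: real \<Rightarrow> real)" for r
    by (rule integrable_real_indicator) (auto simp: emeasure_eq_measure)
  have intS: "integrable M ?S" using int_ind by (intro Bochner_Integration.integrable_sum integrable_mult_right) auto
  have intT: "integrable M (\<lambda>u. 1 + K * ?Q u + K\<^sup>2 * ?S u)"
    using dev_sq(1) intS by (intro Bochner_Integration.integrable_add integrable_mult_right) auto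
  show ?I
  proof (rule Bochner_Integration.integrable_bound[OF intT])
    show "AE u in M. norm (indicator {u. \<bar>dev u\<bar> \<le> \<eta>} u * exp (K * ?Q u)) \<le> norm (1 + K * ?Q u + K\<^sup>2 * ?S u)"
    proof (rule AE_I2)
      fix u
      have "0 \<le> indicator {u. \<bar>dev u\<bar> \<le> \<eta>} u * exp (K * ?Q u)" by simp
      then show "norm (indicator {u. \<bar>dev u\<bar> \<le> \<eta>} u * exp (K * ?Q u)) \<le> norm (1 + K * ?Q u + K\<^sup>2 * ?S u)"
        using ptw[of u] unfolding real_norm_def by linarith
    qed
  qed measurable
  have tail: "measure M {u. real r \<le> ?Q u} \<le> 4 * exp (- (real r / 16))" if r: "r < R" for r
  proof -
    let ?w = "sqrt (real r / real n)"
    have rn: "real r \<le> real n / 16"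
    proof -
      have "real r \<le> real (nat \<lfloor>real n / 16\<rfloor>)"
        using r[unfolded R_def] by (simp only: of_nat_le_iff less_Suc_eq_le)
      also have "\<dots> \<le> real n / 16" using of_int_floor_le[of "real n / 16"] by simp
      finally show ?thesis .
    qed
    have "real r / real n \<le> (1 / 2)\<^sup>2" using rn n_pos by (simp add: field_simps power2_eq_square)
    then have "?w \<le> 1 / 2" by (intro real_le_lsqrt) auto
    then have w: "0 \<le> ?w" "?w \<le> 1 / 2" by auto
    have "{u. real r \<le> ?Q u} \<subseteq> {u. ?w \<le> \<bar>dev u\<bar>}"
    proof
      fix u assume "u \<in> {u. real r \<le> ?Q u}"
      then have "real r / real n \<le> \<bar>dev u\<bar>\<^sup>2" using n_pos by (simp add: field_simps)
      then have "?w \<le> \<bar>dev u\<bar>" by (rule real_le_lsqrt[rotated]) simp_all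
      then show "u \<in> {u. ?w \<le> \<bar>dev u\<bar>}" by simp
    qed
    then have "measure M {u. real r \<le> ?Q u} \<le> measure M {u. ?w \<le> \<bar>dev u\<bar>}"
      by (rule finite_measure_mono) simp
    also have "\<dots> \<le> 4 * exp (- (real n * ?w\<^sup>2 / 16))" by (rule dev_tail[OF w])
    also have "real n * ?w\<^sup>2 = real r" using n_pos by simp
    finally show ?thesis .
  qed
  have "integral\<^sup>L M (\<lambda>u. indicator {u. \<bar>dev u\<bar> \<le> \<eta>} u * exp (K * ?Q u))
      \<le> integral\<^sup>L M (\<lambda>u. 1 + K * ?Q u + K\<^sup>2 * ?S u)"
    by (rule integral_mono[OF \<open>?I\<close> intT]) (use ptw in auto)
  also have "\<dots> = 1 + K * (real n * integral\<^sup>L M (\<lambda>u. dev u ^ 2)) + K\<^sup>2 * integral\<^sup>L M ?S"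
    using dev_sq(1) intS prob_space by (subst Bochner_Integration.integral_add; simp)+
  also have "integral\<^sup>L M ?S = (\<Sum>r<R. ?a r * measure M {u. real r \<le> ?Q u})"
    using int_ind by (subst Bochner_Integration.integral_sum) auto
  also have "1 + K * (real n * integral\<^sup>L M (\<lambda>u. dev u ^ 2)) + K\<^sup>2 * (\<Sum>r<R. ?a r * measure M {u. real r \<le> ?Q u})
      \<le> 1 + K * (1 + 2 / D) + K\<^sup>2 * tail_const"
  proof (intro add_mono mult_left_mono order_refl)
    show "real n * integral\<^sup>L M (\<lambda>u. dev u ^ 2) \<le> 1 + 2 / D"
      using dev_sq(2) n_pos by (simp add: field_simps)
    have "(\<Sum>r<R. ?a r * measure M {u. real r \<le> ?Q u}) \<le> (\<Sum>r<R. ?a r * (4 * exp (- (real r / 16))))"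
      using tail by (intro sum_mono mult_left_mono) auto
    also have "\<dots> = 4 * (\<Sum>r<R. (real r + 1)\<^sup>2 * exp ((real r + 1) / 32 - real r / 16))"
      unfolding sum_distrib_left exp_diff by (rule sum.cong[OF refl]) (simp add: exp_minus field_simps)
    also have "\<dots> \<le> tail_const"
      unfolding tail_const_def using summable_tail_const by (intro mult_left_mono sum_le_suminf) auto
    finally show "(\<Sum>r<R. ?a r * measure M {u. real r \<le> ?Q u}) \<le> tail_const" .
  qed (use K in auto)
  finally show "integral\<^sup>L M (\<lambda>u. indicator {u. \<bar>dev u\<bar> \<le> \<eta>} u * exp (K * ?Q u))
      \<le> 1 + K * (1 + 2 / D) + K\<^sup>2 * tail_const" .
qed

section \<open>The dominant eigenvalue as a function of the Beta variable\<close>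

definition cc :: real where "cc = (D - 2) * (D - 3) / 2"
definition cp :: real where "cp = D * (D - 1) / 2"
definition bb :: real where "bb = 2 * (D - 2) / (D - 3)"
text \<open>Each common edge removes one block, hence a factor \<open>cc\<close>, and shifts the two
  Beta parameters by one in opposite directions, which is the factor (1 - u) / u under the integral.
  The halves in \<open>cc\<close> and \<open>cp\<close> absorb the powers of 2 between double
  factorials and Gamma values.\<close>

definition xx :: "real \<Rightarrow> real" where "xx u = (1 - u) / (cc * u)"
text \<open>The coefficient of r - 1 when the quadratic a r^2 - \<beta> r - (D - 2) in the proof of
  \<open>eigenvalue_quadratic\<close> is expanded at r = 1, with v in place of \<open>dev u\<close>.
  The value of that quadratic at r = 1 is - 2 (D - 1) v^2, which the growth in r has to
  compensate.\<close>

definition curv :: "real \<Rightarrow> real" where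
  "curv v = D * (D - 2) + (D - 1) * (D - 4) * v - 4 * (D - 1) * v\<^sup>2"

lemma consts_pos: "cc > 0" "cp > 0" "bb > 1"
  using D by (auto simp: cc_def cp_def bb_def)

lemma bb_cc: "(bb - 1) * cc = (D - 1) * (D - 2) / 2"
  using D by (simp add: bb_def cc_def field_simps)

text \<open>
  The largest eigenvalue at \<open>xx u\<close>, divided by \<open>(cp / cc) * (1 - u)\<close>, has the value 1 and a
  vanishing derivative at \<open>u = 2 / D\<close>, where \<open>dev u = 0\<close>; \<open>curv\<close> controls its growth.
\<close>

lemma eigenvalue_quadratic:
  assumes u: "0 < u" "u < 1" and K: "K \<ge> 0" "K * curv (dev u) \<ge> 2 * (D - 1)"
  defines "s \<equiv> cp * (1 - u) / cc * (1 + K * (dev u)\<^sup>2)"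
  shows "s\<^sup>2 - (1 + xx u) * s - (bb - 1) * xx u \<ge> 0"
proof -
  define v where "v = dev u"
  define r where "r = 1 + K * v\<^sup>2"
  have uv: "u = 2 * (1 + v) / D" using D by (simp add: v_def dev_def field_simps)
  have s: "s = cp * (1 - u) / cc * r" by (simp add: s_def r_def v_def)
  let ?a = "(D - 1) * (1 + v) * (D - 2 - 2 * v)"
  let ?\<beta> = "(D - 2)\<^sup>2 + v * (D - 1) * (D - 4)"
  let ?G = "cp\<^sup>2 * u * (1 - u) * r\<^sup>2 - (cc * u + 1 - u) * cp * r - (bb - 1) * cc"
  have "1 + v = u * D / 2" "D - 2 - 2 * v = D * (1 - u)" by (simp_all add: v_def dev_def field_simps)
  moreover have "u * D > 0" "D * (1 - u) > 0" using D u by simp_all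
  ultimately have "1 + v \<ge> 0" "D - 2 - 2 * v \<ge> 0" by linarith+
  then have a0: "?a \<ge> 0" using D by (intro mult_nonneg_nonneg) auto
  \<comment> \<open>Expansion at r = 1: the terms of order 0 and 1 in v cancel, which expresses the
    value 1 and the vanishing derivative at u = 2 / D.\<close>
  have "?a * r\<^sup>2 - ?\<beta> * r - (D - 2) = K * v\<^sup>2 * curv v - 2 * (D - 1) * v\<^sup>2 + ?a * (K * v\<^sup>2)\<^sup>2"
    by (simp add: r_def curv_def algebra_simps power2_eq_square)
  also have "\<dots> = v\<^sup>2 * (K * curv v - 2 * (D - 1)) + ?a * (K * v\<^sup>2)\<^sup>2" by (simp add: algebra_simps)
  also have "\<dots> \<ge> 0" using K a0 by (auto simp: v_def intro!: add_nonneg_nonneg mult_nonneg_nonneg)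
  finally have F: "?a * r\<^sup>2 - ?\<beta> * r - (D - 2) \<ge> 0" .
  have G: "?G = (D - 1) / 2 * (?a * r\<^sup>2 - ?\<beta> * r - (D - 2))"
  proof -
    have 1: "cp\<^sup>2 * u * (1 - u) = (D - 1) / 2 * ?a"
      using D by (simp add: cp_def uv field_simps power2_eq_square)
    have "D * (cc * u + 1 - u) = (2 * cc - 2) * (1 + v) + D"
    proof -
      have "D * u = 2 * (1 + v)" using D by (simp add: uv)
      moreover have "D * (cc * u + 1 - u) = (cc - 1) * (D * u) + D" by (simp add: algebra_simps)
      ultimately show ?thesis by (simp add: algebra_simps)
    qed
    also have "2 * cc - 2 = (D - 1) * (D - 4)"
    proof -
      have "2 * cc = (D - 2) * (D - 3)" by (simp add: cc_def)
      then show ?thesis by (simp add: algebra_simps)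
    qed
    also have "(D - 1) * (D - 4) * (1 + v) + D = ?\<beta>" by (simp add: algebra_simps power2_eq_square)
    finally have "D * (cc * u + 1 - u) = ?\<beta>" .
    moreover have "(cc * u + 1 - u) * cp = (D - 1) / 2 * (D * (cc * u + 1 - u))" by (simp add: cp_def)
    ultimately have 2: "(cc * u + 1 - u) * cp = (D - 1) / 2 * ?\<beta>" by simp
    have "X / 2 * a * R - X / 2 * b * t - X * Y / 2 = X / 2 * (a * R - b * t - Y)" for X Y a b R t :: real
      by (simp add: field_simps)
    then show ?thesis unfolding bb_cc 1 2 .
  qed
  have "?G \<ge> 0" unfolding G using F D by (intro mult_nonneg_nonneg) auto
  moreover have "s\<^sup>2 - (1 + xx u) * s - (bb - 1) * xx u = (1 - u) / (cc\<^sup>2 * u) * ?G"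
    using consts_pos(1) u unfolding s xx_def by (simp add: field_simps power2_eq_square)
  ultimately show ?thesis using u consts_pos by simp
qed

end

context beta_laplace
begin

text \<open>For small v the curvature is close to D^2, so a K close to 2 / D suffices. The margin 4
  \<eta> pays for the possible loss D^2 \<eta> in the linear term and, as D \<eta> \<ge> 2, for the
  terms of lower order.\<close>

lemma curv_small:
  assumes \<eta>: "0 < \<eta>" "\<eta> \<le> 1 / 4" "D \<ge> 2 / \<eta>" and v: "\<bar>v\<bar> \<le> \<eta>"
  shows "2 / D * (1 + 4 * \<eta>) * curv v \<ge> 2 * (D - 1)"
proof -
  have D\<eta>: "D * \<eta> \<ge> 2" using \<eta> by (simp add: field_simps)
  have "\<bar>(D - 1) * (D - 4) * v\<bar> \<le> (D - 1) * (D - 4) * \<eta>"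
    unfolding abs_mult using v D by (intro mult_mono) auto
  also have "\<dots> \<le> D * D * \<eta>" using D \<eta> by (intro mult_right_mono mult_mono) auto
  finally have 1: "(D - 1) * (D - 4) * v \<ge> - (D * D * \<eta>)" by linarith
  have "v\<^sup>2 \<le> \<eta>\<^sup>2" using v \<eta> by (metis abs_le_square_iff abs_of_pos)
  also have "\<eta>\<^sup>2 \<le> 1 / 4 * \<eta>" using \<eta> by (simp add: power2_eq_square mult_right_mono)
  finally have v16: "v\<^sup>2 \<le> 1 / 16" using \<eta>(2) by linarith
  have "4 * (D - 1) * v\<^sup>2 \<le> 4 * (D - 1) * (1 / 16)"
    by (rule mult_left_mono[OF v16]) (use D in simp)
  also have "\<dots> \<le> D / 4" by simp
  finally have 2: "4 * (D - 1) * v\<^sup>2 \<le> D / 4" .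
  have "curv v \<ge> D * D - 2 * D - D * D * \<eta> - D / 4"
    using 1 2 by (simp add: curv_def algebra_simps)
  then have "2 / D * (1 + 4 * \<eta>) * curv v \<ge> 2 / D * (1 + 4 * \<eta>) * (D * D - 2 * D - D * D * \<eta> - D / 4)"
    using D \<eta> by (intro mult_left_mono) auto
  also have "2 / D * (1 + 4 * \<eta>) * (D * D - 2 * D - D * D * \<eta> - D / 4)
      = 2 * (1 + 4 * \<eta>) * (D - 2 - D * \<eta> - 1 / 4)"
    using D by (simp add: field_simps)
  also have "\<dots> \<ge> 2 * (D - 1)"
  proof -
    have "(1 + 4 * \<eta>) * (D - 2 - D * \<eta> - 1 / 4) = D + 3 * (D * \<eta>) - 4 * \<eta> * (D * \<eta>) - 9 / 4 * (1 + 4 * \<eta>)"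
      by (simp add: algebra_simps)
    moreover have "4 * \<eta> * (D * \<eta>) \<le> 1 * (D * \<eta>)" using \<eta> D by (intro mult_right_mono) auto
    moreover have "9 / 4 * (1 + 4 * \<eta>) \<le> 9 / 2" using \<eta>(2) by simp
    moreover have "X \<ge> D - 1" if "X = D + 3 * Y - Z - W" "Z \<le> 1 * Y" "W \<le> 9 / 2" "Y \<ge> 2" for X Y Z W :: real
      using that by linarith
    ultimately have "(1 + 4 * \<eta>) * (D - 2 - D * \<eta> - 1 / 4) \<ge> D - 1" using D\<eta> by blast
    then have "2 * ((1 + 4 * \<eta>) * (D - 2 - D * \<eta> - 1 / 4)) \<ge> 2 * (D - 1)" by (rule mult_left_mono) simp
    then show ?thesis by (simp only: mult.assoc)
  qed
  finally show ?thesis .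
qed

text \<open>The range of v corresponds to u between 1 / D and 4 / D. A larger K is affordable away
  from the centre, where the tail bound outweighs exp (5 n / D) for large D.\<close>

lemma curv_mid:
  assumes v: "- (1 / 2) \<le> v" "v \<le> 1"
  shows "5 / D * curv v \<ge> 2 * (D - 1)"
proof -
  have "curv v \<ge> D * D / 2 - 3 * D"
  proof (cases "v \<ge> 0")
    case True
    have "(D - 1) * (D - 4) * v - 4 * (D - 1) * v\<^sup>2 = (D - 1) * v * (D - 4 - 4 * v)"
      by (simp add: algebra_simps power2_eq_square)
    also have "\<dots> \<ge> 0" using True v D by (intro mult_nonneg_nonneg) auto
    finally have "curv v \<ge> D * (D - 2)" by (simp add: curv_def)
    then have "curv v \<ge> D * D - 2 * D" by (simp add: algebra_simps)
    then show ?thesis using D zero_le_square[of D] by linarith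
  next
    case False
    have "(D - 1) * (D - 4) * (- v) \<le> D * D * (1 / 2)"
      using v D False by (intro mult_mono) auto
    moreover have "v\<^sup>2 \<le> (1 / 2)\<^sup>2" using v False by (intro abs_le_square_iff[THEN iffD1]) auto
    then have "4 * (D - 1) * v\<^sup>2 \<le> 4 * (D - 1) * (1 / 2)\<^sup>2" using D by (intro mult_left_mono) auto
    then have "4 * (D - 1) * v\<^sup>2 \<le> D" by (simp add: power2_eq_square)
    moreover have "(D - 1) * (D - 4) * v = - ((D - 1) * (D - 4) * (- v))" by simp
    ultimately show ?thesis unfolding curv_def by (simp add: algebra_simps)
  qed
  then have "5 / D * curv v \<ge> 5 / D * (D * D / 2 - 3 * D)" using D by (intro mult_left_mono) auto
  also have "5 / D * (D * D / 2 - 3 * D) = 5 / 2 * D - 15" using D by (simp add: field_simps)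
  finally have "5 / 2 * D - 15 \<le> 5 / D * curv v" .
  moreover have "2 * (D - 1) \<le> 5 / 2 * D - 15" using D by simp
  ultimately show ?thesis by (rule order_trans[rotated])
qed

end

section \<open>Integration of the truncated trace\<close>

locale beta_trace = beta_laplace +
  fixes N :: "nat \<Rightarrow> real"
  assumes N_nonneg: "N j \<ge> 0"
    and trace: "x > 0 \<Longrightarrow> l + m = 1 + x \<Longrightarrow> l * m = - (bb - 1) * x \<Longrightarrow> (\<Sum>j\<le>n. N j * x ^ j) = l ^ n + m ^ n"
begin

text \<open>The trace of the n-th power of the transfer matrix with its normalising factors: rho
  (u)^n up to the contribution of the second eigenvalue.\<close>

definition full :: "real \<Rightarrow> real" where
  "full u = (cc / cp) ^ n * (\<Sum>j\<le>n. N j * xx u ^ j) / (1 - u) ^ n"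

text \<open>Near u = 0 the term of index j behaves like u^(- j). With j at most n / 4 the inverse
  moments of \<open>lower_moment\<close> control it; larger overlaps are left to
  \<open>overlap_weight_tail\<close>.\<close>

definition head :: "real \<Rightarrow> real" where
  "head u = (\<Sum>j\<le>n div 4. (cc / cp) ^ n * N j * (xx u ^ j / (1 - u) ^ n))"

lemma xx_pos: "0 < u \<Longrightarrow> u < 1 \<Longrightarrow> xx u > 0"
  using consts_pos by (simp add: xx_def)

lemma head_eq: "head u = (cc / cp) ^ n * (\<Sum>j\<le>n div 4. N j * xx u ^ j) / (1 - u) ^ n"
  unfolding head_def sum_distrib_left sum_divide_distrib by (rule sum.cong) auto

text \<open>For u \<ge> 1 / D the product (b - 1) x is at most 1 / 2, so
  \<open>eigenvalue_bound\<close> makes the second eigenvalue negligible, and the n-th power of 1 +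
  K dev^2 is at most an exponential.\<close>

lemma full_bound:
  assumes u: "1 / D \<le> u" "u < 1" and K: "K \<ge> 0" "K * curv (dev u) \<ge> 2 * (D - 1)"
  shows "full u \<le> (1 + (1 / 2) ^ n) * exp (K * (real n * dev u ^ 2))"
proof -
  have u0: "u > 0" using u D by (smt (verit) divide_pos_pos)
  let ?r = "1 + K * (dev u)\<^sup>2"
  let ?s = "cp * (1 - u) / cc * ?r"
  have r: "?r \<ge> 1" using K by simp
  have s: "?s > 0" using consts_pos u r by (intro mult_pos_pos divide_pos_pos) auto
  have x: "xx u > 0" by (rule xx_pos[OF u0 u(2)])
  have "(bb - 1) * xx u \<le> 1 / 2"
  proof -
    have "(bb - 1) * xx u = (D - 1) * (D - 2) / 2 * (1 - u) / (cc\<^sup>2 * u)"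
      unfolding bb_cc[symmetric] xx_def using consts_pos u0 by (simp add: field_simps power2_eq_square)
    also have "\<dots> \<le> (D - 1) * (D - 2) / 2 * 1 / (cc\<^sup>2 * (1 / D))"
    proof (intro frac_le mult_left_mono mult_nonneg_nonneg)
      show "0 < cc\<^sup>2 * (1 / D)" using consts_pos D by simp
    qed (use D u u0 in auto)
    also have "\<dots> = 2 * ((D - 1) * D) / ((D - 2) * (D - 3)\<^sup>2)"
    proof -
      have "R * P / 2 * 1 / ((P * Q / 2)\<^sup>2 * (1 / D)) = 2 * (R * D) / (P * Q\<^sup>2)"
        if "P \<noteq> 0" "Q \<noteq> 0" for P Q R :: real
        using that D by (simp add: field_simps power2_eq_square)
      then show ?thesis unfolding cc_def using D by simp
    qed
    also have "\<dots> \<le> 1 / 2"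
    proof -
      have "(D - 1) * D \<le> (2 * (D - 2)) * (2 * (D - 3))" using D by (intro mult_mono) auto
      then have "4 * ((D - 1) * D) \<le> 16 * ((D - 2) * (D - 3))" by (simp add: algebra_simps)
      also have "\<dots> \<le> (D - 3) * ((D - 2) * (D - 3))" using D by (intro mult_right_mono) auto
      finally have "4 * ((D - 1) * D) \<le> (D - 3) * ((D - 2) * (D - 3))" .
      moreover have "(D - 3) * ((D - 2) * (D - 3)) = (D - 2) * (D - 3)\<^sup>2" by (simp add: power2_eq_square)
      moreover have "(D - 2) * (D - 3)\<^sup>2 > 0" using D by simp
      moreover have "2 * X / Z \<le> 1 / 2" if "4 * X \<le> Y" "Y = Z" "Z > 0" for X Y Z :: real
        using that by (simp add: field_simps)
      ultimately show ?thesis by blast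
    qed
    finally show ?thesis .
  qed
  then obtain l m where lm: "l + m = 1 + xx u" "l * m = - (bb - 1) * xx u" "l ^ n + m ^ n \<le> (1 + (1 / 2) ^ n) * ?s ^ n"
    using eigenvalue_bound[OF consts_pos(3) x s eigenvalue_quadratic[OF u0 u(2) K], of n] by blast
  have "full u = (cc / cp) ^ n * (l ^ n + m ^ n) / (1 - u) ^ n"
    unfolding full_def trace[OF x lm(1,2)] ..
  also have "\<dots> \<le> (cc / cp) ^ n * ((1 + (1 / 2) ^ n) * ?s ^ n) / (1 - u) ^ n"
    using lm(3) consts_pos u by (intro divide_right_mono mult_left_mono) auto
  also have "\<dots> = (1 + (1 / 2) ^ n) * ?r ^ n"
    using consts_pos u by (simp add: power_divide power_mult_distrib)
  also have "\<dots> \<le> (1 + (1 / 2) ^ n) * exp (K * (dev u)\<^sup>2) ^ n"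
    using r by (intro mult_left_mono power_mono) (auto intro: exp_ge_add_one_self)
  also have "exp (K * (dev u)\<^sup>2) ^ n = exp (K * (real n * dev u ^ 2))"
    by (simp add: mult_ac flip: exp_of_nat_mult)
  finally show ?thesis .
qed

lemma full_bound_mid:
  assumes u: "1 / D \<le> u" "u \<le> 4 / D"
  shows "full u \<le> 2 * exp (5 * real n / D)"
proof -
  have u1: "u < 1" using u D by (smt (verit) divide_less_eq_1)
  have v: "- (1 / 2) \<le> dev u" "dev u \<le> 1" using u D by (auto simp: dev_def field_simps)
  have "full u \<le> (1 + (1 / 2) ^ n) * exp (5 / D * (real n * dev u ^ 2))"
    by (rule full_bound[OF u(1) u1 _ curv_mid[OF v]]) (use D in simp)
  also have "\<dots> \<le> 2 * exp (5 * real n / D)"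
  proof (intro mult_mono)
    have "dev u ^ 2 \<le> 1\<^sup>2" using v by (intro abs_le_square_iff[THEN iffD1]) auto
    then have "5 / D * (real n * dev u ^ 2) \<le> 5 / D * (real n * 1)" using D by (intro mult_left_mono) auto
    then show "exp (5 / D * (real n * dev u ^ 2)) \<le> exp (5 * real n / D)" by simp
    show "1 + (1 / 2) ^ n \<le> (2::real)" by (simp add: power_le_one)
  qed auto
  finally show ?thesis .
qed

lemma head_le_full: "0 < u \<Longrightarrow> u < 1 \<Longrightarrow> head u \<le> full u"
  unfolding head_eq full_def using N_nonneg xx_pos[of u] consts_pos
  by (intro divide_right_mono mult_left_mono sum_mono2) (auto simp: less_imp_le)

text \<open>Comparison with the boundary point 1 / D. The quotient of the values of
  \<open>xx\<close> is at least 1, so its powers up to n / 4 are bounded by the last of them, and it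
  is at most 51 / 100 times 2 / (D u).\<close>

lemma head_left:
  assumes u: "0 < u" "u < 1 / D"
  shows "head u \<le> 2 * exp (5 * real n / D) * ((51 / 100) ^ (n div 4) * (2 / (D * u)) ^ (n div 4))"
proof -
  let ?k = "n div 4" and ?w = "1 / D"
  have w: "0 < ?w" "?w < 1" "?w \<le> 4 / D" using D by (auto simp: field_simps)
  have u1: "u < 1" using u w by linarith
  have q: "xx u / xx ?w = (1 - u) * ?w / ((1 - ?w) * u)"
    using consts_pos u w by (simp add: xx_def field_simps)
  have q1: "xx u / xx ?w \<ge> 1"
  proof -
    have "(1 - ?w) * u \<le> (1 - u) * ?w" using u unfolding left_diff_distrib by simp
    moreover have "(1 - ?w) * u > 0" using u w by simp
    ultimately show ?thesis unfolding q by (simp only: le_divide_eq_1_pos)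
  qed
  have q2: "xx u / xx ?w \<le> 51 / 100 * (2 / (D * u))"
  proof -
    have "xx u / xx ?w \<le> 1 * ?w / ((1 - ?w) * u)"
      unfolding q using u w by (intro divide_right_mono mult_right_mono) auto
    also have "\<dots> = 1 / ((D - 1) * u)" using D u by (simp add: field_simps)
    also have "\<dots> \<le> 1 / ((100 / 102 * D) * u)"
      using D u by (intro divide_left_mono mult_right_mono) (auto simp: mult_pos_pos)
    also have "\<dots> = 51 / 100 * (2 / (D * u))" using D u by (simp add: field_simps)
    finally show ?thesis .
  qed
  have "(\<Sum>j\<le>?k. N j * xx u ^ j) \<le> (\<Sum>j\<le>?k. N j * xx ?w ^ j * (xx u / xx ?w) ^ ?k)"
  proof (rule sum_mono)
    fix j assume j: "j \<in> {..?k}"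
    have "xx u ^ j = xx ?w ^ j * (xx u / xx ?w) ^ j"
      using xx_pos[OF w(1,2)] by (simp add: power_divide)
    also have "\<dots> \<le> xx ?w ^ j * (xx u / xx ?w) ^ ?k"
      using j q1 xx_pos[OF w(1,2)] by (intro mult_left_mono power_increasing) auto
    finally have "N j * xx u ^ j \<le> N j * (xx ?w ^ j * (xx u / xx ?w) ^ ?k)"
      using N_nonneg by (rule mult_left_mono)
    then show "N j * xx u ^ j \<le> N j * xx ?w ^ j * (xx u / xx ?w) ^ ?k" by (simp add: mult.assoc)
  qed
  also have "\<dots> = (\<Sum>j\<le>?k. N j * xx ?w ^ j) * (xx u / xx ?w) ^ ?k"
    by (simp add: sum_distrib_right)
  finally have S: "(\<Sum>j\<le>?k. N j * xx u ^ j) \<le> (\<Sum>j\<le>?k. N j * xx ?w ^ j) * (xx u / xx ?w) ^ ?k" .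
  have nn: "0 \<le> (\<Sum>j\<le>?k. N j * xx ?w ^ j)"
    using N_nonneg xx_pos[OF w(1,2)] by (intro sum_nonneg mult_nonneg_nonneg) auto
  have "head u \<le> (cc / cp) ^ n * ((\<Sum>j\<le>?k. N j * xx ?w ^ j) * (xx u / xx ?w) ^ ?k) / (1 - ?w) ^ n"
    unfolding head_eq
  proof (intro frac_le mult_left_mono S power_mono)
    show "0 \<le> (cc / cp) ^ n * ((\<Sum>j\<le>?k. N j * xx ?w ^ j) * (xx u / xx ?w) ^ ?k)"
      using nn q1 consts_pos by (intro mult_nonneg_nonneg) auto
  qed (use consts_pos u w in auto)
  also have "\<dots> = head ?w * (xx u / xx ?w) ^ ?k" by (simp add: head_eq)
  also have "\<dots> \<le> 2 * exp (5 * real n / D) * (51 / 100 * (2 / (D * u))) ^ ?k"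
  proof (intro mult_mono power_mono q2)
    show "head ?w \<le> 2 * exp (5 * real n / D)"
      using head_le_full[OF w(1,2)] full_bound_mid[of ?w] w(3) by simp
  qed (use q1 in auto)
  finally show ?thesis by (simp only: power_mult_distrib)
qed

text \<open>\<open>xx\<close> decreases, so the sum at u is bounded by the sum at 4 / D. The factor
  (D u / 4)^(n div 4), at least 1 in this range, is inserted so that \<open>right_moment\<close>
  yields exponential decay.\<close>

lemma head_right:
  assumes u: "4 / D < u" "u < 1"
  shows "head u \<le> 2 * exp (5 * real n / D) * ((D * u / 4) ^ (n div 4) / (1 - u) ^ n)"
proof -
  let ?w = "4 / D"
  have w: "0 < ?w" "?w < 1" "1 / D \<le> ?w" using D by (auto simp: divide_right_mono)
  have u0: "0 < u" using u w by linarith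
  have xle: "xx u \<le> xx ?w"
    unfolding xx_def using u w consts_pos by (intro frac_le mult_left_mono mult_pos_pos) auto
  have "full u \<le> (cc / cp) ^ n * (\<Sum>j\<le>n. N j * xx ?w ^ j) / (1 - u) ^ n"
    unfolding full_def using xle xx_pos[OF u0 u(2)] N_nonneg consts_pos u
    by (intro divide_right_mono mult_left_mono sum_mono power_mono) auto
  also have "\<dots> = full ?w * (1 - ?w) ^ n / (1 - u) ^ n" using w D by (simp add: full_def)
  also have "\<dots> \<le> (2 * exp (5 * real n / D)) * 1 / (1 - u) ^ n"
  proof (intro divide_right_mono mult_mono)
    show "full ?w \<le> 2 * exp (5 * real n / D)" by (rule full_bound_mid) (use w in auto)
    show "(1 - ?w) ^ n \<le> 1" using w by (intro power_le_one) auto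
  qed (use u w in auto)
  also have "\<dots> \<le> (2 * exp (5 * real n / D)) * (D * u / 4) ^ (n div 4) / (1 - u) ^ n"
  proof (intro divide_right_mono mult_left_mono one_le_power)
    show "1 \<le> D * u / 4" using u D by (simp add: field_simps)
  qed (use u in auto)
  finally show ?thesis using head_le_full[OF u0 u(2)] by simp
qed

text \<open>The centre, where dev is at most \<eta> in modulus, gives the main term; the rest of the
  interval from 1 / D to 4 / D is rare by \<open>dev_tail\<close>; the two outer regions are
  \<open>head_left\<close> and \<open>head_right\<close>. \<open>D \<ge> 128\<close> ensures K \<le>
  1 / 32, as \<open>exp_dev_sq\<close> requires.\<close>

lemma head_integral:
  assumes \<eta>: "0 < \<eta>" "\<eta> \<le> 1 / 4" "D \<ge> 2 / \<eta>" and int: "integrable M head" and D': "D \<ge> 128"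
  defines "K \<equiv> 2 / D * (1 + 4 * \<eta>)"
  shows "integral\<^sup>L M head \<le> (1 + (1 / 2) ^ n) * (1 + K * (1 + 2 / D) + K\<^sup>2 * tail_const)
    + 8 * exp (5 * real n / D - real n * \<eta>\<^sup>2 / 16)
    + 2 * exp (11 * real n / D) * (5 / 8) ^ (n div 4)
    + 2 * exp (5 * real n / D) * (17 / 20) ^ (n div 4)"
proof -
  interpret prob_space M by (rule prob_M)
  let ?k = "n div 4" and ?E = "2 * exp (5 * real n / D)"
  have K0: "0 \<le> K" using D \<eta> by (simp add: K_def)
  have "K \<le> 2 / D * 2" unfolding K_def using \<eta> D by (intro mult_left_mono) auto
  also have "\<dots> \<le> 1 / 32" using D' by (simp add: field_simps)
  finally have K1: "K \<le> 1 / 32" .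
  have k4: "4 * ?k \<le> n" "2 * ?k \<le> n" by linarith+
  let ?f1 = "\<lambda>u. indicator {u. \<bar>dev u\<bar> \<le> \<eta>} u * exp (K * (real n * dev u ^ 2))"
  let ?f2 = "\<lambda>u. indicator {u. \<eta> \<le> \<bar>dev u\<bar>} u :: real"
  let ?f3 = "\<lambda>u. (D * u / 4) ^ ?k / (1 - u) ^ n"
  let ?f4 = "\<lambda>u. (2 / (D * u)) ^ ?k"
  have \<eta>': "0 \<le> \<eta>" "\<eta> \<le> 1 / 2" using \<eta> by auto
  note f1 = exp_dev_sq[OF K0 K1 \<eta>'(1) \<eta>(2)]
  have i2: "integrable M ?f2" by (rule integrable_real_indicator) (auto simp: emeasure_eq_measure)
  note i3 = right_moment(1)[OF k4(1)] and i4 = lower_moment(1)[OF k4(2)]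
  have le: "head u \<le> (1 + (1 / 2) ^ n) * ?f1 u + ?E * ?f2 u + ?E * ?f3 u + ?E * (51 / 100) ^ ?k * ?f4 u"
    if u: "0 < u" "u < 1" for u
  proof -
    have nn: "0 \<le> (1 + (1 / 2) ^ n) * ?f1 u" "0 \<le> ?E * ?f2 u" "0 \<le> ?E * ?f3 u" "0 \<le> ?E * (51 / 100) ^ ?k * ?f4 u"
      using u D by (auto intro!: mult_nonneg_nonneg divide_nonneg_nonneg add_nonneg_nonneg)
    consider "u < 1 / D" | "4 / D < u" | "1 / D \<le> u" "u \<le> 4 / D" "\<bar>dev u\<bar> \<le> \<eta>"
      | "1 / D \<le> u" "u \<le> 4 / D" "\<eta> \<le> \<bar>dev u\<bar>" by linarith
    then show ?thesis
    proof cases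
      case 1
      have "head u \<le> ?E * (51 / 100) ^ ?k * ?f4 u" using head_left[OF u(1) 1] by (simp add: mult.assoc)
      then show ?thesis using nn by linarith
    next
      case 2
      then show ?thesis using head_right[OF 2 u(2)] nn by linarith
    next
      case 3
      have "full u \<le> (1 + (1 / 2) ^ n) * exp (K * (real n * dev u ^ 2))"
        unfolding K_def by (rule full_bound[OF 3(1) u(2) _ curv_small[OF \<eta> 3(3)]]) (use K0 K_def in simp)
      also have "\<dots> = (1 + (1 / 2) ^ n) * ?f1 u" using 3(3) by simp
      finally show ?thesis using head_le_full[OF u] nn by linarith
    next
      case 4
      have "full u \<le> ?E * ?f2 u" using full_bound_mid[OF 4(1,2)] 4(3) by simp
      then show ?thesis using head_le_full[OF u] nn by linarith
    qed
  qed
  let ?F = "\<lambda>u. (1 + (1 / 2) ^ n) * ?f1 u + ?E * ?f2 u + ?E * ?f3 u + ?E * (51 / 100) ^ ?k * ?f4 u"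
  have iF: "integrable M ?F"
    using f1(1) i2 i3 i4 by (intro Bochner_Integration.integrable_add integrable_mult_right) auto
  have "integral\<^sup>L M head \<le> integral\<^sup>L M ?F"
  proof (rule integral_mono_AE[OF int iF])
    show "AE u in M. head u \<le> ?F u" using AE_M by eventually_elim (rule le; simp)
  qed
  also have "\<dots> = (1 + (1 / 2) ^ n) * integral\<^sup>L M ?f1 + ?E * integral\<^sup>L M ?f2 + ?E * integral\<^sup>L M ?f3
      + ?E * (51 / 100) ^ ?k * integral\<^sup>L M ?f4"
  proof -
    have j1: "integrable M (\<lambda>u. (1 + (1 / 2) ^ n) * ?f1 u)" using f1(1) by (rule integrable_mult_right)
    have j2: "integrable M (\<lambda>u. ?E * ?f2 u)" using i2 by (rule integrable_mult_right)
    have j3: "integrable M (\<lambda>u. ?E * ?f3 u)" using i3 by (rule integrable_mult_right)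
    have j4: "integrable M (\<lambda>u. ?E * (51 / 100) ^ ?k * ?f4 u)" using i4 by (rule integrable_mult_right)
    show ?thesis
      unfolding Bochner_Integration.integral_add[OF Bochner_Integration.integrable_add[OF Bochner_Integration.integrable_add[OF j1 j2] j3] j4]
        Bochner_Integration.integral_add[OF Bochner_Integration.integrable_add[OF j1 j2] j3]
        Bochner_Integration.integral_add[OF j1 j2] integral_mult_right_zero ..
  qed
  also have "\<dots> \<le> (1 + (1 / 2) ^ n) * (1 + K * (1 + 2 / D) + K\<^sup>2 * tail_const)
      + ?E * (4 * exp (- (real n * \<eta>\<^sup>2 / 16))) + ?E * ((5 / 8) ^ ?k * exp (6 * real n / D))
      + ?E * (51 / 100) ^ ?k * (5 / 3) ^ ?k"
  proof (intro add_mono mult_left_mono)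
    show "integral\<^sup>L M ?f1 \<le> 1 + K * (1 + 2 / D) + K\<^sup>2 * tail_const" by (rule f1(2))
    show "integral\<^sup>L M ?f2 \<le> 4 * exp (- (real n * \<eta>\<^sup>2 / 16))"
      using dev_tail[OF \<eta>'] by simp
    show "integral\<^sup>L M ?f3 \<le> (5 / 8) ^ ?k * exp (6 * real n / D)" by (rule right_moment(2)[OF k4(1)])
    \<comment> \<open>The inverse moment grows at most like (5 / 3)^k, and 51 / 100 times 5 / 3 is
      17 / 20. The gain of 51 / 100 in \<open>head_left\<close> thus leaves a decaying
      power.\<close>
    have "integral\<^sup>L M ?f4 \<le> exp (2 * real ?k ^ 2 / real n)" by (rule lower_moment(2)[OF k4(2)])
    also have "\<dots> \<le> exp (real ?k * (1 / 2))"
    proof -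
      have "4 * real ?k \<le> real n" using k4(1) by linarith
      then have "real ?k * (4 * real ?k) \<le> real ?k * real n" by (intro mult_left_mono) auto
      then show ?thesis using n_pos by (simp add: field_simps power2_eq_square)
    qed
    also have "\<dots> = exp (1 / 2) ^ ?k" by (rule exp_of_nat_mult)
    also have "\<dots> \<le> (5 / 3) ^ ?k"
    proof (intro power_mono)
      have "exp (1 / 2 :: real) ^ 2 = exp 1" by (simp flip: exp_of_nat_mult)
      also have "\<dots> \<le> (5 / 3)\<^sup>2" using e_less_272 by (simp add: power2_eq_square)
      finally show "exp (1 / 2 :: real) \<le> 5 / 3" by (rule power2_le_imp_le) simp
    qed simp
    finally show "integral\<^sup>L M ?f4 \<le> (5 / 3) ^ ?k" .
  qed auto
  also have "?E * (4 * exp (- (real n * \<eta>\<^sup>2 / 16))) = 8 * exp (5 * real n / D - real n * \<eta>\<^sup>2 / 16)"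
    using exp_add[of "5 * real n / D" "- (real n * \<eta>\<^sup>2 / 16)"] by simp
  also have "?E * ((5 / 8) ^ ?k * exp (6 * real n / D)) = 2 * exp (11 * real n / D) * (5 / 8) ^ ?k"
  proof -
    have "exp (11 * real n / D) = exp (5 * real n / D) * exp (6 * real n / D)"
      by (simp add: add_divide_distrib[symmetric] flip: exp_add)
    then show ?thesis by simp
  qed
  also have "?E * (51 / 100) ^ ?k * (5 / 3) ^ ?k = ?E * (17 / 20) ^ ?k"
    by (simp flip: power_mult_distrib)
  finally show ?thesis .
qed

end

section \<open>Overlap weights as Beta moments\<close>

lemma Gamma_half_nonzero: "Gamma (1 / 2 :: real) \<noteq> 0"
proof -
  have "Gamma (1 / 2 :: real) > 0" by (rule Gamma_real_pos) simp
  then show ?thesis by (metis less_irrefl)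
qed

lemma odd_fact_Gamma: "real (odd_fact s) = 2 ^ s * Gamma (real s + 1 / 2) / Gamma (1 / 2)"
proof -
  have "real (odd_fact s) = (\<Prod>i<s. 2 * (1 / 2 + real i))"
    unfolding odd_fact_def of_nat_prod by (rule prod.cong) simp_all
  also have "\<dots> = 2 ^ s * pochhammer (1 / 2) s"
    unfolding pochhammer_prod_less prod.distrib by simp
  also have "pochhammer (1 / 2) s = Gamma (real s + 1 / 2) / Gamma (1 / 2 :: real)"
    using Gamma_pochhammer[of "1 / 2" s] Gamma_half_nonzero by (simp add: add.commute)
  finally show ?thesis by simp
qed

lemma odd_fact_add: "odd_fact (a + k) = odd_fact a * (\<Prod>i<k. 2 * (a + i) + 1)"
  by (induction k) (simp_all add: odd_fact_Suc algebra_simps)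

lemma power_div_fact_le_exp: "0 \<le> x \<Longrightarrow> x ^ j / fact j \<le> exp (x::real)"
proof -
  assume x: "0 \<le> x"
  have "(\<Sum>i\<in>{j}. x ^ i /\<^sub>R fact i) \<le> (\<Sum>i. x ^ i /\<^sub>R fact i)"
    using x by (intro sum_le_suminf summable_exp_generic) auto
  then show ?thesis by (simp add: exp_def divide_inverse mult.commute)
qed

definition run_coeff :: "real \<Rightarrow> nat \<Rightarrow> nat \<Rightarrow> real" where
  "run_coeff b n j = (\<Sum>I\<in>{I \<in> Pow {..<n}. card I = j}. b ^ runs n I)"

lemma sum_by_card:
  fixes f :: "nat set \<Rightarrow> real"
  shows "(\<Sum>I\<in>Pow {..<n}. f I) = (\<Sum>j\<le>n. \<Sum>I\<in>{I \<in> Pow {..<n}. card I = j}. f I)"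
proof (rule sum.group[symmetric])
  show "card ` Pow {..<n} \<subseteq> {..n}" using card_mono[of "{..<n}"] by fastforce
qed auto

lemma run_coeff_sum: "(\<Sum>j\<le>n. run_coeff b n j * x ^ j) = run_sum b n x"
  unfolding run_sum_def sum_by_card run_coeff_def sum_distrib_right
  by (intro sum.cong refl) (simp add: mult.commute)

lemma runs_le_card: "I \<subseteq> {..<n} \<Longrightarrow> runs n I \<le> card I"
proof -
  assume I: "I \<subseteq> {..<n}"
  let ?S = "{B \<in> {..<n} - I. (B + n - 1) mod n \<in> I}"
  have "inj_on (\<lambda>B. (B + n - 1) mod n) ?S"
    by (rule inj_on_inverseI[of _ "\<lambda>k. Suc k mod n"]) (rule pred_mod(1), simp)
  then show ?thesis unfolding runs_def
    by (rule card_inj_on_le) (use I finite_subset in auto)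
qed

lemma run_coeff_le: "1 \<le> b \<Longrightarrow> run_coeff b n j \<le> real (n choose j) * b ^ j"
proof -
  assume b: "1 \<le> b"
  have "run_coeff b n j \<le> (\<Sum>I\<in>{I \<in> Pow {..<n}. card I = j}. b ^ j)"
    unfolding run_coeff_def using b runs_le_card by (intro sum_mono power_increasing) auto
  also have "\<dots> = real (n choose j) * b ^ j"
    using n_subsets[of "{..<n}" j] by (simp add: Pow_def)
  finally show ?thesis .
qed

lemma run_coeff_nonneg: "0 \<le> b \<Longrightarrow> 0 \<le> run_coeff b n j"
  unfolding run_coeff_def by (intro sum_nonneg) auto

text \<open>The bound for the share of one set of j common edges in the second moment of the round
  count divided by the square of its mean, without the factor that depends on the runs of the
  set.\<close>

definition overlap_weight :: "nat \<Rightarrow> nat \<Rightarrow> nat \<Rightarrow> nat \<Rightarrow> real" where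
  "overlap_weight n d r j = real n * fact (n - j - 1) * ((real d - 2) * (real d - 3)) ^ (n - j)
     * real (odd_fact (r - (2 * n - j))) * real (odd_fact r)
     / (fact n * (real d * (real d - 1)) ^ n * (real (odd_fact (r - n)))\<^sup>2)"

text \<open>Pairs of rounds with the same edges give the term 2 n / m; all other pairs are sorted by
  the number j < n of common edges, and the run factors of the sets of size j add up to
  \<open>run_coeff\<close>.\<close>

lemma second_moment_ratio:
  assumes r: "n * d = 2 * r" and n: "n > 0" and d: "d \<ge> 4"
  defines "m \<equiv> fact n * (real d * (real d - 1)) ^ n * real (odd_fact (r - n)) / real (odd_fact r)"
  shows "(\<Sum>P\<in>pairings n d. (real (round_count n d P))\<^sup>2) / real (odd_fact r) / m\<^sup>2
    \<le> 2 * real n / m + (\<Sum>j<n. run_coeff (2 * (real d - 2) / (real d - 3)) n j * overlap_weight n d r j)"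
proof -
  let ?b = "2 * (real d - 2) / (real d - 3)"
  let ?X = "fact n * (real d * (real d - 1)) ^ n :: real"
  let ?o = "real (odd_fact (r - n))" and ?q = "real (odd_fact r)"
  let ?g = "\<lambda>j. real n * fact (n - j - 1) * ((real d - 2) * (real d - 3)) ^ (n - j) * real (odd_fact (r - (2 * n - j)))"
  let ?S = "\<Sum>I\<in>Pow {..<n} - {{..<n}}. n * fact (n - card I - 1) * (\<Prod>B\<in>{..<n} - I. block_weight n d I B)
         * odd_fact (r - (2 * n - card I))"
  have pos: "?X > 0" "?o > 0" "?q > 0" using d by (auto intro!: mult_pos_pos)
  have m: "m = ?X * ?o / ?q" by (simp add: m_def)
  have S: "real ?S = (\<Sum>j<n. run_coeff ?b n j * ?g j)"
  proof -
    have "real ?S = (\<Sum>I\<in>Pow {..<n} - {{..<n}}. ?g (card I) * ?b ^ runs n I)"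
      unfolding of_nat_sum
    proof (rule sum.cong[OF refl])
      fix I assume "I \<in> Pow {..<n} - {{..<n}}"
      then have I: "I \<subseteq> {..<n}" by auto
      show "real (n * fact (n - card I - 1) * (\<Prod>B\<in>{..<n} - I. block_weight n d I B) * odd_fact (r - (2 * n - card I)))
          = ?g (card I) * ?b ^ runs n I"
        unfolding of_nat_mult prod_block_weight[OF d I] of_nat_fact by simp
    qed
    also have "\<dots> = (\<Sum>j<n. \<Sum>I\<in>{I \<in> Pow {..<n} - {{..<n}}. card I = j}. ?g (card I) * ?b ^ runs n I)"
    proof (rule sum.group[symmetric])
      show "card ` (Pow {..<n} - {{..<n}}) \<subseteq> {..<n}"
      proof
        fix j assume "j \<in> card ` (Pow {..<n} - {{..<n}})"
        then obtain I where "I \<subset> {..<n}" "j = card I" by auto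
        then show "j \<in> {..<n}" using psubset_card_mono[of "{..<n}" I] by simp
      qed
    qed auto
    also have "\<dots> = (\<Sum>j<n. run_coeff ?b n j * ?g j)"
    proof (rule sum.cong[OF refl])
      fix j assume j: "j \<in> {..<n}"
      have "{I \<in> Pow {..<n} - {{..<n}}. card I = j} = {I \<in> Pow {..<n}. card I = j}"
        using j by auto
      then show "(\<Sum>I\<in>{I \<in> Pow {..<n} - {{..<n}}. card I = j}. ?g (card I) * ?b ^ runs n I) = run_coeff ?b n j * ?g j"
        by (simp add: run_coeff_def sum_distrib_right sum_distrib_left mult_ac)
    qed
    finally show ?thesis .
  qed
  have "(\<Sum>P\<in>pairings n d. (real (round_count n d P))\<^sup>2) = real (\<Sum>P\<in>pairings n d. (round_count n d P)\<^sup>2)"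
    by simp
  also have "\<dots> \<le> real (fact n * (d * (d - 1)) ^ n * (2 * n * odd_fact (r - n) + ?S))"
    using sum_round_count_sq[OF r n] by (rule of_nat_mono)
  also have "\<dots> = ?X * (2 * real n * ?o + (\<Sum>j<n. run_coeff ?b n j * ?g j))"
    using d unfolding of_nat_mult of_nat_add of_nat_power S by (simp add: of_nat_diff)
  finally have "(\<Sum>P\<in>pairings n d. (real (round_count n d P))\<^sup>2) / ?q / m\<^sup>2
      \<le> ?X * (2 * real n * ?o + (\<Sum>j<n. run_coeff ?b n j * ?g j)) / ?q / m\<^sup>2"
    by (intro divide_right_mono) auto
  also have "\<dots> = 2 * real n / m + (\<Sum>j<n. run_coeff ?b n j * ?g j) * (?q / (?X * ?o\<^sup>2))"
  proof -
    have "X * (2 * N * p + T) / q / (X * p / q)\<^sup>2 = 2 * N / (X * p / q) + T * (q / (X * p\<^sup>2))"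
      if "X > 0" "p > 0" "q > 0" for X p q N T :: real
      using that by (simp add: field_simps power2_eq_square)
    then show ?thesis unfolding m using pos by blast
  qed
  also have "(\<Sum>j<n. run_coeff ?b n j * ?g j) * (?q / (?X * ?o\<^sup>2)) = (\<Sum>j<n. run_coeff ?b n j * overlap_weight n d r j)"
    unfolding sum_distrib_right overlap_weight_def by (rule sum.cong) (simp_all add: mult_ac)
  finally show ?thesis .
qed

text \<open>Each odd factor is at most n d, and n^n is at most 3^n n!, so the mean is at least ((d -
  1) / 3)^n; for \<open>d \<ge> 7\<close> the base is at least 2. This makes the diagonal term 2 n /
  m exponentially small.\<close>

lemma first_moment_lower:
  assumes r: "n * d = 2 * r" and n: "n > 0" and d: "d \<ge> 7"
  shows "2 ^ n \<le> fact n * (real d * (real d - 1)) ^ n * real (odd_fact (r - n)) / real (odd_fact r)"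
proof -
  have "n * 2 \<le> n * d" using d by (intro mult_le_mono2) simp
  then have nr: "n \<le> r" using r by linarith
  have "odd_fact r = odd_fact (r - n) * (\<Prod>i<n. 2 * (r - n + i) + 1)"
    using odd_fact_add[of "r - n" n] nr by simp
  then have "real (odd_fact r) = real (odd_fact (r - n)) * (\<Prod>i<n. real (2 * (r - n + i) + 1))" by simp
  also have "\<dots> \<le> real (odd_fact (r - n)) * real (n * d) ^ n"
  proof (intro mult_left_mono prod_le_power_real)
    fix i assume "i < n"
    then have "2 * (r - n + i) + 1 \<le> 2 * r" using nr by arith
    then have "2 * (r - n + i) + 1 \<le> n * d" unfolding r .
    then show "real (2 * (r - n + i) + 1) \<le> real (n * d)" by (rule of_nat_mono)
  qed auto
  finally have o: "real (odd_fact r) \<le> real (odd_fact (r - n)) * real (n * d) ^ n" .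
  have "real n ^ n / fact n \<le> exp (real n)" by (rule power_div_fact_le_exp) simp
  also have "\<dots> = exp 1 ^ n" by (simp flip: exp_of_nat_mult)
  also have "\<dots> \<le> 3 ^ n" using e_less_272 by (intro power_mono) auto
  finally have f: "real n ^ n \<le> 3 ^ n * fact n" by (simp add: field_simps)
  have "2 ^ n * real (odd_fact r) \<le> 2 ^ n * (real (odd_fact (r - n)) * (real n ^ n * real d ^ n))"
    using o by (simp add: power_mult_distrib)
  also have "\<dots> \<le> 2 ^ n * (real (odd_fact (r - n)) * ((3 ^ n * fact n) * real d ^ n))"
    using f by (intro mult_left_mono mult_right_mono) auto
  also have "\<dots> = real (odd_fact (r - n)) * fact n * real d ^ n * 6 ^ n"
  proof -
    have "(2::real) ^ n * 3 ^ n = 6 ^ n" by (simp flip: power_mult_distrib)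
    moreover have "x * (p * ((y * f) * e)) = p * f * e * (x * y)" for x y p f e :: real by simp
    ultimately show ?thesis by metis
  qed
  also have "\<dots> \<le> real (odd_fact (r - n)) * fact n * real d ^ n * (real d - 1) ^ n"
    using d by (intro mult_left_mono power_mono) auto
  finally have "2 ^ n * real (odd_fact r) \<le> fact n * (real d * (real d - 1)) ^ n * real (odd_fact (r - n))"
    by (simp add: power_mult_distrib mult_ac)
  then show ?thesis by (simp add: pos_le_divide_eq)
qed

text \<open>The binomial coefficient and the factorials leave 1 / j!, which against (n / 4)^j costs
  at most exp (n / 4) \<le> 2^n. Each common edge then gains a factor 12 / (d - 1), at most 2^(- 12)
  for \<open>d \<ge> 50000\<close>; since j \<ge> n / 4, these 3 n halvings beat the factor 4^n lost
  in total.\<close>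

lemma overlap_weight_tail:
  assumes r: "n * d = 2 * r" and d: "d \<ge> 50000" and j: "j < n" "n \<le> 4 * j"
  shows "run_coeff (2 * (real d - 2) / (real d - 3)) n j * overlap_weight n d r j \<le> real n * (1 / 2) ^ n"
proof -
  let ?D = "real d"
  let ?b = "2 * (?D - 2) / (?D - 3)"
  have D: "?D \<ge> 50000" using d by simp
  have b: "1 \<le> ?b" "?b \<le> 3" using D by (auto simp: field_simps)
  have nr: "2 * n \<le> r"
  proof -
    have "n * 4 \<le> n * d" using d by (intro mult_le_mono2) simp
    then show ?thesis using r by linarith
  qed
  define s where "s = r - (2 * n - j)"
  have s: "r - n = s + (n - j)" "r = (r - n) + n" using nr j by (auto simp: s_def)
  have o1: "real (odd_fact r) \<le> real (odd_fact (r - n)) * (real n * ?D) ^ n"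
  proof -
    have "real (odd_fact r) = real (odd_fact (r - n)) * (\<Prod>i<n. real (2 * (r - n + i) + 1))"
      using odd_fact_add[of "r - n" n] nr by simp
    also have "\<dots> \<le> real (odd_fact (r - n)) * (real n * ?D) ^ n"
    proof (intro mult_left_mono prod_le_power_real)
      fix i assume "i < n"
      then have "2 * (r - n + i) + 1 \<le> 2 * r" using nr by arith
      then have "2 * (r - n + i) + 1 \<le> n * d" unfolding r .
      then have "real (2 * (r - n + i) + 1) \<le> real (n * d)" by (rule of_nat_mono)
      then show "real (2 * (r - n + i) + 1) \<le> real n * ?D" by simp
    qed auto
    finally show ?thesis .
  qed
  have o2: "real (odd_fact s) * (real n * (?D - 4)) ^ (n - j) \<le> real (odd_fact (r - n))"
  proof -
    have e: "real (odd_fact (r - n)) = real (odd_fact s) * (\<Prod>i<n - j. real (2 * (s + i) + 1))"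
      unfolding s(1) odd_fact_add by simp
    have "(real n * (?D - 4)) ^ (n - j) = (\<Prod>i<n - j. real n * (?D - 4))" by simp
    also have "\<dots> \<le> (\<Prod>i<n - j. real (2 * (s + i) + 1))"
    proof (rule prod_mono)
      fix i
      have "n * d + 2 * j \<le> 2 * s + 4 * n" using r nr j by (simp add: s_def)
      then have "real (n * d) \<le> real (2 * s + 4 * n)" by (intro of_nat_mono) linarith
      then have "real n * (?D - 4) \<le> 2 * real s" by (simp add: algebra_simps)
      then show "0 \<le> real n * (?D - 4) \<and> real n * (?D - 4) \<le> real (2 * (s + i) + 1)" using D by simp
    qed
    finally show ?thesis unfolding e by (intro mult_left_mono) auto
  qed
  have nD: "real n * (?D - 4) > 0" using D j by simp
  have ratio: "real (odd_fact s) * real (odd_fact r) / (real (odd_fact (r - n)))\<^sup>2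
      \<le> (real n * ?D) ^ n / (real n * (?D - 4)) ^ (n - j)"
  proof -
    have o: "real (odd_fact (r - n)) > 0" by simp
    have "real (odd_fact s) / real (odd_fact (r - n)) \<le> 1 / (real n * (?D - 4)) ^ (n - j)"
      using o2 nD o by (simp add: field_simps)
    moreover have "real (odd_fact r) / real (odd_fact (r - n)) \<le> (real n * ?D) ^ n"
      using o1 o by (simp add: field_simps)
    ultimately have "real (odd_fact s) / real (odd_fact (r - n)) * (real (odd_fact r) / real (odd_fact (r - n)))
        \<le> 1 / (real n * (?D - 4)) ^ (n - j) * (real n * ?D) ^ n"
      using nD by (intro mult_mono) auto
    then show ?thesis by (simp add: power2_eq_square)
  qed
  have comb: "real (n choose j) * (real n * fact (n - j - 1) / fact n) \<le> real n / fact j"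
  proof -
    have nj: "fact (n - j) = real (n - j) * fact (n - j - 1)" using j by (simp add: fact_reduce)
    have "real (n choose j) * (real n * fact (n - j - 1) / fact n) = real n / (fact j * real (n - j))"
      using j by (simp add: binomial_fact nj)
    also have "\<dots> \<le> real n / (fact j * 1)" using j by (intro divide_left_mono mult_left_mono) auto
    finally show ?thesis by simp
  qed
  let ?c = "(?D - 2) * (?D - 3)" and ?e = "?D * (?D - 1)"
  have pw: "?c ^ (n - j) / ?e ^ n * ((real n * ?D) ^ n / (real n * (?D - 4)) ^ (n - j)) \<le> 2 ^ n * (real n / (?D - 1)) ^ j"
  proof -
    have ns: "n = j + (n - j)" using j by simp
    have split: "y ^ n = y ^ j * y ^ (n - j)" for y :: real using power_add[of y j "n - j"] j by simp
    have "?c ^ (n - j) / ?e ^ n * ((real n * ?D) ^ n / (real n * (?D - 4)) ^ (n - j))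
        = (real n * ?D / ?e) ^ j * (?c / ?e * (real n * ?D) / (real n * (?D - 4))) ^ (n - j)"
      unfolding split[of ?e] split[of "real n * ?D"] by (simp add: power_divide power_mult_distrib mult_ac)
    also have "real n * ?D / ?e = real n / (?D - 1)" using D by simp
    also have "?c / ?e * (real n * ?D) / (real n * (?D - 4)) = ?c / ((?D - 1) * (?D - 4))"
    proof -
      have "c / (x * y) * (N * x) / (N * z) = c / (y * z)" if "x \<noteq> 0" "y \<noteq> 0" "z \<noteq> 0" "N \<noteq> 0" for c x y z N :: real
        using that by (simp add: field_simps)
      then show ?thesis using D j by simp
    qed
    also have "(real n / (?D - 1)) ^ j * (?c / ((?D - 1) * (?D - 4))) ^ (n - j) \<le> (real n / (?D - 1)) ^ j * 2 ^ (n - j)"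
    proof (intro mult_left_mono power_mono)
      have "?c \<le> 2 * ((?D - 1) * (?D - 4))"
      proof -
        have "(?D - 2) * (?D - 3) \<le> (?D - 1) * (2 * (?D - 4))" using D by (intro mult_mono) auto
        then show ?thesis by (metis mult.left_commute)
      qed
      then show "?c / ((?D - 1) * (?D - 4)) \<le> 2" using D by (simp add: pos_divide_le_eq)
    qed (use D in auto)
    also have "\<dots> \<le> (real n / (?D - 1)) ^ j * 2 ^ n"
      using D by (intro mult_left_mono power_increasing) auto
    finally show ?thesis by (simp add: mult.commute)
  qed
  have c0: "?c > 0" "?e > 0" using D by auto
  have w: "overlap_weight n d r j = (real n * fact (n - j - 1) / fact n)
      * (?c ^ (n - j) / ?e ^ n * (real (odd_fact s) * real (odd_fact r) / (real (odd_fact (r - n)))\<^sup>2))"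
    by (simp add: overlap_weight_def s_def)
  have w0: "overlap_weight n d r j \<ge> 0" unfolding w using c0 by (intro mult_nonneg_nonneg divide_nonneg_nonneg) auto
  have "run_coeff ?b n j * overlap_weight n d r j \<le> (real (n choose j) * ?b ^ j) * overlap_weight n d r j"
    by (rule mult_right_mono[OF run_coeff_le[OF b(1)] w0])
  also have "\<dots> = ?b ^ j * ((real (n choose j) * (real n * fact (n - j - 1) / fact n))
      * (?c ^ (n - j) / ?e ^ n * (real (odd_fact s) * real (odd_fact r) / (real (odd_fact (r - n)))\<^sup>2)))"
    unfolding w by (simp add: mult_ac)
  also have "\<dots> \<le> 3 ^ j * ((real n / fact j) * (2 ^ n * (real n / (?D - 1)) ^ j))"
  proof -
    have "?c ^ (n - j) / ?e ^ n * (real (odd_fact s) * real (odd_fact r) / (real (odd_fact (r - n)))\<^sup>2)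
        \<le> ?c ^ (n - j) / ?e ^ n * ((real n * ?D) ^ n / (real n * (?D - 4)) ^ (n - j))"
      using ratio c0 by (intro mult_left_mono) auto
    then have Z: "?c ^ (n - j) / ?e ^ n * (real (odd_fact s) * real (odd_fact r) / (real (odd_fact (r - n)))\<^sup>2)
        \<le> 2 ^ n * (real n / (?D - 1)) ^ j" using pw by linarith
    have Z0: "0 \<le> ?c ^ (n - j) / ?e ^ n * (real (odd_fact s) * real (odd_fact r) / (real (odd_fact (r - n)))\<^sup>2)"
      using c0 D by (intro mult_nonneg_nonneg divide_nonneg_nonneg zero_le_power) auto
    have b3: "?b ^ j \<le> 3 ^ j" using b by (intro power_mono) auto
    show ?thesis
      by (rule mult_mono[OF b3 mult_mono[OF comb Z _ Z0]])
        (use Z0 d in \<open>auto intro!: mult_nonneg_nonneg\<close>)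
  qed
  also have "\<dots> = real n * 2 ^ n * ((12 / (?D - 1)) ^ j * ((real n / 4) ^ j / fact j))"
  proof -
    have e: "3 ^ j * (real n / (?D - 1)) ^ j = (12 / (?D - 1)) ^ j * (real n / 4) ^ j"
    proof -
      have "3 * (N / y) = 12 / y * (N / 4)" for N y :: real by simp
      then show ?thesis by (metis power_mult_distrib)
    qed
    have g: "a * ((N / f) * (T * Y)) = N * T * ((a * Y) / f)" for a N f T Y :: real by simp
    show ?thesis unfolding g e by (simp only: times_divide_eq_right)
  qed
  also have "\<dots> \<le> real n * 2 ^ n * ((1 / 2) ^ (3 * n) * 2 ^ n)"
  proof (intro mult_left_mono mult_mono)
    have "(12 / (?D - 1)) ^ j \<le> ((1 / 2) ^ 12) ^ j"
    proof (rule power_mono)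
      show "12 / (?D - 1) \<le> (1 / 2) ^ 12" using D by (simp add: field_simps)
    qed (use D in simp)
    also have "\<dots> = (1 / 2) ^ (12 * j)" by (simp flip: power_mult)
    also have "\<dots> \<le> (1 / 2) ^ (3 * n)" using j by (intro power_decreasing) auto
    finally show "(12 / (?D - 1)) ^ j \<le> (1 / 2) ^ (3 * n)" .
    have "(real n / 4) ^ j / fact j \<le> exp (real n / 4)" by (rule power_div_fact_le_exp) simp
    also have "\<dots> = exp (1 / 4) ^ n" by (simp flip: exp_of_nat_mult)
    also have "\<dots> \<le> 2 ^ n" using exp_half_le[of "1 / 2"] by (intro power_mono) auto
    finally show "(real n / 4) ^ j / fact j \<le> 2 ^ n" .
  qed (use D in auto)
  also have "\<dots> = real n * (1 / 2) ^ n"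
  proof -
    have three: "3 * n = n + n + n" by simp
    have "x * (y * y * y * x) = (x * y) * (x * y) * y" for x y :: real by simp
    moreover have "(2::real) ^ n * (1 / 2) ^ n = 1" by (simp flip: power_mult_distrib)
    ultimately have "(2::real) ^ n * ((1 / 2) ^ (3 * n) * 2 ^ n) = (1 / 2) ^ n"
      unfolding three power_add by (metis mult_1)
    then show ?thesis by simp
  qed
  finally show ?thesis .
qed

text \<open>The main term is 1 + K up to higher order in 1 / d, with K = (2 / d) (1 + 4 \<eta>). The
  remaining terms are exponentially small in n once d is large compared with 1 / \<eta>^2.\<close>

lemma second_moment_bound:
  assumes r: "n * d = 2 * r" and n: "n \<ge> 8" and d: "d \<ge> 50000"
    and \<eta>: "0 < \<eta>" "\<eta> \<le> 1 / 4" "real d \<ge> 2 / \<eta>"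
  defines "m \<equiv> fact n * (real d * (real d - 1)) ^ n * real (odd_fact (r - n)) / real (odd_fact r)"
    and "K \<equiv> 2 / real d * (1 + 4 * \<eta>)"
  shows "(\<Sum>P\<in>pairings n d. (real (round_count n d P))\<^sup>2) / real (odd_fact r) / m\<^sup>2
    \<le> 2 * real n * (1 / 2) ^ n + (real n)\<^sup>2 * (1 / 2) ^ n
      + (1 + (1 / 2) ^ n) * (1 + K * (1 + 2 / real d) + K\<^sup>2 * tail_const)
      + 8 * exp (5 * real n / real d - real n * \<eta>\<^sup>2 / 16)
      + 2 * exp (11 * real n / real d) * (5 / 8) ^ (n div 4)
      + 2 * exp (5 * real n / real d) * (17 / 20) ^ (n div 4)"
proof -
  interpret beta_laplace n "real d" using n d by unfold_locales auto
  let ?N = "run_coeff bb n"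
  interpret beta_trace n "real d" ?N
  proof
    show "0 \<le> ?N j" for j using consts_pos(3) by (intro run_coeff_nonneg) simp
    show "(\<Sum>j\<le>n. ?N j * x ^ j) = l ^ n + m ^ n"
      if "x > 0" "l + m = 1 + x" "l * m = - (bb - 1) * x" for x l m
      unfolding run_coeff_sum by (rule run_sum_eigenvalues) (use that n in auto)
  qed
  have nr: "2 * n < r"
  proof -
    have "n * 6 \<le> n * d" using d by (intro mult_le_mono2) simp
    then show ?thesis using r n by linarith
  qed
  have Ar: "A = real (r - n) + 1 / 2"
  proof -
    have "real n * real d = 2 * real r" using r by (metis of_nat_mult of_nat_numeral)
    then show ?thesis using nr by (simp add: A_def of_nat_diff field_simps)
  qed
  let ?h = "\<lambda>j u. (cc / cp) ^ n * ?N j * (xx u ^ j / (1 - u) ^ n)"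
  have weight: "has_bochner_integral M (?h j) (?N j * overlap_weight n d r j)" if j: "j < n" for j
  proof -
    let ?B = "Beta (real n - real j) (A + real j - real n) / Beta (real n) A"
    have "has_bochner_integral M (\<lambda>u. u ^ 0 / u ^ j * ((1 - u) ^ j / (1 - u) ^ n))
        (Beta (real n + real 0 - real j) (A + real j - real n) / Beta (real n) A)"
      unfolding M_def
      by (rule beta_dist_monomial[OF n_pos A_pos]) (use j nr Ar in \<open>auto simp: of_nat_diff\<close>)
    then have "has_bochner_integral M (\<lambda>u. ((cc / cp) ^ n * ?N j / cc ^ j) * (u ^ 0 / u ^ j * ((1 - u) ^ j / (1 - u) ^ n)))
        (((cc / cp) ^ n * ?N j / cc ^ j) * ?B)"
      by (intro has_bochner_integral_mult_right) simp
    moreover have "((cc / cp) ^ n * ?N j / cc ^ j) * (u ^ 0 / u ^ j * ((1 - u) ^ j / (1 - u) ^ n)) = ?h j u" for u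
      by (simp add: xx_def power_divide power_mult_distrib)
    \<comment> \<open>All Gamma values are factorials or double factorials. The powers of 2 that
      come with the latter collapse to 2^(- j), matched by the halves in \<open>cc\<close> and
      \<open>cp\<close>.\<close>
    moreover have val: "((cc / cp) ^ n / cc ^ j) * ?B = overlap_weight n d r j"
    proof -
      define s where "s = r - (2 * n - j)"
      have sn: "s + n = (r - n) + j" using nr j by (simp add: s_def)
      have sr: "real s + real n = real (r - n) + real j" using sn by (metis of_nat_add)
      have G1: "Gamma (real n - real j) = fact (n - j - 1)"
      proof -
        have "real n - real j = 1 + real (n - j - 1)" using j by simp
        then show ?thesis by (metis Gamma_fact)
      qed
      have G2: "Gamma (real n) = fact (n - 1)"
      proof -
        have "real n = 1 + real (n - 1)" using n by simp
        then show ?thesis by (metis Gamma_fact)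
      qed
      let ?g = "Gamma (1 / 2 :: real)"
      note g = Gamma_half_nonzero
      have G3: "Gamma (A + real j - real n) = real (odd_fact s) * ?g / 2 ^ s"
      proof -
        have "A + real j - real n = real s + 1 / 2" using Ar sr by linarith
        then show ?thesis using g by (simp add: odd_fact_Gamma)
      qed
      have G4: "Gamma A = real (odd_fact (r - n)) * ?g / 2 ^ (r - n)"
        unfolding Ar odd_fact_Gamma using g by simp
      have G5: "Gamma (real n + A) = real (odd_fact r) * ?g / 2 ^ r"
      proof -
        have "real n + A = real r + 1 / 2" using Ar nr by (simp add: of_nat_diff)
        then show ?thesis using g by (simp add: odd_fact_Gamma)
      qed
      have e: "real n - real j + (A + real j - real n) = A" by simp
      have fn: "fact n = real n * fact (n - 1)" using n by (simp add: fact_reduce)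
      have p2: "(2::real) ^ (r - n) * 2 ^ (r - n) = 2 ^ r * 2 ^ s / 2 ^ j"
      proof -
        have "(r - n) + (r - n) + j = r + s" using nr j by (simp add: s_def)
        then have "(2::real) ^ ((r - n) + (r - n) + j) = 2 ^ (r + s)" by simp
        then show ?thesis by (simp add: power_add field_simps)
      qed
      have B: "?B = fact (n - j - 1) / fact (n - 1)
          * (real (odd_fact s) * real (odd_fact r) / (real (odd_fact (r - n)))\<^sup>2)
          * (2 ^ (r - n) * 2 ^ (r - n) / (2 ^ r * 2 ^ s))"
        unfolding Beta_def e G1 G2 G3 G4 G5 using g by (simp add: field_simps power2_eq_square)
      also have "2 ^ (r - n) * 2 ^ (r - n) / (2 ^ r * 2 ^ s) = (1 / 2 ^ j :: real)"
        unfolding p2 by simp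
      finally have B': "?B = fact (n - j - 1) / fact (n - 1)
          * (real (odd_fact s) * real (odd_fact r) / (real (odd_fact (r - n)))\<^sup>2) * (1 / 2 ^ j)" .
      have c: "(real d - 2) * (real d - 3) = 2 * cc" "real d * (real d - 1) = 2 * cp"
        by (simp_all add: cc_def cp_def)
      have pw: "(2 * cc) ^ (n - j) / (2 * cp) ^ n = (cc / cp) ^ n / cc ^ j * (1 / 2 ^ j)"
      proof -
        have "n = (n - j) + j" using j by simp
        then have "(2 * cc) ^ n = (2 * cc) ^ (n - j) * (2 * cc) ^ j" by (metis power_add)
        then have "(2 * cc) ^ (n - j) = (2 * cc) ^ n / (2 * cc) ^ j" using consts_pos(1) by simp
        then show ?thesis using consts_pos by (simp add: power_mult_distrib power_divide)
      qed
      have "overlap_weight n d r j = fact (n - j - 1) / fact (n - 1) * ((2 * cc) ^ (n - j) / (2 * cp) ^ n)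
          * (real (odd_fact s) * real (odd_fact r) / (real (odd_fact (r - n)))\<^sup>2)"
        unfolding overlap_weight_def s_def[symmetric] c fn using n by simp
      then show ?thesis unfolding B' pw by (simp add: mult_ac)
    qed
    moreover have "((cc / cp) ^ n * ?N j / cc ^ j) * ?B = ?N j * overlap_weight n d r j"
      unfolding val[symmetric] by (simp add: mult_ac)
    ultimately show ?thesis by (simp only:)
  qed
  have hb: "has_bochner_integral M head (\<Sum>j\<le>n div 4. ?N j * overlap_weight n d r j)"
    unfolding head_def[abs_def] using n by (intro has_bochner_integral_sum weight) simp
  then have ih: "integrable M head" and eh: "integral\<^sup>L M head = (\<Sum>j\<le>n div 4. ?N j * overlap_weight n d r j)"
    by (auto simp: has_bochner_integral_iff)
  have "{..<n} = {..n div 4} \<union> {n div 4<..<n}" using n by auto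
  then have "(\<Sum>j<n. ?N j * overlap_weight n d r j)
      = (\<Sum>j\<le>n div 4. ?N j * overlap_weight n d r j) + (\<Sum>j\<in>{n div 4<..<n}. ?N j * overlap_weight n d r j)"
    by (simp add: sum.union_disjoint disjoint_iff)
  also have "(\<Sum>j\<in>{n div 4<..<n}. ?N j * overlap_weight n d r j) \<le> (\<Sum>j\<in>{n div 4<..<n}. real n * (1 / 2) ^ n)"
  proof (rule sum_mono)
    fix j assume "j \<in> {n div 4<..<n}"
    then have "j < n" "n \<le> 4 * j" by auto
    then show "?N j * overlap_weight n d r j \<le> real n * (1 / 2) ^ n"
      unfolding bb_def using overlap_weight_tail[OF r d] by blast
  qed
  also have "\<dots> = real (card {n div 4<..<n}) * (real n * (1 / 2) ^ n)" by simp
  also have "\<dots> \<le> real n * (real n * (1 / 2) ^ n)" by (intro mult_right_mono) auto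
  also have "\<dots> = (real n)\<^sup>2 * (1 / 2) ^ n" by (simp add: power2_eq_square)
  finally have sum: "(\<Sum>j<n. ?N j * overlap_weight n d r j)
      \<le> integral\<^sup>L M head + (real n)\<^sup>2 * (1 / 2) ^ n" unfolding eh by simp
  have m2: "2 ^ n \<le> m" unfolding m_def by (rule first_moment_lower[OF r]) (use n d in auto)
  have "2 * real n / m \<le> 2 * real n / 2 ^ n"
  proof -
    have "m > 0" using m2 zero_less_power[of "2 :: real" n] by linarith
    then show ?thesis using m2 by (intro divide_left_mono) auto
  qed
  then have fm: "2 * real n / m \<le> 2 * real n * (1 / 2) ^ n" by (simp add: power_divide)
  have "(\<Sum>P\<in>pairings n d. (real (round_count n d P))\<^sup>2) / real (odd_fact r) / m\<^sup>2
      \<le> 2 * real n / m + (\<Sum>j<n. ?N j * overlap_weight n d r j)"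
    unfolding m_def bb_def by (rule second_moment_ratio[OF r]) (use n d in auto)
  then show ?thesis
    using sum fm head_integral[OF \<eta> ih] d unfolding K_def by simp
qed

section \<open>The number of loops is nearly Poisson\<close>

lemma bij_betw_matchings_image:
  assumes "inj f"
  shows "bij_betw ((`) ((`) f)) (perfect_matchings Y) (perfect_matchings (f ` Y))"
proof (rule bij_betw_byWitness[where f' = "(`) ((`) (inv f))"])
  have inv: "inv f ` f ` e = e" for e using assms by (simp add: image_image)
  have inv': "f ` inv f ` e = e" if "e \<subseteq> range f" for e
    using that by (force simp: image_image f_inv_into_f)
  have m: "matching ((`) g ` P)" if "matching P" "inj_on g (\<Union>P)" for P and g :: "'c \<Rightarrow> 'd"
    unfolding matching_def disjoint_def
  proof (intro conjI ballI impI)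
    fix e assume "e \<in> (`) g ` P"
    then obtain e' where e': "e' \<in> P" "e = g ` e'" by blast
    have "inj_on g e'" using that(2) e'(1) by (meson Union_upper inj_on_subset)
    then show "card e = 2" using that(1) e' by (simp add: card_image matching_def)
  next
    fix e e' assume "e \<in> (`) g ` P" "e' \<in> (`) g ` P" "e \<noteq> e'"
    then obtain h h' where h: "h \<in> P" "h' \<in> P" "e = g ` h" "e' = g ` h'" "h \<noteq> h'" by blast
    then have "h \<inter> h' = {}" using that(1) by (auto simp: matching_def disjoint_def)
    then show "e \<inter> e' = {}"
      using that(2) h inj_on_image_Int[of g "\<Union>P" h h'] by auto
  qed
  show "\<forall>P\<in>perfect_matchings Y. (`) (inv f) ` (`) f ` P = P"
    using inv by (simp add: image_image)
  show "\<forall>P\<in>perfect_matchings (f ` Y). (`) f ` (`) (inv f) ` P = P"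
  proof
    fix P assume "P \<in> perfect_matchings (f ` Y)"
    then have "\<Union>P = f ` Y" by (simp add: perfect_matchings_altdef)
    then have "f ` inv f ` e = e" if "e \<in> P" for e using inv'[of e] that by blast
    then show "(`) f ` (`) (inv f) ` P = P" by (simp add: image_image)
  qed
  show "(`) ((`) f) ` perfect_matchings Y \<subseteq> perfect_matchings (f ` Y)"
  proof clarify
    fix P assume P: "P \<in> perfect_matchings Y"
    then have "matching P" "\<Union>P = Y" by (auto simp: perfect_matchings_altdef)
    moreover have "\<Union>((`) f ` P) = f ` \<Union>P" by blast
    ultimately show "(`) f ` P \<in> perfect_matchings (f ` Y)"
      using m[of P f] inj_on_subset[OF assms subset_UNIV] by (simp add: perfect_matchings_altdef)
  qed
  show "(`) ((`) (inv f)) ` perfect_matchings (f ` Y) \<subseteq> perfect_matchings Y"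
  proof clarify
    fix P assume P: "P \<in> perfect_matchings (f ` Y)"
    then have P': "matching P" "\<Union>P = f ` Y" by (auto simp: perfect_matchings_altdef)
    have "inj_on (inv f) (\<Union>P)" unfolding P'(2) by (rule inj_on_inv_into) auto
    moreover have "\<Union>((`) (inv f) ` P) = inv f ` \<Union>P" by blast
    ultimately show "(`) (inv f) ` P \<in> perfect_matchings Y"
      using m[OF P'(1), of "inv f"] P'(2) inv by (simp add: perfect_matchings_altdef)
  qed
qed

lemma sum_matchings_by_partner:
  fixes f :: "'a set set \<Rightarrow> complex"
  assumes X: "finite X" and a: "a \<in> X"
  shows "(\<Sum>P\<in>perfect_matchings X. f P) = (\<Sum>y\<in>X - {a}. \<Sum>Q\<in>perfect_matchings (X - {a, y}). f (insert {a, y} Q))"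
proof -
  let ?C = "\<lambda>y. {P \<in> perfect_matchings X. {a, y} \<in> P}"
  have "(\<Sum>P\<in>perfect_matchings X. f P) = (\<Sum>P\<in>(\<Union>y\<in>X - {a}. ?C y). f P)"
    using matching_containing_point[OF a] by simp
  also have "\<dots> = (\<Sum>y\<in>X - {a}. \<Sum>P\<in>?C y. f P)"
  proof (rule sum.UNION_disjoint)
    show "\<forall>i\<in>X - {a}. \<forall>j\<in>X - {a}. i \<noteq> j \<longrightarrow> ?C i \<inter> ?C j = {}"
    proof (intro ballI impI equals0I)
      fix i j P assume ij: "i \<in> X - {a}" "j \<in> X - {a}" "i \<noteq> j" and P: "P \<in> ?C i \<inter> ?C j"
      have "{a, i} = {a, j}"
        using P by (intro matching_eqI[of P _ _ a]) (auto simp: perfect_matchings_altdef)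
      then show False using ij by (auto simp: doubleton_eq_iff)
    qed
  qed (use X finite_perfect_matchings[OF X] in auto)
  also have "\<dots> = (\<Sum>y\<in>X - {a}. \<Sum>Q\<in>perfect_matchings (X - {a, y}). f (insert {a, y} Q))"
  proof (rule sum.cong[OF refl])
    fix y assume y: "y \<in> X - {a}"
    then have m: "matching {{a, y}}" by (auto simp: matching_def card_2_iff)
    have "bij_betw (\<lambda>Q. insert {a, y} Q) (perfect_matchings (X - {a, y})) (?C y)"
      using bij_betw_matchings_containing[OF m, of X] a y by simp
    then show "(\<Sum>P\<in>?C y. f P) = (\<Sum>Q\<in>perfect_matchings (X - {a, y}). f (insert {a, y} Q))"
      by (rule sum.reindex_bij_betw[symmetric])
  qed
  finally show ?thesis .
qed

text \<open>A switching: a receives an arbitrary partner y, and b takes over the former partner of y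
  (nothing else happens if y = b). It couples pairings conditioned to contain the pair of a and b,
  with this pair deleted, to unconditioned pairings.\<close>

lemma sum_matchings_switch:
  fixes f :: "'a set set \<Rightarrow> complex"
  assumes X: "finite X" and ab: "a \<in> X" "b \<in> X" "a \<noteq> b"
  shows "(\<Sum>P\<in>perfect_matchings X. f P)
    = (\<Sum>Q\<in>perfect_matchings (X - {a, b}). \<Sum>y\<in>X - {a}. f (insert {a, y} ((`) (Transposition.transpose b y) ` Q)))"
proof -
  have "(\<Sum>Q\<in>perfect_matchings (X - {a, y}). f (insert {a, y} Q))
      = (\<Sum>Q\<in>perfect_matchings (X - {a, b}). f (insert {a, y} ((`) (Transposition.transpose b y) ` Q)))"
    if y: "y \<in> X - {a}" for y
  proof -
    have "Transposition.transpose b y ` (X - {a, b}) = X - {a, y}"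
    proof (intro equalityI subsetI)
      fix x assume x: "x \<in> X - {a, y}"
      then have "Transposition.transpose b y x \<in> X - {a, b}" using ab y by (auto simp: Transposition.transpose_def)
      moreover have "x = Transposition.transpose b y (Transposition.transpose b y x)" by simp
      ultimately show "x \<in> Transposition.transpose b y ` (X - {a, b})" by blast
    next
      fix x assume "x \<in> Transposition.transpose b y ` (X - {a, b})"
      then show "x \<in> X - {a, y}" using ab y by (auto simp: Transposition.transpose_def)
    qed
    then have "bij_betw ((`) ((`) (Transposition.transpose b y))) (perfect_matchings (X - {a, b})) (perfect_matchings (X - {a, y}))"
      using bij_betw_matchings_image[of "Transposition.transpose b y" "X - {a, b}"] by simp
    then show ?thesis by (rule sum.reindex_bij_betw[symmetric])
  qed
  then show ?thesis
    unfolding sum_matchings_by_partner[OF X ab(1)] by (subst sum.swap) simp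
qed

lemma loop_count_mono:
  assumes "loops n d \<inter> A \<subseteq> (loops n d \<inter> B) \<union> C" "finite C"
  shows "loop_count n d A \<le> loop_count n d B + card C"
proof -
  have "loop_count n d A = card (loops n d \<inter> A)" for A by (simp add: loop_count_def Int_def)
  then have "loop_count n d A \<le> card ((loops n d \<inter> B) \<union> C)"
    using assms finite_loops[of n d] by (simp add: card_mono)
  also have "\<dots> \<le> card (loops n d \<inter> B) + card C" by (rule card_Un_le)
  finally show ?thesis by (simp add: loop_count_def Int_def)
qed

text \<open>With z the partner of y in \<open>Q\<close>, the switching creates {a, y}, destroys {y,
  z} and creates {b, z}; the three indicators record which of these are loops.\<close>

lemma switch_loop_count:
  assumes Q: "Q \<in> perfect_matchings (X - {a, b})" and y: "y \<in> X - {a}"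
  shows "\<bar>real (loop_count n d (insert {a, y} ((`) (Transposition.transpose b y) ` Q))) - real (loop_count n d Q)\<bar>
    \<le> of_bool ({a, y} \<in> loops n d) + of_bool (\<exists>z. {y, z} \<in> Q \<and> {y, z} \<in> loops n d)
      + of_bool (\<exists>z. {y, z} \<in> Q \<and> {b, z} \<in> loops n d)"
proof -
  let ?L = "loops n d"
  let ?P = "insert {a, y} ((`) (Transposition.transpose b y) ` Q)"
  have m: "matching Q" and U: "\<Union>Q = X - {a, b}" using Q by (auto simp: perfect_matchings_altdef)
  show ?thesis
  proof (cases "y = b")
    case True
    then have P: "?P = insert {a, y} Q" by simp
    have "loop_count n d ?P \<le> loop_count n d Q + card (?L \<inter> {{a, y}})"
      unfolding P by (rule loop_count_mono) auto
    moreover have "loop_count n d Q \<le> loop_count n d ?P + card ({} :: (nat \<times> nat) set set)"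
      unfolding P by (rule loop_count_mono) auto
    moreover have "card (?L \<inter> {{a, y}}) \<le> of_bool ({a, y} \<in> ?L)" by (cases "{a, y} \<in> ?L") auto
    ultimately have "\<bar>real (loop_count n d ?P) - real (loop_count n d Q)\<bar> \<le> of_bool ({a, y} \<in> ?L)"
      by (cases "{a, y} \<in> ?L") auto
    then show ?thesis by (simp add: add_increasing2)
  next
    case False
    then obtain f where f: "f \<in> Q" "y \<in> f" using U y by blast
    then have "card f = 2" using m by (simp add: matching_def)
    then obtain z where z: "f = {y, z}" "z \<noteq> y" using f(2) unfolding card_2_iff by auto
    have "f \<subseteq> X - {a, b}" using f(1) U by blast
    then have zb: "z \<noteq> b" using z(1) by auto
    have tf: "Transposition.transpose b y ` f = {b, z}" using z zb by (auto simp: Transposition.transpose_def)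
    have te: "Transposition.transpose b y ` e = e" if "e \<in> Q" "e \<noteq> f" for e
    proof -
      have "b \<notin> e" using that(1) U by blast
      moreover have "y \<notin> e" using matching_eqI[OF m that(1) f(1)] f(2) that(2) by blast
      ultimately have "Transposition.transpose b y x = x" if "x \<in> e" for x using that by (auto simp: Transposition.transpose_def)
      then show ?thesis by simp
    qed
    have "Q = insert f (Q - {f})" using f by blast
    then have "(`) (Transposition.transpose b y) ` Q = insert (Transposition.transpose b y ` f) ((`) (Transposition.transpose b y) ` (Q - {f}))"
      by (metis image_insert)
    also have "(`) (Transposition.transpose b y) ` (Q - {f}) = Q - {f}" using te by simp
    finally have P: "?P = insert {a, y} (insert {b, z} (Q - {f}))" unfolding tf by simp
    have "loop_count n d ?P \<le> loop_count n d Q + card (?L \<inter> {{a, y}, {b, z}})"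
      unfolding P by (rule loop_count_mono) auto
    moreover have "loop_count n d Q \<le> loop_count n d ?P + card (?L \<inter> {f})"
      unfolding P by (rule loop_count_mono) auto
    moreover have "card (?L \<inter> {{a, y}, {b, z}}) \<le> of_bool ({a, y} \<in> ?L) + of_bool ({b, z} \<in> ?L)"
      by (cases "{a, y} \<in> ?L"; cases "{b, z} \<in> ?L") (auto simp: card_insert_if)
    moreover have "card (?L \<inter> {f}) \<le> of_bool (f \<in> ?L)" by (cases "f \<in> ?L") auto
    moreover have "of_bool (f \<in> ?L) \<le> (of_bool (\<exists>z. {y, z} \<in> Q \<and> {y, z} \<in> ?L) :: nat)"
    proof (cases "f \<in> ?L")
      case True
      then have "\<exists>z. {y, z} \<in> Q \<and> {y, z} \<in> ?L" by (intro exI[of _ z]) (use f z in simp)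
      then show ?thesis by (simp only: of_bool_eq) simp
    qed simp
    moreover have "of_bool ({b, z} \<in> ?L) \<le> (of_bool (\<exists>z. {y, z} \<in> Q \<and> {b, z} \<in> ?L) :: nat)"
    proof (cases "{b, z} \<in> ?L")
      case True
      then have "\<exists>z. {y, z} \<in> Q \<and> {b, z} \<in> ?L" by (intro exI[of _ z]) (use f z in simp)
      then show ?thesis by (simp only: of_bool_eq) simp
    qed simp
    ultimately have "real (loop_count n d ?P) \<le> real (loop_count n d Q + (of_bool ({a, y} \<in> ?L)
        + of_bool (\<exists>z. {y, z} \<in> Q \<and> {b, z} \<in> ?L)))"
      and "real (loop_count n d Q) \<le> real (loop_count n d ?P + of_bool (\<exists>z. {y, z} \<in> Q \<and> {y, z} \<in> ?L))"
      by (auto simp only: of_nat_le_iff)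
    moreover have "real (of_bool p) = of_bool p" "(0::real) \<le> of_bool p" for p by auto
    ultimately show ?thesis unfolding of_nat_add by (smt (verit))
  qed
qed

text \<open>At most d choices of y form a loop with a; the y on loops of \<open>Q\<close> number at
  most twice the loops; and at most d choices of y have their partner in the bin of b.\<close>

lemma switch_loop_count_sum:
  assumes ab: "{a, b} \<in> loops n d" and Q: "Q \<in> perfect_matchings (prevertices n d - {a, b})"
  shows "(\<Sum>y\<in>prevertices n d - {a}.
      \<bar>real (loop_count n d (insert {a, y} ((`) (Transposition.transpose b y) ` Q))) - real (loop_count n d Q)\<bar>)
    \<le> 2 * real (loop_count n d Q) + 2 * real d"
proof -
  let ?L = "loops n d" and ?X = "prevertices n d"
  let ?A = "{y \<in> ?X - {a}. {a, y} \<in> ?L}" and ?B = "{y \<in> ?X - {a}. \<exists>z. {y, z} \<in> Q \<and> {y, z} \<in> ?L}"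
    and ?C = "{y \<in> ?X - {a}. \<exists>z. {y, z} \<in> Q \<and> {b, z} \<in> ?L}"
  have fin: "finite (?X - {a})" by (simp add: card_prevertices)
  have m: "matching Q" using Q by (simp add: perfect_matchings_altdef)
  have same_bin: "y \<in> {fst x} \<times> {..<d}" if "{x, y} \<in> ?L" for x y
  proof -
    obtain v where "{x, y} \<subseteq> {v} \<times> {..<d}" using \<open>{x, y} \<in> ?L\<close> unfolding loops_def by blast
    then show ?thesis by auto
  qed
  have "card ?A \<le> card ({fst a} \<times> {..<d})"
  proof (rule card_mono)
    show "?A \<subseteq> {fst a} \<times> {..<d}" using same_bin[of a] by blast
  qed simp
  then have A: "card ?A \<le> d" by (simp add: card_cartesian_product_singleton)
  have "card ?B \<le> card (\<Union>(?L \<inter> Q))"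
  proof (rule card_mono)
    show "finite (\<Union>(?L \<inter> Q))"
      by (rule finite_subset[of _ ?X]) (use loops_prevertices card_prevertices in auto)
  qed blast
  also have "\<dots> = 2 * card (?L \<inter> Q)"
    by (rule card_Union_matching) (rule matching_subset[OF m], simp)
  finally have B: "card ?B \<le> 2 * loop_count n d Q" by (simp add: loop_count_def Int_def)
  have "?C \<subseteq> (\<Union>z\<in>{fst b} \<times> {..<d}. {y. {y, z} \<in> Q})" using same_bin[of b] by blast
  moreover have one: "finite {y. {y, z} \<in> Q} \<and> card {y. {y, z} \<in> Q} \<le> 1" for z
  proof (cases "{y. {y, z} \<in> Q} = {}")
    case True
    show ?thesis unfolding True by simp
  next
    case False
    then obtain y where y: "{y, z} \<in> Q" by blast
    have "y' = y" if "{y', z} \<in> Q" for y'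
    proof -
      have "{y', z} = {y, z}" by (rule matching_eqI[OF m that y, of z]) auto
      then show ?thesis by (auto simp: doubleton_eq_iff)
    qed
    then have "{y. {y, z} \<in> Q} = {y}" using y by blast
    then show ?thesis by simp
  qed
  ultimately have "card ?C \<le> card (\<Union>z\<in>{fst b} \<times> {..<d}. {y. {y, z} \<in> Q})"
    by (intro card_mono) auto
  also have "\<dots> \<le> (\<Sum>z\<in>{fst b} \<times> {..<d}. card {y. {y, z} \<in> Q})" by (rule card_UN_le) simp
  also have "\<dots> \<le> (\<Sum>z\<in>{fst b} \<times> {..<d}. 1)" using one by (intro sum_mono) auto
  also have "\<dots> = d" by (simp add: card_cartesian_product_singleton)
  finally have C: "card ?C \<le> d" .
  have ob: "(\<Sum>y\<in>?X - {a}. of_bool (p y)) = real (card {y \<in> ?X - {a}. p y})" for p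
    using fin by (simp add: of_bool_def sum.If_cases Int_def)
  have "(\<Sum>y\<in>?X - {a}.
      \<bar>real (loop_count n d (insert {a, y} ((`) (Transposition.transpose b y) ` Q))) - real (loop_count n d Q)\<bar>)
    \<le> (\<Sum>y\<in>?X - {a}. of_bool ({a, y} \<in> ?L) + of_bool (\<exists>z. {y, z} \<in> Q \<and> {y, z} \<in> ?L)
      + of_bool (\<exists>z. {y, z} \<in> Q \<and> {b, z} \<in> ?L))"
    by (rule sum_mono) (rule switch_loop_count[OF Q])
  also have "\<dots> = real (card ?A) + real (card ?B) + real (card ?C)"
    unfolding sum.distrib ob ..
  also have "\<dots> \<le> 2 * real (loop_count n d Q) + 2 * real d" using A B C by linarith
  finally show ?thesis .
qed

section \<open>The characteristic function of the loop count\<close>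

definition loop_mean :: "nat \<Rightarrow> nat \<Rightarrow> real" where
  "loop_mean n d = real n * real (d choose 2) / (real n * real d - 1)"

definition loop_char :: "nat \<Rightarrow> nat \<Rightarrow> real \<Rightarrow> complex" where
  "loop_char n d t = (\<Sum>P\<in>pairings n d. cis (t * real (loop_count n d P))) / of_nat (card (pairings n d))"

definition loop_char_deriv :: "nat \<Rightarrow> nat \<Rightarrow> real \<Rightarrow> complex" where
  "loop_char_deriv n d t = \<i> * (\<Sum>P\<in>pairings n d. of_nat (loop_count n d P) * cis (t * real (loop_count n d P)))
     / of_nat (card (pairings n d))"

lemma norm_cis_diff: "norm (cis x - cis y) \<le> \<bar>x - y\<bar>"
proof -
  have "norm (cis x - cis y) = norm (cis y * (cis (x - y) - 1))"
    by (simp add: right_diff_distrib cis_mult)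
  also have "\<dots> = norm (iexp (x - y) - 1)" by (simp add: norm_mult cis_conv_exp)
  also have "\<dots> \<le> \<bar>x - y\<bar>" using iexp_approx1[of "x - y" 0] by simp
  finally show ?thesis .
qed

lemma loop_count_insert_loop:
  assumes "e \<in> loops n d" "e \<notin> Q"
  shows "loop_count n d (insert e Q) = Suc (loop_count n d Q)"
proof -
  have "{f \<in> loops n d. f \<in> insert e Q} = insert e {f \<in> loops n d. f \<in> Q}" using assms by auto
  then show ?thesis using assms finite_loops[of n d] by (simp add: loop_count_def)
qed

lemma matchings_minus_loop:
  assumes r: "n * d = 2 * r" and e: "e \<in> loops n d"
  shows "card (perfect_matchings (prevertices n d - e)) = odd_fact (r - 1)"
    "finite (perfect_matchings (prevertices n d - e))" "r \<ge> 1"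
proof -
  have c: "card e = 2" using e by (simp add: loops_def)
  then have fe: "finite e" by (metis card.infinite zero_neq_numeral)
  have "card e \<le> card (prevertices n d)" using loops_prevertices[OF e] by (intro card_mono) (simp_all add: card_prevertices)
  then show r1: "r \<ge> 1" using r c by (simp add: card_prevertices)
  have "card (prevertices n d - e) = 2 * (r - 1)"
    using loops_prevertices[OF e] c fe r r1 by (subst card_Diff_subset) (auto simp: card_prevertices)
  then show "card (perfect_matchings (prevertices n d - e)) = odd_fact (r - 1)"
    by (intro card_perfect_matchings) (simp_all add: card_prevertices)
  show "finite (perfect_matchings (prevertices n d - e))"
    by (intro finite_perfect_matchings) (simp add: card_prevertices)
qed

lemma sum_loop_count_minus_loop:
  assumes r: "n * d = 2 * r" and e: "e \<in> loops n d"
  shows "(\<Sum>Q\<in>perfect_matchings (prevertices n d - e). loop_count n d Q) \<le> n * (d choose 2) * odd_fact (r - 2)"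
proof -
  let ?X = "prevertices n d - e"
  have "(\<Sum>Q\<in>perfect_matchings ?X. loop_count n d Q) = (\<Sum>f\<in>loops n d. card {Q \<in> perfect_matchings ?X. f \<in> Q})"
    unfolding loop_count_def by (rule sum_card_swap[OF finite_loops matchings_minus_loop(2)[OF r e]])
  also have "\<dots> \<le> (\<Sum>f\<in>loops n d. odd_fact (r - 2))"
  proof (rule sum_mono)
    fix f assume f: "f \<in> loops n d"
    have c: "card e = 2" using e by (simp add: loops_def)
    then have fe: "finite e" by (metis card.infinite zero_neq_numeral)
    have X: "card ?X = 2 * (r - 1)"
      using loops_prevertices[OF e] c fe r matchings_minus_loop(3)[OF r e]
      by (subst card_Diff_subset) (auto simp: card_prevertices)
    show "card {Q \<in> perfect_matchings ?X. f \<in> Q} \<le> odd_fact (r - 2)"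
    proof (cases "f \<subseteq> ?X")
      case True
      have "matching {f}" using f by (simp add: loops_def matching_def)
      then show ?thesis
        using card_matchings_containing[of ?X "r - 1" "{f}"] X True by (simp add: card_prevertices numeral_2_eq_2)
    next
      case False
      have "{Q \<in> perfect_matchings ?X. f \<in> Q} = {}"
      proof (rule equals0I)
        fix Q assume "Q \<in> {Q \<in> perfect_matchings ?X. f \<in> Q}"
        then have "f \<subseteq> ?X" by (auto simp: perfect_matchings_altdef)
        then show False using False by blast
      qed
      then show ?thesis by (metis card.empty zero_le)
    qed
  qed
  also have "\<dots> = n * (d choose 2) * odd_fact (r - 2)" by (simp add: card_loops)
  finally show ?thesis .
qed

text \<open>Compares the sum over all pairings with the sum over pairings that contain the loop
  \<open>e\<close>, where \<open>e\<close> itself is not counted. Each \<open>Q\<close> arises with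
  2 r - 1 partners y, hence the factor; as \<open>cis\<close> is 1-Lipschitz, the error is the total
  change of the count times the modulus of t.\<close>

lemma switch_average:
  assumes r: "n * d = 2 * r" and e: "e \<in> loops n d" and r2: "r \<ge> 2"
  shows "norm ((\<Sum>P\<in>pairings n d. cis (t * real (loop_count n d P)))
      - of_nat (2 * r - 1) * (\<Sum>Q\<in>perfect_matchings (prevertices n d - e). cis (t * real (loop_count n d Q))))
    \<le> \<bar>t\<bar> * (2 * (real n * real (d choose 2) * real (odd_fact (r - 2))) + 2 * real d * real (odd_fact (r - 1)))"
proof -
  let ?X = "prevertices n d"
  obtain a b where ab: "e = {a, b}" "a \<noteq> b" using e unfolding loops_def card_2_iff by blast
  have abX: "a \<in> ?X" "b \<in> ?X" using loops_prevertices[OF e] ab by auto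
  let ?M = "perfect_matchings (?X - {a, b})"
  let ?sw = "\<lambda>Q y. insert {a, y} ((`) (Transposition.transpose b y) ` Q)"
  let ?F = "\<lambda>P. cis (t * real (loop_count n d P))"
  have cX: "card (?X - {a}) = 2 * r - 1" using abX r by (simp add: card_prevertices)
  have "(\<Sum>P\<in>pairings n d. ?F P) - of_nat (2 * r - 1) * (\<Sum>Q\<in>?M. ?F Q)
      = (\<Sum>Q\<in>?M. (\<Sum>y\<in>?X - {a}. ?F (?sw Q y)) - of_nat (2 * r - 1) * ?F Q)"
    unfolding pairings_eq using sum_matchings_switch[OF _ abX ab(2), of ?F]
    by (simp add: card_prevertices sum_subtractf sum_distrib_left)
  also have "\<dots> = (\<Sum>Q\<in>?M. \<Sum>y\<in>?X - {a}. ?F (?sw Q y) - ?F Q)"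
    by (simp add: sum_subtractf cX)
  finally have eq: "(\<Sum>P\<in>pairings n d. ?F P) - of_nat (2 * r - 1) * (\<Sum>Q\<in>?M. ?F Q)
      = (\<Sum>Q\<in>?M. \<Sum>y\<in>?X - {a}. ?F (?sw Q y) - ?F Q)" .
  have "norm (\<Sum>Q\<in>?M. \<Sum>y\<in>?X - {a}. ?F (?sw Q y) - ?F Q)
      \<le> (\<Sum>Q\<in>?M. \<bar>t\<bar> * (2 * real (loop_count n d Q) + 2 * real d))"
  proof (rule sum_norm_le)
    fix Q assume Q: "Q \<in> ?M"
    have "norm (\<Sum>y\<in>?X - {a}. ?F (?sw Q y) - ?F Q)
        \<le> (\<Sum>y\<in>?X - {a}. \<bar>t\<bar> * \<bar>real (loop_count n d (?sw Q y)) - real (loop_count n d Q)\<bar>)"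
    proof (rule sum_norm_le)
      fix y
      show "norm (?F (?sw Q y) - ?F Q) \<le> \<bar>t\<bar> * \<bar>real (loop_count n d (?sw Q y)) - real (loop_count n d Q)\<bar>"
        using norm_cis_diff[of "t * real (loop_count n d (?sw Q y))" "t * real (loop_count n d Q)"]
        by (simp flip: right_diff_distrib abs_mult)
    qed
    also have "\<dots> = \<bar>t\<bar> * (\<Sum>y\<in>?X - {a}. \<bar>real (loop_count n d (?sw Q y)) - real (loop_count n d Q)\<bar>)"
      by (simp add: sum_distrib_left)
    also have "\<dots> \<le> \<bar>t\<bar> * (2 * real (loop_count n d Q) + 2 * real d)"
      using switch_loop_count_sum[of a b n d Q] e ab Q by (intro mult_left_mono) auto
    finally show "norm (\<Sum>y\<in>?X - {a}. ?F (?sw Q y) - ?F Q) \<le> \<bar>t\<bar> * (2 * real (loop_count n d Q) + 2 * real d)" .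
  qed
  also have "\<dots> = \<bar>t\<bar> * (2 * real (\<Sum>Q\<in>?M. loop_count n d Q) + 2 * real d * real (card ?M))"
    by (simp add: sum.distrib algebra_simps flip: sum_distrib_left)
  also have "\<dots> \<le> \<bar>t\<bar> * (2 * real (n * (d choose 2) * odd_fact (r - 2)) + 2 * real d * real (odd_fact (r - 1)))"
  proof (intro mult_left_mono add_mono of_nat_mono)
    show "(\<Sum>Q\<in>?M. loop_count n d Q) \<le> n * (d choose 2) * odd_fact (r - 2)"
      using sum_loop_count_minus_loop[OF r e] ab by simp
    show "card ?M \<le> odd_fact (r - 1)" using matchings_minus_loop(1)[OF r e] ab by simp
  qed auto
  finally show ?thesis using eq ab by simp
qed

text \<open>Size biasing: the weight \<open>loop_count\<close> is a sum over the loops present, and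
  deleting the chosen loop lowers the count by one, which produces the factor
  \<open>cis t\<close>.\<close>

lemma sum_loop_count_cis:
  assumes r: "n * d = 2 * r"
  shows "(\<Sum>P\<in>pairings n d. of_nat (loop_count n d P) * cis (t * real (loop_count n d P)))
    = (\<Sum>e\<in>loops n d. cis t * (\<Sum>Q\<in>perfect_matchings (prevertices n d - e). cis (t * real (loop_count n d Q))))"
proof -
  let ?F = "\<lambda>P. cis (t * real (loop_count n d P))"
  have "of_nat (loop_count n d P) * ?F P = (\<Sum>e\<in>loops n d. if e \<in> P then ?F P else 0)" for P
    using finite_loops[of n d] by (simp add: loop_count_def sum.If_cases Int_def)
  then have "(\<Sum>P\<in>pairings n d. of_nat (loop_count n d P) * ?F P)
      = (\<Sum>e\<in>loops n d. \<Sum>P\<in>pairings n d. if e \<in> P then ?F P else 0)"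
    by (simp add: sum.swap[of _ "pairings n d"])
  also have "\<dots> = (\<Sum>e\<in>loops n d. cis t * (\<Sum>Q\<in>perfect_matchings (prevertices n d - e). ?F Q))"
  proof (rule sum.cong[OF refl])
    fix e assume e: "e \<in> loops n d"
    then have m: "matching {e}" by (simp add: loops_def matching_def)
    have bij: "bij_betw (\<lambda>Q. insert e Q) (perfect_matchings (prevertices n d - e)) {P \<in> pairings n d. e \<in> P}"
      using bij_betw_matchings_containing[OF m, of "prevertices n d"] loops_prevertices[OF e] by (simp add: pairings_eq)
    have "(\<Sum>P\<in>pairings n d. if e \<in> P then ?F P else 0) = (\<Sum>P\<in>{P \<in> pairings n d. e \<in> P}. ?F P)"
      using finite_pairings[of n d] by (simp add: sum.If_cases Int_def)
    also have "\<dots> = (\<Sum>Q\<in>perfect_matchings (prevertices n d - e). ?F (insert e Q))"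
      by (rule sum.reindex_bij_betw[OF bij, symmetric])
    also have "\<dots> = (\<Sum>Q\<in>perfect_matchings (prevertices n d - e). cis t * ?F Q)"
    proof (rule sum.cong[OF refl])
      fix Q assume Q: "Q \<in> perfect_matchings (prevertices n d - e)"
      have "e \<noteq> {}" using e by (auto simp: loops_def)
      then have "e \<notin> Q" using Q by (auto simp: perfect_matchings_altdef)
      then show "?F (insert e Q) = cis t * ?F Q"
        using loop_count_insert_loop[OF e] by (simp add: cis_mult algebra_simps)
    qed
    finally show "(\<Sum>P\<in>pairings n d. if e \<in> P then ?F P else 0)
        = cis t * (\<Sum>Q\<in>perfect_matchings (prevertices n d - e). ?F Q)" by (simp add: sum_distrib_left)
  qed
  finally show ?thesis .
qed

lemma choose_two_real: "2 * real (d choose 2) = real d * (real d - 1)"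
proof -
  have "even (d * (d - 1))" by (cases d) auto
  then have "2 * (d choose 2) = d * (d - 1)" unfolding choose_two by (rule dvd_mult_div_cancel)
  then have "real (2 * (d choose 2)) = real (d * (d - 1))" by simp
  then show ?thesis by (cases d) (auto simp: algebra_simps)
qed

lemma loop_mean_bounds:
  assumes "n \<ge> 1" "d \<ge> 2"
  shows "0 \<le> loop_mean n d" "loop_mean n d \<le> real d / 2"
proof -
  have nd: "1 * 2 \<le> real n * real d" using assms by (intro mult_mono) auto
  then show "0 \<le> loop_mean n d" unfolding loop_mean_def by (intro divide_nonneg_nonneg mult_nonneg_nonneg) auto
  have "real n * real (d choose 2) = real n * (real d * (real d - 1)) / 2" using choose_two_real[of d] by simp
  also have "\<dots> \<le> real d / 2 * (real n * real d - 1)"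
  proof -
    have "1 * real d \<le> real n * real d" using assms by (intro mult_right_mono) auto
    then have "real n * (real d * (real d - 1)) \<le> real d * (real n * real d - 1)" by (simp add: algebra_simps)
    then show ?thesis by simp
  qed
  finally show "loop_mean n d \<le> real d / 2" unfolding loop_mean_def using nd by (simp add: pos_divide_le_eq)
qed

text \<open>
  Approximate Stein equation: the loop count biased by its size is close to the loop count plus
  one, as for a Poisson variable.
\<close>

lemma loop_char_deriv_approx:
  assumes r: "n * d = 2 * r" and n: "n \<ge> 2" and d: "d \<ge> 3"
  shows "norm (loop_char_deriv n d t - \<i> * of_real (loop_mean n d) * cis t * loop_char n d t)
    \<le> loop_mean n d * (\<bar>t\<bar> * (8 / real n))"
proof -
  let ?M = "\<lambda>e. perfect_matchings (prevertices n d - e)"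
  let ?F = "\<lambda>P. cis (t * real (loop_count n d P))"
  let ?S = "\<Sum>P\<in>pairings n d. ?F P"
  let ?c = "real n * real (d choose 2)"
  have nd6: "2 * 3 \<le> n * d" using n d by (intro mult_le_mono) auto
  then have r3: "r \<ge> 3" using r by simp
  have rr: "real (2 * r - 1) = real n * real d - 1"
  proof -
    have "real n * real d = 2 * real r" using r by (metis of_nat_mult of_nat_numeral)
    then show ?thesis using r3 by (simp add: of_nat_diff)
  qed
  \<comment> \<open>The number of possible partners of one prevertex. Fixing a pair divides the
    number of pairings by R, fixing a second one by R - 2.\<close>
  define R where "R = real (2 * r - 1)"
  have R: "R > 0" using r3 by (simp add: R_def)
  have o1: "real (odd_fact r) = R * real (odd_fact (r - 1))"
  proof -
    have "Suc (r - 1) = r" using r3 by simp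
    then have "odd_fact r = (2 * (r - 1) + 1) * odd_fact (r - 1)" using odd_fact_Suc[of "r - 1"] by simp
    moreover have "real (2 * (r - 1) + 1) = R" using r3 by (simp add: R_def of_nat_diff)
    ultimately show ?thesis by (metis of_nat_mult)
  qed
  have o2: "real (odd_fact (r - 1)) = (R - 2) * real (odd_fact (r - 2))"
  proof -
    have "Suc (r - 2) = r - 1" using r3 by simp
    then have "odd_fact (r - 1) = (2 * (r - 2) + 1) * odd_fact (r - 2)" using odd_fact_Suc[of "r - 2"] by simp
    moreover have "real (2 * (r - 2) + 1) = R - 2" using r3 by (simp add: R_def of_nat_diff)
    ultimately show ?thesis by (metis of_nat_mult)
  qed
  let ?q = "real (odd_fact r)"
  have card: "card (pairings n d) = odd_fact r" by (rule card_pairings[OF r])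
  have q0: "?q > 0" by simp
  have lm: "loop_mean n d = ?c / R" unfolding loop_mean_def R_def rr ..
  have "loop_char_deriv n d t - \<i> * of_real (loop_mean n d) * cis t * loop_char n d t
      = (\<Sum>e\<in>loops n d. \<i> * cis t * (of_real R * (\<Sum>Q\<in>?M e. ?F Q) - ?S)) / of_real (R * ?q)"
  proof -
    have "(\<Sum>e\<in>loops n d. \<i> * cis t * (of_real R * (\<Sum>Q\<in>?M e. ?F Q) - ?S))
        = \<i> * of_real R * (\<Sum>e\<in>loops n d. cis t * (\<Sum>Q\<in>?M e. ?F Q)) - \<i> * cis t * of_real ?c * ?S"
      by (simp add: right_diff_distrib sum_subtractf sum_distrib_left card_loops mult_ac)
    also have "(\<Sum>e\<in>loops n d. cis t * (\<Sum>Q\<in>?M e. ?F Q))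
        = (\<Sum>P\<in>pairings n d. of_nat (loop_count n d P) * ?F P)"
      by (rule sum_loop_count_cis[OF r, symmetric])
    finally show ?thesis
      unfolding loop_char_deriv_def loop_char_def card lm
      using R q0 by (simp add: field_simps)
  qed
  also have "norm \<dots> \<le> (\<Sum>e\<in>loops n d. \<bar>t\<bar> * (2 * (?c * real (odd_fact (r - 2))) + 2 * real d * real (odd_fact (r - 1)))) / (R * ?q)"
    unfolding norm_divide
  proof (intro frac_le sum_norm_le)
    fix e assume e: "e \<in> loops n d"
    have "norm (\<i> * cis t * (of_real R * (\<Sum>Q\<in>?M e. ?F Q) - ?S)) = norm (?S - of_nat (2 * r - 1) * (\<Sum>Q\<in>?M e. ?F Q))"
      by (simp add: norm_mult R_def norm_minus_commute)
    also have "\<dots> \<le> \<bar>t\<bar> * (2 * (?c * real (odd_fact (r - 2))) + 2 * real d * real (odd_fact (r - 1)))"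
      by (rule switch_average[OF r e]) (use r3 in simp)
    finally show "norm (\<i> * cis t * (of_real R * (\<Sum>Q\<in>?M e. ?F Q) - ?S))
        \<le> \<bar>t\<bar> * (2 * (?c * real (odd_fact (r - 2))) + 2 * real d * real (odd_fact (r - 1)))" .
  qed (use R q0 in \<open>auto intro!: sum_nonneg mult_nonneg_nonneg add_nonneg_nonneg simp: norm_mult\<close>)
  also have "\<dots> = ?c / R * (\<bar>t\<bar> * ((2 * (?c * real (odd_fact (r - 2))) + 2 * real d * real (odd_fact (r - 1))) / ?q))"
    by (simp add: card_loops)
  also have "\<dots> \<le> ?c / R * (\<bar>t\<bar> * (8 / real n))"
  proof (intro mult_left_mono)
    have R5: "R \<ge> 5" using r3 by (simp add: R_def of_nat_diff)
    have Rn: "R = real n * real d - 1" using rr by (simp add: R_def)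
    have c: "?c \<le> real d * (R - 2)"
    proof -
      have "2 * ?c = real n * (real d * (real d - 1))" using choose_two_real[of d] by simp
      also have "\<dots> \<le> real d * (2 * (R - 2))"
      proof -
        have "2 * 3 \<le> real n * real d" using n d by (intro mult_mono) auto
        then have "real n * (real d - 1) \<le> 2 * (R - 2)" using n by (simp add: Rn algebra_simps)
        then have "real d * (real n * (real d - 1)) \<le> real d * (2 * (R - 2))" by (intro mult_left_mono) auto
        then show ?thesis by (simp add: mult_ac)
      qed
      finally have "2 * ?c \<le> 2 * (real d * (R - 2))" by (metis mult.left_commute)
      then show ?thesis by (rule mult_left_le_imp_le) simp
    qed
    have "2 * (?c * real (odd_fact (r - 2))) \<le> 2 * (real d * (R - 2) * real (odd_fact (r - 2)))"
      using c by (intro mult_left_mono mult_right_mono) auto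
    also have "\<dots> = 2 * real d * real (odd_fact (r - 1))" unfolding o2 by simp
    finally have "2 * (?c * real (odd_fact (r - 2))) + 2 * real d * real (odd_fact (r - 1)) \<le> 4 * real d * real (odd_fact (r - 1))"
      by simp
    then have "(2 * (?c * real (odd_fact (r - 2))) + 2 * real d * real (odd_fact (r - 1))) / ?q
        \<le> 4 * real d * real (odd_fact (r - 1)) / ?q" by (intro divide_right_mono) auto
    also have "\<dots> = 4 * real d / R" unfolding o1 using R by simp
    also have "\<dots> \<le> 4 * real d / (real n * real d / 2)"
    proof (intro divide_left_mono)
      have "2 * 3 \<le> real n * real d" using n d by (intro mult_mono) auto
      then show "real n * real d / 2 \<le> R" unfolding Rn by linarith
    qed (use R n d in auto)
    also have "\<dots> = 8 / real n" using n d by (simp add: field_simps)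
    finally show "(2 * (?c * real (odd_fact (r - 2))) + 2 * real d * real (odd_fact (r - 1))) / ?q \<le> 8 / real n" .
  qed (use R in auto)
  finally show ?thesis by (simp add: lm)
qed

text \<open>Multiplication by the reciprocal of the Poisson characteristic function turns the
  approximate Stein equation into a bound on a derivative, which is integrated from 0 to t. The
  error is of order 1 / n as long as l t^2 stays bounded, and this is the range of the normal
  limit.\<close>

lemma loop_char_poisson:
  assumes r: "n * d = 2 * r" and n: "n \<ge> 2" and d: "d \<ge> 3"
  defines "l \<equiv> loop_mean n d"
  shows "norm (loop_char n d t - exp (of_real l * (cis t - 1))) \<le> l * t\<^sup>2 * (8 / real n) * exp (l * t\<^sup>2 / 2)"
proof -
  have l0: "l \<ge> 0" unfolding l_def by (rule loop_mean_bounds) (use n d in auto)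
  let ?g = "\<lambda>z::complex. exp (- (of_real l * (exp (\<i> * z) - 1)))"
  let ?N = "of_nat (card (pairings n d)) :: complex"
  \<comment> \<open>Extended to complex arguments so that the mean value inequality
    \<open>field_differentiable_bound\<close> applies on the segment from 0 to t.\<close>
  define ph where "ph z = (\<Sum>P\<in>pairings n d. exp (\<i> * z * of_nat (loop_count n d P))) / ?N" for z
  define ph' where "ph' z = (\<Sum>P\<in>pairings n d. exp (\<i> * z * of_nat (loop_count n d P)) * (\<i> * of_nat (loop_count n d P))) / ?N" for z
  have ph: "ph (of_real s) = loop_char n d s" for s
    by (simp add: ph_def loop_char_def cis_conv_exp mult.assoc)
  have ph': "ph' (of_real s) = loop_char_deriv n d s" for s
    by (simp add: ph'_def loop_char_deriv_def cis_conv_exp mult_ac sum_distrib_left)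
  have D1: "(ph has_field_derivative ph' z) (at z within S)" for z S
    unfolding ph_def[abs_def] ph'_def
    by (rule DERIV_cdivide) (auto intro!: derivative_eq_intros sum.cong simp: mult_ac)
  have D2: "(?g has_field_derivative - (of_real l * (\<i> * exp (\<i> * z))) * ?g z) (at z within S)" for z S
    by (auto intro!: derivative_eq_intros simp: mult_ac)
  have D: "((\<lambda>z. ph z * ?g z) has_field_derivative (ph' z - \<i> * of_real l * exp (\<i> * z) * ph z) * ?g z) (at z within S)" for z S
    by (rule DERIV_cong[OF DERIV_mult[OF D1 D2]]) (simp add: algebra_simps)
  let ?S = "closed_segment 0 (of_real t :: complex)"
  let ?B = "l * \<bar>t\<bar> * (8 / real n) * exp (l * t\<^sup>2 / 2)"
  have g: "norm (?g (of_real s)) \<le> exp (l * t\<^sup>2 / 2)" if "\<bar>s\<bar> \<le> \<bar>t\<bar>" for s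
  proof -
    have "norm (?g (of_real s)) = exp (l * (1 - cos s))"
      by (simp add: norm_exp_eq_Re cis_conv_exp[symmetric] algebra_simps)
    also have "\<dots> \<le> exp (l * (t\<^sup>2 / 2))"
    proof -
      have "cos s = 1 - 2 * (sin (s / 2))\<^sup>2" using cos_double_sin[of "s / 2"] by simp
      then have "1 - cos s = 2 * (sin (s / 2))\<^sup>2" by simp
      also have "\<dots> \<le> 2 * (s / 2)\<^sup>2"
        using abs_sin_x_le_abs_x[of "s / 2"] by (intro mult_left_mono) (simp_all only: abs_le_square_iff zero_le_numeral)
      also have "\<dots> \<le> t\<^sup>2 / 2" using that by (simp add: power_divide abs_le_square_iff)
      finally have "l * (1 - cos s) \<le> l * (t\<^sup>2 / 2)" using l0 by (rule mult_left_mono)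
      then show ?thesis by (simp only: exp_le_cancel_iff)
    qed
    finally show ?thesis by simp
  qed
  have "norm (ph (of_real t) * ?g (of_real t) - ph 0 * ?g 0) \<le> ?B * norm (of_real t - (0::complex))"
  proof (rule field_differentiable_bound[OF convex_closed_segment D])
    fix z assume "z \<in> ?S"
    then obtain u where u: "0 \<le> u" "u \<le> 1" "z = of_real (u * t)"
      by (auto simp: in_segment scaleR_conv_of_real)
    have s: "\<bar>u * t\<bar> \<le> \<bar>t\<bar>" using u by (simp add: abs_mult mult_left_le_one_le)
    have "norm (ph' z - \<i> * of_real l * exp (\<i> * z) * ph z) \<le> l * (\<bar>u * t\<bar> * (8 / real n))"
      unfolding u(3) ph ph' using loop_char_deriv_approx[OF r n d, of "u * t"]
      by (simp add: l_def cis_conv_exp)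
    also have "\<dots> \<le> l * (\<bar>t\<bar> * (8 / real n))" using s l0 by (intro mult_left_mono mult_right_mono) auto
    finally have "norm (ph' z - \<i> * of_real l * exp (\<i> * z) * ph z) * norm (?g z)
        \<le> l * (\<bar>t\<bar> * (8 / real n)) * exp (l * t\<^sup>2 / 2)"
      using g[OF s] u(3) l0 by (intro mult_mono) auto
    then show "norm ((ph' z - \<i> * of_real l * exp (\<i> * z) * ph z) * ?g z) \<le> ?B"
      by (simp add: norm_mult mult.assoc)
  qed auto
  moreover have "card (pairings n d) \<noteq> 0" using card_pairings[OF r] odd_fact_pos[of r] by (metis less_irrefl)
  then have "?N \<noteq> 0" by (simp only: of_nat_eq_0_iff not_False_eq_True)
  then have "?N / ?N = 1" by (rule divide_self)
  then have "ph 0 * ?g 0 = 1" by (simp add: ph_def)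
  ultimately have 1: "norm (loop_char n d t * ?g (of_real t) - 1) \<le> ?B * \<bar>t\<bar>" unfolding ph by simp
  let ?h = "exp (of_real l * (cis t - 1)) :: complex"
  have gh: "?g (of_real t) * ?h = 1"
    by (simp add: cis_conv_exp flip: exp_add)
  have h1: "norm ?h \<le> 1"
  proof -
    have "norm ?h = exp (l * (cos t - 1))" by (simp add: norm_exp_eq_Re algebra_simps)
    also have "\<dots> \<le> 1" using l0 by (simp add: mult_nonneg_nonpos)
    finally show ?thesis .
  qed
  have "loop_char n d t - ?h = (loop_char n d t * ?g (of_real t) - 1) * ?h"
    using gh by (simp add: algebra_simps)
  then have "norm (loop_char n d t - ?h) = norm (loop_char n d t * ?g (of_real t) - 1) * norm ?h"
    by (simp add: norm_mult)
  also have "\<dots> \<le> (?B * \<bar>t\<bar>) * 1" using 1 h1 l0 by (intro mult_mono) auto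
  also have "\<dots> = l * t\<^sup>2 * (8 / real n) * exp (l * t\<^sup>2 / 2)"
    by (simp add: power2_eq_square abs_mult[symmetric] mult_ac)
  finally show ?thesis .
qed

section \<open>The residual after subtracting the loop contribution\<close>

definition pairing_mean :: "nat \<Rightarrow> nat \<Rightarrow> (prevertex set set \<Rightarrow> real) \<Rightarrow> real" where
  "pairing_mean n d f = (\<Sum>P\<in>pairings n d. f P) / real (card (pairings n d))"

definition round_mean :: "nat \<Rightarrow> nat \<Rightarrow> real" where
  "round_mean n d = pairing_mean n d (\<lambda>P. real (round_count n d P))"

lemma expectation_pairing_mean:
  "even (n * d) \<Longrightarrow> measure_pmf.expectation (config_model n d) f = pairing_mean n d f"
  unfolding pairing_mean_def by (rule expectation_config_model)

lemma round_mean_eq: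
  assumes r: "n * d = 2 * r" and d: "d \<ge> 1"
  shows "round_mean n d = fact n * (real d * (real d - 1)) ^ n * real (odd_fact (r - n)) / real (odd_fact r)"
proof -
  have "(\<Sum>P\<in>pairings n d. real (round_count n d P)) = real (\<Sum>P\<in>pairings n d. round_count n d P)" by simp
  also have "\<dots> = fact n * (real d * (real d - 1)) ^ n * real (odd_fact (r - n))"
    unfolding sum_round_count[OF r] using d by (simp add: of_nat_diff)
  finally show ?thesis by (simp add: round_mean_def pairing_mean_def card_pairings[OF r])
qed

lemma loop_mean_eq:
  assumes r: "n * d = 2 * r" and r1: "r \<ge> 1"
  shows "pairing_mean n d (\<lambda>P. real (loop_count n d P)) = loop_mean n d"
proof -
  have o: "odd_fact r = (2 * (r - 1) + 1) * odd_fact (r - 1)"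
    using odd_fact_Suc[of "r - 1"] r1 by simp
  have R: "real (2 * (r - 1) + 1) = real n * real d - 1"
  proof -
    have "real n * real d = 2 * real r" using r by (metis of_nat_mult of_nat_numeral)
    then show ?thesis using r1 by (simp add: of_nat_diff)
  qed
  have "(\<Sum>P\<in>pairings n d. real (loop_count n d P)) = real (\<Sum>P\<in>pairings n d. loop_count n d P)" by simp
  also have "\<dots> = real n * real (d choose 2) * real (odd_fact (r - 1))" unfolding sum_loop_count[OF r] by simp
  finally show ?thesis
    unfolding pairing_mean_def card_pairings[OF r] loop_mean_def o of_nat_mult R by simp
qed

lemma loop_mean_sq_le:
  assumes r: "n * d = 2 * r" and n: "n \<ge> 2" and d: "d \<ge> 3"
  shows "pairing_mean n d (\<lambda>P. (real (loop_count n d P))\<^sup>2) - (loop_mean n d)\<^sup>2 \<le> real d / 2 + real d / real n"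
proof -
  let ?l = "loop_mean n d"
  define R where "R = real n * real d - 1"
  have nd6: "2 * 3 \<le> n * d" using n d by (intro mult_le_mono) auto
  then have r3: "r \<ge> 3" using r by simp
  have nr: "real n * real d = 2 * real r" using r by (metis of_nat_mult of_nat_numeral)
  have R5: "R \<ge> 5" using nr r3 by (simp add: R_def)
  have o1: "real (odd_fact r) = R * real (odd_fact (r - 1))"
  proof -
    have "odd_fact r = (2 * (r - 1) + 1) * odd_fact (r - 1)" using odd_fact_Suc[of "r - 1"] r3 by simp
    moreover have "real (2 * (r - 1) + 1) = R" using r3 nr by (simp add: R_def of_nat_diff)
    ultimately show ?thesis by (metis of_nat_mult)
  qed
  have o2: "real (odd_fact (r - 1)) = (R - 2) * real (odd_fact (r - 2))"
  proof -
    have "Suc (r - 2) = r - 1" using r3 by simp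
    then have "odd_fact (r - 1) = (2 * (r - 2) + 1) * odd_fact (r - 2)" using odd_fact_Suc[of "r - 2"] by simp
    moreover have "real (2 * (r - 2) + 1) = R - 2" using r3 nr by (simp add: R_def of_nat_diff)
    ultimately show ?thesis by (metis of_nat_mult)
  qed
  let ?c = "real n * real (d choose 2)"
  have l: "?l = ?c / R" by (simp add: loop_mean_def R_def)
  have l0: "0 \<le> ?l" "?l \<le> real d / 2" using loop_mean_bounds[of n d] n d by auto
  have "(\<Sum>P\<in>pairings n d. (real (loop_count n d P))\<^sup>2) = real (\<Sum>P\<in>pairings n d. (loop_count n d P)\<^sup>2)" by simp
  also have "\<dots> \<le> real (n * (d choose 2) * odd_fact (r - 1) + (n * (d choose 2))\<^sup>2 * odd_fact (r - 2))"
    by (rule of_nat_mono[OF sum_loop_count_sq[OF r]])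
  also have "\<dots> = ?c * real (odd_fact (r - 1)) + ?c\<^sup>2 * real (odd_fact (r - 2))" by simp
  finally have "pairing_mean n d (\<lambda>P. (real (loop_count n d P))\<^sup>2)
      \<le> (?c * real (odd_fact (r - 1)) + ?c\<^sup>2 * real (odd_fact (r - 2))) / real (odd_fact r)"
    unfolding pairing_mean_def card_pairings[OF r] by (intro divide_right_mono) auto
  also have "\<dots> = ?l + ?l\<^sup>2 * (R / (R - 2))"
  proof -
    have "(c * ((R - 2) * q) + c\<^sup>2 * q) / (R * ((R - 2) * q)) = c / R + (c / R)\<^sup>2 * (R / (R - 2))"
      if "q > 0" for c q :: real
    proof -
      have "R - 2 > 0" "R > 0" using R5 by auto
      then show ?thesis using that by (simp add: field_simps power2_eq_square)
    qed
    then show ?thesis unfolding l o1 o2 by simp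
  qed
  finally have "pairing_mean n d (\<lambda>P. (real (loop_count n d P))\<^sup>2) - ?l\<^sup>2 \<le> ?l + ?l\<^sup>2 * (R / (R - 2) - 1)"
    by (simp add: algebra_simps)
  also have "?l\<^sup>2 * (R / (R - 2) - 1) \<le> (real d / 2)\<^sup>2 * (4 / (real n * real d))"
  proof (intro mult_mono power_mono)
    have "R / (R - 2) - 1 = 2 / (R - 2)" using R5 by (simp add: field_simps)
    also have "\<dots> \<le> 2 / (real n * real d / 2)"
    proof (intro divide_left_mono)
      show "real n * real d / 2 \<le> R - 2" using R5 unfolding R_def by linarith
    qed (use R5 n d in auto)
    finally show "R / (R - 2) - 1 \<le> 4 / (real n * real d)" by simp
    show "0 \<le> R / (R - 2) - 1" using R5 by (simp add: field_simps)
  qed (use l0 in auto)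
  also have "(real d / 2)\<^sup>2 * (4 / (real n * real d)) = real d / real n"
    using n d by (simp add: field_simps power2_eq_square)
  finally show ?thesis using l0 by linarith
qed

text \<open>Weighted by the round count the mean number of loops is at most (d - 3) / 2 + 1 / n,
  while the plain mean is at least (d - 1) / 2.\<close>

lemma round_loop_mean_le:
  assumes r: "n * d = 2 * r" and n: "n \<ge> 2" and d: "d \<ge> 4"
  shows "pairing_mean n d (\<lambda>P. real (round_count n d P) * real (loop_count n d P)) / round_mean n d - loop_mean n d
    \<le> - 1 + 1 / real n"
proof -
  let ?q = "real (odd_fact r)" and ?X = "fact n * (real d * (real d - 1)) ^ n :: real"
  have nr: "real n * real d = 2 * real r" using r by (metis of_nat_mult of_nat_numeral)
  have d1: "d \<ge> 1" using d by simp
  have "n * 4 \<le> n * d" using d by (intro mult_le_mono2) simp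
  then have rn: "r \<ge> 2 * n" using r by simp
  define S where "S = real n * (real d - 2) - 1"
  have nd2: "2 * 2 \<le> real n * (real d - 2)" using n d by (intro mult_mono) auto
  have S: "S > 0" using nd2 by (simp add: S_def)
  have o: "real (odd_fact (r - n)) = S * real (odd_fact (r - (n + 1)))"
  proof -
    have "Suc (r - (n + 1)) = r - n" using rn n by simp
    then have "odd_fact (r - n) = (2 * (r - (n + 1)) + 1) * odd_fact (r - (n + 1))"
      using odd_fact_Suc[of "r - (n + 1)"] by simp
    moreover have "real (2 * (r - (n + 1)) + 1) = S"
      using rn n nr by (simp add: S_def of_nat_diff algebra_simps)
    ultimately show ?thesis by (metis of_nat_mult)
  qed
  let ?c = "real n * real ((d - 2) choose 2)"
  have "(\<Sum>P\<in>pairings n d. real (round_count n d P) * real (loop_count n d P))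
      = real (\<Sum>P\<in>pairings n d. round_count n d P * loop_count n d P)" by simp
  also have "\<dots> \<le> real (fact n * (d * (d - 1)) ^ n * (n * ((d - 2) choose 2)) * odd_fact (r - (n + 1)))"
    by (rule of_nat_mono[OF sum_round_loop_count[OF r n]])
  also have "\<dots> = ?X * ?c * real (odd_fact (r - (n + 1)))" using d by (simp add: of_nat_diff)
  finally have "pairing_mean n d (\<lambda>P. real (round_count n d P) * real (loop_count n d P))
      \<le> ?X * ?c * real (odd_fact (r - (n + 1))) / ?q"
    unfolding pairing_mean_def card_pairings[OF r] by (intro divide_right_mono) auto
  moreover have m: "round_mean n d = ?X * (S * real (odd_fact (r - (n + 1)))) / ?q"
    unfolding round_mean_eq[OF r d1] o ..
  moreover have X0: "?X > 0" using d by (intro mult_pos_pos zero_less_power) auto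
  then have m0: "round_mean n d > 0" unfolding m
    by (rule divide_pos_pos[OF mult_pos_pos[OF _ mult_pos_pos[OF S]]]) simp_all
  ultimately have "pairing_mean n d (\<lambda>P. real (round_count n d P) * real (loop_count n d P)) / round_mean n d
      \<le> (?X * ?c * real (odd_fact (r - (n + 1))) / ?q) / round_mean n d"
    by (intro divide_right_mono) auto
  also have "\<dots> = ?c / S"
  proof -
    have gen: "(X * c * p / q) / (X * (S * p) / q) = c / S" if "X > 0" "p > 0" "q > 0" for X c p q :: real
      using that S by (simp add: field_simps)
    show ?thesis unfolding m by (rule gen[OF X0]) simp_all
  qed
  also have "\<dots> \<le> (real d - 3) / 2 + 1 / real n"
  proof -
    have "2 * real ((d - 2) choose 2) = (real d - 2) * (real d - 3)"
      using choose_two_real[of "d - 2"] d by (simp add: of_nat_diff)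
    then have "?c = (S + 1) * (real d - 3) / 2" by (simp add: S_def)
    then have "?c / S = (real d - 3) / 2 + (real d - 3) / (2 * S)" using S by (simp add: field_simps)
    also have "(real d - 3) / (2 * S) \<le> 1 / real n"
    proof -
      have "real n * (real d - 3) \<le> 2 * S" using nd2 by (simp add: S_def algebra_simps)
      then show ?thesis using S n by (simp add: field_simps)
    qed
    finally show ?thesis by simp
  qed
  finally have 1: "pairing_mean n d (\<lambda>P. real (round_count n d P) * real (loop_count n d P)) / round_mean n d
      \<le> (real d - 3) / 2 + 1 / real n" .
  have "loop_mean n d \<ge> (real d - 1) / 2"
  proof -
    have "2 * 4 \<le> real n * real d" using n d by (intro mult_mono) auto
    moreover have "(real d - 1) / 2 * (real n * real d - 1) \<le> real n * real (d choose 2)"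
    proof -
      have "2 * (real n * real (d choose 2)) = real n * (real d * (real d - 1))"
        using choose_two_real[of d] by (metis mult.left_commute)
      moreover have "(real d - 1) * (real n * real d - 1) \<le> real n * (real d * (real d - 1))"
        using d by (simp add: algebra_simps)
      ultimately have "(real d - 1) * (real n * real d - 1) / 2 \<le> real n * real (d choose 2)" by linarith
      then show ?thesis by simp
    qed
    ultimately show ?thesis unfolding loop_mean_def by (simp add: pos_le_divide_eq)
  qed
  then show ?thesis using 1 by (simp add: field_simps)
qed

text \<open>What remains of the centred ratio H / E H after subtraction of its linear prediction
  from the loops. The regression coefficient - 2 / d is the limiting covariance -1 divided by the
  asymptotic variance d / 2.\<close>

definition residual :: "nat \<Rightarrow> nat \<Rightarrow> prevertex set set \<Rightarrow> real" where
  "residual n d P = real (round_count n d P) / round_mean n d - 1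
     + 2 / real d * (real (loop_count n d P) - loop_mean n d)"

text \<open>After multiplication by d / 2 the square contributes the relative variance times d / 2,
  then -2 from the covariance and 1 from the variance of the loops, up to 4 / n. A relative variance
  of (2 + o(1)) / d therefore leaves o(1).\<close>

lemma residual_mean_sq:
  assumes r: "n * d = 2 * r" and n: "n \<ge> 2" and d: "d \<ge> 7"
  shows "real d / 2 * pairing_mean n d (\<lambda>P. (residual n d P)\<^sup>2)
    \<le> real d / 2 * (pairing_mean n d (\<lambda>P. (real (round_count n d P))\<^sup>2) / (round_mean n d)\<^sup>2 - 1) - 1 + 4 / real n"
proof -
  let ?E = "pairing_mean n d" and ?m = "round_mean n d" and ?l = "loop_mean n d" and ?c = "2 / real d"
  let ?p = "\<lambda>P. real (round_count n d P)" and ?L = "\<lambda>P. real (loop_count n d P)"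
  have N: "real (card (pairings n d)) > 0" using card_pairings[OF r] by simp
  have lin: "?E (\<lambda>P. f P + g P) = ?E f + ?E g" "?E (\<lambda>P. a * f P) = a * ?E f" "?E (\<lambda>P. a) = a" for f g a
    using N by (simp_all add: pairing_mean_def sum.distrib add_divide_distrib flip: sum_distrib_left)
  have "n * 7 \<le> n * d" using d by (intro mult_le_mono2) simp
  then have r1: "r \<ge> 1" using r n by simp
  have d1: "d \<ge> 1" using d by simp
  have "2 ^ n \<le> ?m"
    unfolding round_mean_eq[OF r d1]
    by (rule first_moment_lower[OF r]) (use n d in auto)
  then have m: "?m > 0" using zero_less_power[of "2 :: real" n] by linarith
  have "(residual n d P)\<^sup>2 = (1 / ?m\<^sup>2) * (?p P)\<^sup>2 + ((2 * ?c / ?m) * (?p P * ?L P) + (?c\<^sup>2 * (?L P)\<^sup>2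
      + ((- 2 * (1 + ?c * ?l) / ?m) * ?p P + ((- 2 * ?c * (1 + ?c * ?l)) * ?L P + (1 + ?c * ?l)\<^sup>2))))" for P
  proof -
    have "(p * y - 1 + c * (L - l))\<^sup>2 = y\<^sup>2 * p\<^sup>2 + ((2 * c * y) * (p * L) + (c\<^sup>2 * L\<^sup>2
        + ((- 2 * (1 + c * l) * y) * p + ((- 2 * c * (1 + c * l)) * L + (1 + c * l)\<^sup>2))))" for p y c L l :: real
      by (simp add: power2_eq_square algebra_simps)
    from this[of "?p P" "1 / ?m" ?c "?L P" ?l] show ?thesis
      unfolding residual_def by (simp only: power_one_over times_divide_eq_right mult_1_right)
  qed
  then have "?E (\<lambda>P. (residual n d P)\<^sup>2) = (1 / ?m\<^sup>2) * ?E (\<lambda>P. (?p P)\<^sup>2) + ((2 * ?c / ?m) * ?E (\<lambda>P. ?p P * ?L P)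
      + (?c\<^sup>2 * ?E (\<lambda>P. (?L P)\<^sup>2) + ((- 2 * (1 + ?c * ?l) / ?m) * ?E ?p
      + ((- 2 * ?c * (1 + ?c * ?l)) * ?E ?L + (1 + ?c * ?l)\<^sup>2))))"
    by (simp only: lin)
  also have "?E ?p = ?m" by (simp add: round_mean_def)
  also have "?E ?L = ?l" by (rule loop_mean_eq[OF r r1])
  finally have "?E (\<lambda>P. (residual n d P)\<^sup>2) = (?E (\<lambda>P. (?p P)\<^sup>2) / ?m\<^sup>2 - 1)
      + 2 * ?c * (?E (\<lambda>P. ?p P * ?L P) / ?m - ?l) + ?c\<^sup>2 * (?E (\<lambda>P. (?L P)\<^sup>2) - ?l\<^sup>2)"
  proof -
    have gen: "(1 / m\<^sup>2) * A + ((2 * c / m) * B + (c\<^sup>2 * F + ((- 2 * (1 + c * l) / m) * m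
        + ((- 2 * c * (1 + c * l)) * l + (1 + c * l)\<^sup>2))))
      = (A / m\<^sup>2 - 1) + 2 * c * (B / m - l) + c\<^sup>2 * (F - l\<^sup>2)" if "m > 0" for m c l A B F :: real
      using that by (simp add: power2_eq_square algebra_simps diff_divide_distrib add_divide_distrib)
    assume "?E (\<lambda>P. (residual n d P)\<^sup>2) = (1 / ?m\<^sup>2) * ?E (\<lambda>P. (?p P)\<^sup>2) + ((2 * ?c / ?m) * ?E (\<lambda>P. ?p P * ?L P)
      + (?c\<^sup>2 * ?E (\<lambda>P. (?L P)\<^sup>2) + ((- 2 * (1 + ?c * ?l) / ?m) * ?m
      + ((- 2 * ?c * (1 + ?c * ?l)) * ?l + (1 + ?c * ?l)\<^sup>2))))"
    then show ?thesis unfolding gen[OF m] .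
  qed
  also have "\<dots> \<le> (?E (\<lambda>P. (?p P)\<^sup>2) / ?m\<^sup>2 - 1) + 2 * ?c * (- 1 + 1 / real n) + ?c\<^sup>2 * (real d / 2 + real d / real n)"
    using round_loop_mean_le[OF r n] loop_mean_sq_le[OF r n] d by (intro add_mono mult_left_mono order_refl) auto
  finally have "real d / 2 * ?E (\<lambda>P. (residual n d P)\<^sup>2) \<le> real d / 2 * ((?E (\<lambda>P. (?p P)\<^sup>2) / ?m\<^sup>2 - 1)
      + 2 * ?c * (- 1 + 1 / real n) + ?c\<^sup>2 * (real d / 2 + real d / real n))"
    by (intro mult_left_mono) auto
  also have "\<dots> = real d / 2 * (?E (\<lambda>P. (?p P)\<^sup>2) / ?m\<^sup>2 - 1) + 2 * (- 1 + 1 / real n) + (1 + 2 / real n)"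
  proof -
    have gen: "x / 2 * (y + 2 * (2 / x) * z + (2 / x)\<^sup>2 * (x / 2 + x / w)) = x / 2 * y + 2 * z + (1 + 2 / w)"
      if "x > 0" "w > 0" for x y z w :: real
      using that by (simp add: field_simps power2_eq_square)
    show ?thesis by (rule gen) (use d n in auto)
  qed
  finally show ?thesis by (simp add: algebra_simps)
qed

text \<open>The bound d \<ge> 160 / \<eta>^2 makes 5 / d at most half of \<eta>^2 / 16. The bound d
  \<ge> 1000 makes 11 / d at most 3 / 160, which is half of the rate 3 / 80 at which (17 / 20)^(n /
  4) surely decays.\<close>

lemma tail_terms_le:
  assumes n: "n \<ge> 1" and d: "real d \<ge> 1000" "real d \<ge> 160 / \<eta>\<^sup>2" and \<eta>: "\<eta> > 0"
  shows "8 * exp (5 * real n / real d - real n * \<eta>\<^sup>2 / 16)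
      + 2 * exp (11 * real n / real d) * (5 / 8) ^ (n div 4)
      + 2 * exp (5 * real n / real d) * (17 / 20) ^ (n div 4)
    \<le> 8 * exp (- (\<eta>\<^sup>2 / 32 * real n)) + 8 * exp (- (real n * (3 / 160)))"
proof -
  let ?k = "n div 4" and ?D = "real d"
  have "5 / ?D \<le> \<eta>\<^sup>2 / 32"
  proof -
    have "160 \<le> ?D * \<eta>\<^sup>2" using d(2) \<eta> by (simp add: field_simps)
    then show ?thesis using d by (simp add: field_simps)
  qed
  then have "5 / ?D * real n \<le> \<eta>\<^sup>2 / 32 * real n" by (intro mult_right_mono) auto
  moreover have "5 * real n / ?D = 5 / ?D * real n" "real n * \<eta>\<^sup>2 / 16 = 2 * (\<eta>\<^sup>2 / 32 * real n)" by simp_all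
  ultimately have "5 * real n / ?D - real n * \<eta>\<^sup>2 / 16 \<le> - (\<eta>\<^sup>2 / 32 * real n)" by linarith
  then have 1: "exp (5 * real n / ?D - real n * \<eta>\<^sup>2 / 16) \<le> exp (- (\<eta>\<^sup>2 / 32 * real n))"
    by (simp only: exp_le_cancel_iff)
  have "(5 / 8 :: real) ^ ?k \<le> (17 / 20) ^ ?k" by (intro power_mono) auto
  moreover have "(17 / 20 :: real) ^ ?k \<le> exp (- (3 / 20)) ^ ?k"
    using exp_ge_add_one_self[of "- (3 / 20) :: real"] by (intro power_mono) auto
  moreover have "exp (- (3 / 20)) ^ ?k \<le> 2 * exp (- (real n * (3 / 80)))"
  proof -
    have "real n / 4 - 1 \<le> real ?k" by linarith
    then have "exp (- (3 / 20)) ^ ?k \<le> exp (1 / 2 + - (real n * (3 / 80)))"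
      by (simp flip: exp_of_nat_mult)
    also have "\<dots> \<le> 2 * exp (- (real n * (3 / 80)))"
    proof -
      have "1 / 2 \<le> exp (- (1 / 2) :: real)" using exp_ge_add_one_self[of "- (1 / 2) :: real"] by simp
      then have "exp (1 / 2 :: real) \<le> 2" by (simp add: exp_minus field_simps)
      then show ?thesis unfolding exp_add by (intro mult_right_mono) auto
    qed
    finally show ?thesis .
  qed
  ultimately have k: "(5 / 8 :: real) ^ ?k \<le> 2 * exp (- (real n * (3 / 80)))"
      "(17 / 20 :: real) ^ ?k \<le> 2 * exp (- (real n * (3 / 80)))" by linarith+
  have e: "exp (11 * real n / ?D) \<le> exp (real n * (3 / 160))" "exp (5 * real n / ?D) \<le> exp (real n * (3 / 160))"
  proof -
    have "11 / ?D \<le> 3 / 160" "5 / ?D \<le> 3 / 160" using d by (auto simp: field_simps)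
    then have "real n * (11 / ?D) \<le> real n * (3 / 160)" "real n * (5 / ?D) \<le> real n * (3 / 160)"
      by (intro mult_left_mono; simp)+
    then show "exp (11 * real n / ?D) \<le> exp (real n * (3 / 160))" "exp (5 * real n / ?D) \<le> exp (real n * (3 / 160))"
      by (simp_all add: mult.commute)
  qed
  have p: "exp (real n * (3 / 160)) * (2 * exp (- (real n * (3 / 80)))) = 2 * exp (- (real n * (3 / 160)))"
    by (simp flip: exp_add)
  have 2: "exp (11 * real n / ?D) * (5 / 8) ^ ?k \<le> 2 * exp (- (real n * (3 / 160)))"
    unfolding p[symmetric] using e(1) k(1) by (intro mult_mono) auto
  have 3: "exp (5 * real n / ?D) * (17 / 20) ^ ?k \<le> 2 * exp (- (real n * (3 / 160)))"
    unfolding p[symmetric] using e(2) k(2) by (intro mult_mono) auto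
  show ?thesis using 1 2 3 by (simp only: mult.assoc)
qed

lemma tail_const_nonneg: "0 \<le> tail_const"
  unfolding tail_const_def using summable_tail_const by (intro mult_nonneg_nonneg suminf_nonneg) auto

lemma residual_nonneg: "0 \<le> pairing_mean n d (\<lambda>P. (residual n d P)\<^sup>2)"
  unfolding pairing_mean_def by (intro divide_nonneg_nonneg sum_nonneg) auto

text \<open>The margin \<eta> is fixed before n grows: it leaves an upper bound with limit 4 \<eta>,
  which is below \<epsilon>. The exponentially small errors are multiplied by d / 2, and
  \<open>d n \<le> n\<close> replaces this by a factor n / 2 that they still beat.\<close>

lemma residual_vanishes:
  fixes d :: "nat \<Rightarrow> nat"
  assumes ev: "\<And>n. even (n * d n)" and lim: "filterlim d at_top sequentially"
    and le: "eventually (\<lambda>n. d n \<le> n) sequentially"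
  shows "(\<lambda>n. real (d n) / 2 * pairing_mean n (d n) (\<lambda>P. (residual n (d n) P)\<^sup>2)) \<longlonglongrightarrow> 0"
proof (rule LIMSEQ_I)
  fix \<epsilon> :: real assume \<epsilon>: "0 < \<epsilon>"
  define \<eta> where "\<eta> = min (1 / 4) (\<epsilon> / 16)"
  have \<eta>: "0 < \<eta>" "\<eta> \<le> 1 / 4" "4 * \<eta> < \<epsilon>" using \<epsilon> by (auto simp: \<eta>_def min_def)
  define c where "c = \<eta>\<^sup>2 / 32"
  have c: "c > 0" using \<eta> by (simp add: c_def)
  let ?h = "\<lambda>n. (1 / 2 :: real) ^ n"
  let ?w = "\<lambda>n. real n / 2 * (?h n * (2 * real n + (real n)\<^sup>2 + 1) + (8 * exp (- (c * real n)) + 8 * exp (- (real n * (3 / 160)))))"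
  let ?up = "\<lambda>n. (1 + ?h n) * ((1 + 4 * \<eta>) * (1 + 2 / real (d n)) + 8 * tail_const / real (d n)) + ?w n - 1 + 4 / real n"
  have rlim: "filterlim (\<lambda>n. real (d n)) at_top sequentially"
    by (rule filterlim_compose[OF filterlim_real_sequentially lim])
  have inv: "(\<lambda>n. a / real (d n)) \<longlonglongrightarrow> 0" for a :: real
    by (rule tendsto_divide_0[OF tendsto_const]) (rule filterlim_at_top_imp_at_infinity[OF rlim])
  have h0: "?h \<longlonglongrightarrow> 0" by (intro LIMSEQ_power_zero) simp
  have w0: "?w \<longlonglongrightarrow> 0"
  proof -
    have "((\<lambda>x::real. x * exp (- x)) \<longlongrightarrow> 0) at_top" by real_asymp
    moreover have "filterlim (\<lambda>n. c * real n) at_top sequentially"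
      by (rule filterlim_tendsto_pos_mult_at_top[OF tendsto_const c filterlim_real_sequentially])
    ultimately have "(\<lambda>n. c * real n * exp (- (c * real n))) \<longlonglongrightarrow> 0"
      by (rule filterlim_compose)
    then have "(\<lambda>n. 4 / c * (c * real n * exp (- (c * real n)))) \<longlonglongrightarrow> 4 / c * 0"
      by (intro tendsto_intros)
    moreover have "(\<lambda>n. real n / 2 * (?h n * (2 * real n + (real n)\<^sup>2 + 1)) + 4 * real n * exp (- (real n * (3 / 160)))) \<longlonglongrightarrow> 0 + 0"
      by (rule tendsto_add; real_asymp)
    ultimately have "(\<lambda>n. 4 / c * (c * real n * exp (- (c * real n)))
        + (real n / 2 * (?h n * (2 * real n + (real n)\<^sup>2 + 1)) + 4 * real n * exp (- (real n * (3 / 160))))) \<longlonglongrightarrow> 4 / c * 0 + (0 + 0)"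
      by (rule tendsto_add)
    moreover have "4 / c * (c * real n * exp (- (c * real n)))
        + (real n / 2 * (?h n * (2 * real n + (real n)\<^sup>2 + 1)) + 4 * real n * exp (- (real n * (3 / 160)))) = ?w n" for n
      using c by (simp add: algebra_simps)
    ultimately show ?thesis by (simp only: mult_zero_right add_0_right)
  qed
  have n0: "(\<lambda>n. 4 / real n) \<longlonglongrightarrow> 0" by real_asymp
  have "?up \<longlonglongrightarrow> (1 + 0) * ((1 + 4 * \<eta>) * (1 + 0) + 0) + 0 - 1 + 0"
    by (intro tendsto_intros h0 w0 n0 inv)
  then have "?up \<longlonglongrightarrow> 4 * \<eta>" by simp
  then have up: "eventually (\<lambda>n. ?up n < \<epsilon>) sequentially" using \<eta>(3) by (rule order_tendstoD)
  have big: "eventually (\<lambda>n. real (d n) \<ge> B) sequentially" for B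
    using rlim unfolding filterlim_at_top by blast
  have "eventually (\<lambda>n. real (d n) / 2 * pairing_mean n (d n) (\<lambda>P. (residual n (d n) P)\<^sup>2) \<le> ?up n) sequentially"
    using big[of 50000] big[of "2 / \<eta>"] big[of "160 / \<eta>\<^sup>2"] le eventually_ge_at_top[of 8]
  proof eventually_elim
    case (elim n)
    let ?D = "real (d n)"
    define r where "r = n * d n div 2"
    have r: "n * d n = 2 * r" using ev[of n] by (simp add: r_def)
    have D: "d n \<ge> 50000" using elim(1) by linarith
    have d1: "d n \<ge> 1" "d n \<ge> 7" using D by simp_all
    define K where "K = 2 / ?D * (1 + 4 * \<eta>)"
    let ?R = "pairing_mean n (d n) (\<lambda>P. (real (round_count n (d n) P))\<^sup>2) / (round_mean n (d n))\<^sup>2"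
    let ?t = "8 * exp (5 * real n / ?D - real n * \<eta>\<^sup>2 / 16)
      + 2 * exp (11 * real n / ?D) * (5 / 8) ^ (n div 4)
      + 2 * exp (5 * real n / ?D) * (17 / 20) ^ (n div 4)"
    have R: "?R \<le> 2 * real n * ?h n + (real n)\<^sup>2 * ?h n
        + (1 + ?h n) * (1 + K * (1 + 2 / ?D) + K\<^sup>2 * tail_const) + ?t"
      using second_moment_bound[OF r elim(5) D \<eta>(1,2) elim(2)]
      unfolding pairing_mean_def card_pairings[OF r] round_mean_eq[OF r d1(1)] K_def by (simp add: add.assoc)
    have t: "?t \<le> 8 * exp (- (c * real n)) + 8 * exp (- (real n * (3 / 160)))"
      unfolding c_def by (rule tail_terms_le) (use elim \<eta> in auto)
    let ?t' = "8 * exp (- (c * real n)) + 8 * exp (- (real n * (3 / 160)))"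
    have "?R - 1 \<le> (?h n * (2 * real n + (real n)\<^sup>2 + 1) + ?t') + (1 + ?h n) * (K * (1 + 2 / ?D) + K\<^sup>2 * tail_const)"
      using R t by (simp add: algebra_simps)
    then have "?D / 2 * (?R - 1) \<le> ?D / 2 * ((?h n * (2 * real n + (real n)\<^sup>2 + 1) + ?t')
        + (1 + ?h n) * (K * (1 + 2 / ?D) + K\<^sup>2 * tail_const))"
      by (intro mult_left_mono) auto
    also have "\<dots> = ?D / 2 * (?h n * (2 * real n + (real n)\<^sup>2 + 1) + ?t')
        + (1 + ?h n) * (?D / 2 * K * (1 + 2 / ?D) + ?D / 2 * K\<^sup>2 * tail_const)"
    proof -
      have gen: "D / 2 * (X + (1 + h) * (k * a + q * C)) = D / 2 * X + (1 + h) * (D / 2 * k * a + D / 2 * q * C)"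
        for D X h k a q C :: real by (simp add: algebra_simps add_divide_distrib)
      show ?thesis by (rule gen)
    qed
    also have "?D / 2 * K = 1 + 4 * \<eta>" using D by (simp add: K_def)
    also have "?D / 2 * (?h n * (2 * real n + (real n)\<^sup>2 + 1) + ?t')
        + (1 + ?h n) * ((1 + 4 * \<eta>) * (1 + 2 / ?D) + ?D / 2 * K\<^sup>2 * tail_const)
      \<le> ?w n + (1 + ?h n) * ((1 + 4 * \<eta>) * (1 + 2 / ?D) + 8 / ?D * tail_const)"
    proof (intro add_mono mult_left_mono mult_right_mono order_refl)
      show "?D / 2 \<le> real n / 2" using elim(4) by simp
      have "?D / 2 * K\<^sup>2 = (1 + 4 * \<eta>) * K" unfolding power2_eq_square mult.assoc[symmetric]
        using \<open>?D / 2 * K = 1 + 4 * \<eta>\<close> by simp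
      also have "\<dots> \<le> 2 * (2 / ?D * 2)" unfolding K_def using \<eta> D by (intro mult_mono) auto
      finally show "?D / 2 * K\<^sup>2 \<le> 8 / ?D" by simp
    qed (use \<eta> in \<open>auto intro!: add_nonneg_nonneg mult_nonneg_nonneg tail_const_nonneg\<close>)
    finally have "?D / 2 * (?R - 1) \<le> ?w n + (1 + ?h n) * ((1 + 4 * \<eta>) * (1 + 2 / ?D) + 8 / ?D * tail_const)" .
    moreover have "real (d n) / 2 * pairing_mean n (d n) (\<lambda>P. (residual n (d n) P)\<^sup>2) \<le> ?D / 2 * (?R - 1) - 1 + 4 / real n"
      by (rule residual_mean_sq[OF r]) (use elim(5) d1 in auto)
    ultimately show ?case by simp
  qed
  with up have "eventually (\<lambda>n. real (d n) / 2 * pairing_mean n (d n) (\<lambda>P. (residual n (d n) P)\<^sup>2) < \<epsilon>) sequentially"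
    by eventually_elim linarith
  then obtain n0 where "\<And>n. n \<ge> n0 \<Longrightarrow> real (d n) / 2 * pairing_mean n (d n) (\<lambda>P. (residual n (d n) P)\<^sup>2) < \<epsilon>"
    unfolding eventually_sequentially by blast
  moreover have "0 \<le> real (d n) / 2 * pairing_mean n (d n) (\<lambda>P. (residual n (d n) P)\<^sup>2)" for n
    using residual_nonneg by (intro mult_nonneg_nonneg) auto
  ultimately show "\<exists>n0. \<forall>n\<ge>n0. norm (real (d n) / 2 * pairing_mean n (d n) (\<lambda>P. (residual n (d n) P)\<^sup>2) - 0) < \<epsilon>"
    by (intro exI[of _ n0]) simp
qed

text \<open>The minus sign is that of the covariance: more loops mean fewer Hamiltonian cycles. The
  scale sqrt (2 / d) is both the inverse of the asymptotic standard deviation of the loop count and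
  the normalisation of the logarithm.\<close>

definition loop_normalized :: "nat \<Rightarrow> nat \<Rightarrow> prevertex set set \<Rightarrow> real" where
  "loop_normalized n d P = - (real (loop_count n d P) - loop_mean n d) * sqrt (2 / real d)"

lemma char_loop_normalized:
  assumes "even (n * d)"
  defines "u \<equiv> \<lambda>t. - t * sqrt (2 / real d)"
  shows "char (distr (measure_pmf (config_model n d)) borel (loop_normalized n d)) t
    = cis (- (loop_mean n d * u t)) * loop_char n d (u t)"
proof -
  have "char (distr (measure_pmf (config_model n d)) borel (loop_normalized n d)) t
      = (CLINT P|measure_pmf (config_model n d). cis (t * loop_normalized n d P))"
    unfolding char_def by (subst integral_distr) (auto simp: cis_conv_exp)
  also have "\<dots> = (\<Sum>P\<in>pairings n d. pmf (config_model n d) P *\<^sub>R cis (t * loop_normalized n d P))"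
    by (rule integral_measure_pmf[OF finite_pairings])
      (simp add: config_model_def set_pmf_of_set[OF pairings_nonempty[OF assms(1)] finite_pairings])
  also have "\<dots> = (\<Sum>P\<in>pairings n d. cis (- (loop_mean n d * u t)) * cis (u t * real (loop_count n d P))
      / of_nat (card (pairings n d)))"
  proof (rule sum.cong[OF refl])
    fix P assume P: "P \<in> pairings n d"
    have "t * loop_normalized n d P = - (loop_mean n d * u t) + u t * real (loop_count n d P)"
      by (simp add: loop_normalized_def u_def algebra_simps)
    then show "pmf (config_model n d) P *\<^sub>R cis (t * loop_normalized n d P)
        = cis (- (loop_mean n d * u t)) * cis (u t * real (loop_count n d P)) / of_nat (card (pairings n d))"
      using P pmf_of_set[OF pairings_nonempty[OF assms(1)] finite_pairings]
      by (simp add: config_model_def scaleR_conv_of_real cis_mult)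
  qed
  also have "\<dots> = cis (- (loop_mean n d * u t)) * loop_char n d (u t)"
    by (simp add: loop_char_def sum_distrib_left sum_divide_distrib)
  finally show ?thesis .
qed

lemma loop_mean_over_degree:
  fixes d :: "nat \<Rightarrow> nat"
  assumes lim: "filterlim d at_top sequentially"
  shows "(\<lambda>n. loop_mean n (d n) / real (d n)) \<longlonglongrightarrow> 1 / 2"
proof (rule tendsto_sandwich[of "\<lambda>n. 1 / 2 - (1 / 2) / real (d n)" _ _ "\<lambda>n. 1 / 2"])
  have rlim: "filterlim (\<lambda>n. real (d n)) at_top sequentially"
    by (rule filterlim_compose[OF filterlim_real_sequentially lim])
  have big: "eventually (\<lambda>n. real (d n) \<ge> 2) sequentially" using rlim unfolding filterlim_at_top by blast
  show "eventually (\<lambda>n. loop_mean n (d n) / real (d n) \<le> 1 / 2) sequentially"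
    using big eventually_ge_at_top[of 1]
  proof eventually_elim
    case (elim n)
    then show ?case using loop_mean_bounds(2)[of n "d n"] by (simp add: field_simps)
  qed
  show "eventually (\<lambda>n. 1 / 2 - (1 / 2) / real (d n) \<le> loop_mean n (d n) / real (d n)) sequentially"
    using big eventually_ge_at_top[of 1]
  proof eventually_elim
    case (elim n)
    let ?D = "real (d n)" and ?N = "real n"
    have ND: "1 * 2 \<le> ?N * ?D" using elim by (intro mult_mono) auto
    have "(1 / 2 - (1 / 2) / ?D) * ?D = (?D - 1) / 2" using elim by (simp add: field_simps)
    also have "\<dots> \<le> loop_mean n (d n)"
    proof -
      have "2 * (?N * real (d n choose 2)) = ?N * (?D * (?D - 1))"
        using choose_two_real[of "d n"] by (metis mult.left_commute)
      moreover have "(?D - 1) * (?N * ?D - 1) \<le> ?N * (?D * (?D - 1))" using elim by (simp add: algebra_simps)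
      ultimately have "(?D - 1) * (?N * ?D - 1) / 2 \<le> ?N * real (d n choose 2)" by linarith
      then have "(?D - 1) / 2 * (?N * ?D - 1) \<le> ?N * real (d n choose 2)" by simp
      then show ?thesis unfolding loop_mean_def using ND by (simp add: pos_le_divide_eq)
    qed
    finally show ?case using elim by (simp add: pos_le_divide_eq)
  qed
  have "(\<lambda>n. (1 / 2) / real (d n)) \<longlonglongrightarrow> 0"
    by (rule tendsto_divide_0[OF tendsto_const]) (rule filterlim_at_top_imp_at_infinity[OF rlim])
  then have "(\<lambda>n. 1 / 2 - (1 / 2) / real (d n)) \<longlonglongrightarrow> 1 / 2 - 0" by (intro tendsto_intros)
  then show "(\<lambda>n. 1 / 2 - (1 / 2) / real (d n)) \<longlonglongrightarrow> 1 / 2" by simp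
qed simp

lemma std_normal_no_atoms: "measure std_normal_distribution {x} = 0"
proof -
  have "emeasure std_normal_distribution {x} = (\<integral>\<^sup>+y. ennreal (std_normal_density y) * indicator {x} y \<partial>lborel)"
    by (rule emeasure_density) auto
  also have "\<dots> = (\<integral>\<^sup>+(y::real). 0 \<partial>lborel)"
  proof (rule nn_integral_cong_AE)
    show "AE y in lborel. ennreal (std_normal_density y) * indicator {x} y = 0"
      using AE_lborel_singleton[of x] by eventually_elim simp
  qed
  finally show ?thesis by (simp add: measure_def)
qed

lemma isCont_cdf_std_normal: "isCont (cdf std_normal_distribution) x"
proof -
  interpret real_distribution std_normal_distribution by (rule real_dist_normal_dist)
  show ?thesis using std_normal_no_atoms by (simp only: isCont_cdf)
qed

text \<open>At u = - t sqrt (2 / d) the exponent of the centred Poisson characteristic function has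
  a quadratic term tending to - t^2 / 2, because the mean l is asymptotic to d / 2, and a cubic
  remainder that vanishes. Levy's continuity theorem then applies.\<close>

lemma loop_clt:
  fixes d :: "nat \<Rightarrow> nat"
  assumes ev: "\<And>n. even (n * d n)" and lim: "filterlim d at_top sequentially"
  shows "(\<lambda>n. measure (measure_pmf (config_model n (d n))) {P. loop_normalized n (d n) P \<le> y})
    \<longlonglongrightarrow> cdf std_normal_distribution y"
proof -
  let ?M = "\<lambda>n. distr (measure_pmf (config_model n (d n))) borel (loop_normalized n (d n))"
  have rlim: "filterlim (\<lambda>n. real (d n)) at_top sequentially"
    by (rule filterlim_compose[OF filterlim_real_sequentially lim])
  have s0: "(\<lambda>n. sqrt (2 / real (d n))) \<longlonglongrightarrow> 0"
  proof -
    have "(\<lambda>n. 2 / real (d n)) \<longlonglongrightarrow> 0"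
      by (rule tendsto_divide_0[OF tendsto_const]) (rule filterlim_at_top_imp_at_infinity[OF rlim])
    then show ?thesis using tendsto_real_sqrt by fastforce
  qed
  have "(\<lambda>n. char (?M n) t) \<longlonglongrightarrow> char std_normal_distribution t" for t
  proof -
    define u where "u n = - t * sqrt (2 / real (d n))" for n
    define l where "l n = loop_mean n (d n)" for n
    have u0: "u \<longlonglongrightarrow> 0"
    proof -
      have "(\<lambda>n. - t * sqrt (2 / real (d n))) \<longlonglongrightarrow> - t * 0" by (intro tendsto_intros s0)
      then show ?thesis by (simp add: u_def[abs_def])
    qed
    have ev3: "eventually (\<lambda>n. real (d n) \<ge> 3) sequentially" using rlim unfolding filterlim_at_top by blast
    have lu: "(\<lambda>n. l n * (u n)\<^sup>2 / 2) \<longlonglongrightarrow> t\<^sup>2 / 2"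
    proof -
      have "(\<lambda>n. loop_mean n (d n) / real (d n) * t\<^sup>2) \<longlonglongrightarrow> 1 / 2 * t\<^sup>2"
        by (intro tendsto_intros loop_mean_over_degree lim)
      moreover have "l n * (u n)\<^sup>2 / 2 = loop_mean n (d n) / real (d n) * t\<^sup>2" for n
        by (simp add: l_def u_def power_mult_distrib)
      ultimately show ?thesis by simp
    qed
    let ?e = "\<lambda>n. exp (of_real (l n) * (cis (u n) - 1 - \<i> * of_real (u n)))"
    have main: "?e \<longlonglongrightarrow> exp (of_real (- t\<^sup>2 / 2))"
    proof (rule tendsto_exp)
      have "(\<lambda>n. of_real (l n) * (cis (u n) - 1 - \<i> * of_real (u n)) - of_real (- (l n * (u n)\<^sup>2 / 2)) :: complex) \<longlonglongrightarrow> 0"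
      proof (rule Lim_null_comparison)
        show "eventually (\<lambda>n. norm (of_real (l n) * (cis (u n) - 1 - \<i> * of_real (u n)) - of_real (- (l n * (u n)\<^sup>2 / 2)) :: complex)
            \<le> l n * (u n)\<^sup>2 / 2 * \<bar>u n\<bar>) sequentially"
          using ev3 eventually_ge_at_top[of 1]
        proof eventually_elim
          case (elim n)
          have l0: "0 \<le> l n" unfolding l_def by (rule loop_mean_bounds) (use elim in auto)
          have a: "norm (iexp (u n) - (\<Sum>k\<le>2. (\<i> * of_real (u n)) ^ k / fact k)) \<le> \<bar>u n\<bar> ^ Suc 2 / fact (Suc 2)"
            by (rule iexp_approx1)
          have s: "(\<Sum>k\<le>2. (\<i> * of_real (u n)) ^ k / fact k) = 1 + \<i> * of_real (u n) - of_real ((u n)\<^sup>2 / 2)"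
            by (simp add: numeral_2_eq_2 power2_eq_square algebra_simps)
          have "of_real (l n) * (cis (u n) - 1 - \<i> * of_real (u n)) - of_real (- (l n * (u n)\<^sup>2 / 2))
              = of_real (l n) * (iexp (u n) - (1 + \<i> * of_real (u n) - of_real ((u n)\<^sup>2 / 2)))"
            by (simp add: cis_conv_exp algebra_simps)
          then have "norm (of_real (l n) * (cis (u n) - 1 - \<i> * of_real (u n)) - of_real (- (l n * (u n)\<^sup>2 / 2)) :: complex)
              = l n * norm (iexp (u n) - (1 + \<i> * of_real (u n) - of_real ((u n)\<^sup>2 / 2)))"
            using l0 by (simp add: norm_mult)
          also have "\<dots> \<le> l n * (\<bar>u n\<bar> ^ Suc 2 / fact (Suc 2))"
            using a l0 unfolding s by (intro mult_left_mono)
          also have "\<dots> \<le> l n * (\<bar>u n\<bar> ^ 3 / 2)"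
          proof (intro mult_left_mono l0 frac_le)
            show "\<bar>u n\<bar> ^ Suc 2 \<le> \<bar>u n\<bar> ^ 3" by (simp add: numeral_3_eq_3 numeral_2_eq_2)
            show "(2::real) \<le> fact (Suc 2)" by (simp add: fact_numeral)
          qed simp_all
          also have "\<dots> = l n * (u n)\<^sup>2 / 2 * \<bar>u n\<bar>" by (simp add: power3_eq_cube power2_eq_square)
          finally show ?case .
        qed
        have "(\<lambda>n. l n * (u n)\<^sup>2 / 2 * \<bar>u n\<bar>) \<longlonglongrightarrow> t\<^sup>2 / 2 * \<bar>0\<bar>" by (intro tendsto_intros lu u0)
        then show "(\<lambda>n. l n * (u n)\<^sup>2 / 2 * \<bar>u n\<bar>) \<longlonglongrightarrow> 0" by simp
      qed
      moreover have "(\<lambda>n. of_real (- (l n * (u n)\<^sup>2 / 2)) :: complex) \<longlonglongrightarrow> of_real (- (t\<^sup>2 / 2))"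
        by (intro tendsto_intros lu)
      ultimately have "(\<lambda>n. (of_real (l n) * (cis (u n) - 1 - \<i> * of_real (u n)) - of_real (- (l n * (u n)\<^sup>2 / 2)))
          + of_real (- (l n * (u n)\<^sup>2 / 2)) :: complex) \<longlonglongrightarrow> 0 + of_real (- (t\<^sup>2 / 2))"
        by (rule tendsto_add)
      then show "(\<lambda>n. of_real (l n) * (cis (u n) - 1 - \<i> * of_real (u n)) :: complex) \<longlonglongrightarrow> of_real (- t\<^sup>2 / 2)"
        by simp
    qed
    \<comment> \<open>Since l u^2 is at most t^2, the error of the Poisson approximation is of order
      1 / n for fixed t, although the mean diverges.\<close>
    have diff: "(\<lambda>n. char (?M n) t - ?e n) \<longlonglongrightarrow> 0"
    proof (rule Lim_null_comparison)
      show "eventually (\<lambda>n. norm (char (?M n) t - ?e n) \<le> t\<^sup>2 * (8 / real n) * exp (t\<^sup>2 / 2)) sequentially"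
        using ev3 eventually_ge_at_top[of 2]
      proof eventually_elim
        case (elim n)
        define r where "r = n * d n div 2"
        have r: "n * d n = 2 * r" using ev[of n] by (simp add: r_def)
        have lb: "0 \<le> l n" "l n \<le> real (d n) / 2" unfolding l_def using loop_mean_bounds[of n "d n"] elim by auto
        have lt: "l n * (u n)\<^sup>2 \<le> t\<^sup>2"
        proof -
          have "l n * (u n)\<^sup>2 \<le> real (d n) / 2 * (u n)\<^sup>2" using lb by (intro mult_right_mono) auto
          also have "\<dots> = t\<^sup>2" using elim by (simp add: u_def power_mult_distrib)
          finally show ?thesis .
        qed
        have ch: "char (?M n) t = cis (- (l n * u n)) * loop_char n (d n) (u n)"
          using char_loop_normalized[OF ev, of n t] by (simp add: u_def l_def)
        have e: "?e n = cis (- (l n * u n)) * exp (of_real (l n) * (cis (u n) - 1))"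
          unfolding cis_conv_exp exp_add[symmetric] by (simp add: algebra_simps)
        have "norm (char (?M n) t - ?e n) = norm (loop_char n (d n) (u n) - exp (of_real (l n) * (cis (u n) - 1)))"
          unfolding ch e right_diff_distrib[symmetric] norm_mult by simp
        also have "\<dots> \<le> l n * (u n)\<^sup>2 * (8 / real n) * exp (l n * (u n)\<^sup>2 / 2)"
          unfolding l_def by (rule loop_char_poisson[OF r]) (use elim in auto)
        also have "\<dots> \<le> t\<^sup>2 * (8 / real n) * exp (t\<^sup>2 / 2)"
          using lt lb by (intro mult_mono) auto
        finally show ?case .
      qed
      show "(\<lambda>n. t\<^sup>2 * (8 / real n) * exp (t\<^sup>2 / 2)) \<longlonglongrightarrow> 0" by real_asymp
    qed
    have "(\<lambda>n. (char (?M n) t - ?e n) + ?e n) \<longlonglongrightarrow> 0 + exp (of_real (- t\<^sup>2 / 2))"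
      by (rule tendsto_add[OF diff main])
    then show ?thesis
      by (simp only: diff_add_cancel add_0_left char_std_normal_distribution exp_of_real)
  qed
  then have "weak_conv_m ?M std_normal_distribution"
    by (intro levy_continuity) (auto intro!: prob_space.real_distribution_distr[OF prob_space_measure_pmf] real_dist_normal_dist)
  then have "(\<lambda>n. cdf (?M n) y) \<longlonglongrightarrow> cdf std_normal_distribution y"
    using isCont_cdf_std_normal unfolding weak_conv_m_def weak_conv_def by blast
  moreover have "cdf (?M n) y = measure (measure_pmf (config_model n (d n))) {P. loop_normalized n (d n) P \<le> y}" for n
    unfolding cdf_def by (subst measure_distr) (auto simp: vimage_def)
  ultimately show ?thesis by simp
qed

section \<open>The limit law\<close>

text \<open>The factor 2 n between cycles and rounds cancels in H / E H, so the estimates for rounds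
  hold for cycles as they stand.\<close>

lemma ham_count_ratio:
  assumes "even (n * d)" "n \<ge> 2" "d \<ge> 7"
  shows "expected_ham_count n d = round_mean n d / (2 * real n)" "round_mean n d > 0"
    "P \<in> pairings n d \<Longrightarrow> real (ham_count n P) = real (round_count n d P) / (2 * real n)"
proof -
  have h: "real (ham_count n P) = real (round_count n d P) / (2 * real n)" if "P \<in> pairings n d" for P
    using card_rounds_in_pairing[OF assms(2) that] assms(2) by (simp add: round_count_def)
  then show "P \<in> pairings n d \<Longrightarrow> real (ham_count n P) = real (round_count n d P) / (2 * real n)" .
  have "(\<Sum>P\<in>pairings n d. real (ham_count n P)) = (\<Sum>P\<in>pairings n d. real (round_count n d P)) / (2 * real n)"
    unfolding sum_divide_distrib by (rule sum.cong[OF refl h])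
  then show "expected_ham_count n d = round_mean n d / (2 * real n)"
    unfolding expected_ham_count_def expectation_pairing_mean[OF assms(1)] round_mean_def pairing_mean_def
    by simp
  define r where "r = n * d div 2"
  have r: "n * d = 2 * r" using assms(1) by (simp add: r_def)
  have d1: "d \<ge> 1" using assms(3) by simp
  have "2 ^ n \<le> round_mean n d"
    unfolding round_mean_eq[OF r d1] by (rule first_moment_lower[OF r]) (use assms in auto)
  then show "round_mean n d > 0" using zero_less_power[of "2 :: real" n] by linarith
qed

text \<open>
  The threshold is transported through the exponential function exactly, so that no expansion of
  the logarithm is needed and the event that there is no Hamiltonian cycle is covered as well.
\<close>

lemma normalized_log_le_iff:
  assumes "0 \<le> h" "0 < m" "0 < s"
  shows "(log_ereal h - log_ereal m) / ereal s \<le> ereal x \<longleftrightarrow> h / m \<le> exp (x * s)"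
proof (cases "h = 0")
  case True
  have "(- \<infinity> - ereal (ln m)) / ereal s = - \<infinity>" using assms(3) by (simp add: divide_ereal_def)
  then show ?thesis using True assms by (simp add: log_ereal_def)
next
  case False
  then have h: "h > 0" using assms by simp
  have "(log_ereal h - log_ereal m) / ereal s = ereal ((ln h - ln m) / s)"
    using h assms by (simp add: log_ereal_def)
  then have "(log_ereal h - log_ereal m) / ereal s \<le> ereal x \<longleftrightarrow> ln (h / m) \<le> x * s"
    using assms h by (simp add: ln_div pos_divide_le_eq)
  also have "\<dots> \<longleftrightarrow> h / m \<le> exp (x * s)"
    using h assms by (metis divide_pos_pos exp_le_cancel_iff exp_ln)
  finally show ?thesis .
qed

lemma chebyshev_pairings:
  assumes ev: "even (n * d)" and e: "0 < e" and s: "0 < s"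
  shows "measure (measure_pmf (config_model n d)) {P. e \<le> \<bar>residual n d P\<bar> / s}
    \<le> pairing_mean n d (\<lambda>P. (residual n d P)\<^sup>2) / s\<^sup>2 / e\<^sup>2"
proof -
  let ?N = "real (card (pairings n d))" and ?S = "{P. e \<le> \<bar>residual n d P\<bar> / s}"
  have ne: "pairings n d \<noteq> {}" "finite (pairings n d)"
    using pairings_nonempty[OF ev] finite_pairings by auto
  have N: "?N > 0" using ne by (simp add: card_gt_0_iff)
  have "measure (measure_pmf (config_model n d)) ?S = real (card (pairings n d \<inter> ?S)) / ?N"
    unfolding config_model_def by (rule measure_pmf_of_set[OF ne])
  also have "real (card (pairings n d \<inter> ?S)) = (\<Sum>P\<in>pairings n d. indicator ?S P)"
    using ne by (simp add: sum.If_cases indicator_def)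
  also have "\<dots> \<le> (\<Sum>P\<in>pairings n d. (residual n d P)\<^sup>2 / s\<^sup>2 / e\<^sup>2)"
  proof (rule sum_mono)
    fix P
    have "1 \<le> (residual n d P)\<^sup>2 / s\<^sup>2 / e\<^sup>2" if "e \<le> \<bar>residual n d P\<bar> / s"
    proof -
      have "e\<^sup>2 \<le> (\<bar>residual n d P\<bar> / s)\<^sup>2" using that e by (intro power_mono) auto
      then have "1 * e\<^sup>2 \<le> (residual n d P)\<^sup>2 / s\<^sup>2" by (simp add: power_divide)
      moreover have "0 < e\<^sup>2" using e by simp
      ultimately show ?thesis by (simp only: pos_le_divide_eq)
    qed
    then show "indicator ?S P \<le> (residual n d P)\<^sup>2 / s\<^sup>2 / e\<^sup>2" by (simp add: indicator_def)
  qed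
  finally have "measure (measure_pmf (config_model n d)) ?S
      \<le> (\<Sum>P\<in>pairings n d. (residual n d P)\<^sup>2 / s\<^sup>2 / e\<^sup>2) / ?N"
    using N by (simp add: divide_right_mono)
  then show ?thesis
    by (simp add: pairing_mean_def mult_ac flip: sum_divide_distrib)
qed

theorem theorem1p4:
  fixes d :: "nat \<Rightarrow> nat"
  assumes "\<And>n. even (n * d n)"
    and "filterlim d at_top sequentially"
    and "(\<lambda>n. ln (real (d n)) / ln (real n)) \<longlonglongrightarrow> 0"
  shows "weak_conv_ereal
    (\<lambda>n. distr (measure_pmf (config_model n (d n))) borel
      (\<lambda>P. (log_ereal (real (ham_count n P)) - log_ereal (expected_ham_count n (d n)))
             / ereal (sqrt (2 / real (d n)))))
    std_normal_distribution"
  unfolding weak_conv_ereal_def weak_conv_def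
proof (intro allI impI)
  fix x :: real
  let ?\<mu> = "\<lambda>n. measure_pmf (config_model n (d n))"
  let ?f = "\<lambda>n P. (log_ereal (real (ham_count n P)) - log_ereal (expected_ham_count n (d n)))
             / ereal (sqrt (2 / real (d n)))"
  let ?F = "cdf std_normal_distribution"
  let ?Q = "\<lambda>n. pairing_mean n (d n) (\<lambda>P. (residual n (d n) P)\<^sup>2)"
  define s where "s n = sqrt (2 / real (d n))" for n
  have rlim: "filterlim (\<lambda>n. real (d n)) at_top sequentially"
    by (rule filterlim_compose[OF filterlim_real_sequentially assms(2)])
  have big: "eventually (\<lambda>n. real (d n) \<ge> 7) sequentially"
    using rlim unfolding filterlim_at_top by blast
  \<comment> \<open>The form in which the growth hypothesis enters: ln d / ln n is eventually below
    1.\<close>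
  have le: "eventually (\<lambda>n. d n \<le> n) sequentially"
  proof -
    have "eventually (\<lambda>n. ln (real (d n)) / ln (real n) < 1) sequentially"
      by (rule order_tendstoD(2)[OF assms(3)]) simp
    then show ?thesis using big eventually_ge_at_top[of 2]
    proof eventually_elim
      case (elim n)
      then have "ln (real (d n)) < ln (real n)" by (simp add: pos_divide_less_eq)
      then show ?case using elim by simp
    qed
  qed
  have s0: "s \<longlonglongrightarrow> 0"
  proof -
    have "(\<lambda>n. 2 / real (d n)) \<longlonglongrightarrow> 0"
      by (rule tendsto_divide_0[OF tendsto_const]) (rule filterlim_at_top_imp_at_infinity[OF rlim])
    then have "(\<lambda>n. sqrt (2 / real (d n))) \<longlonglongrightarrow> sqrt 0" by (rule tendsto_real_sqrt)
    then show ?thesis by (simp add: s_def[abs_def])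
  qed
  \<comment> \<open>The threshold x for the normalised logarithm is the threshold \<open>y n\<close>
    for (H / E H - 1) / s; it tends to x, the derivative of exp (x t) at t = 0.\<close>
  define y where "y n = (exp (x * s n) - 1) / s n" for n
  have y: "y \<longlonglongrightarrow> x"
  proof -
    have "((\<lambda>t. (exp (x * t) - 1) / t) \<longlongrightarrow> x) (at 0)"
    proof -
      have "((\<lambda>t. exp (x * t)) has_real_derivative x) (at 0)"
        by (auto intro!: derivative_eq_intros)
      then show ?thesis by (simp add: has_field_derivative_iff)
    qed
    moreover have "filterlim s (at 0) sequentially"
      unfolding filterlim_at using s0 big by (auto elim!: eventually_mono simp: s_def)
    ultimately show ?thesis unfolding y_def[abs_def] by (rule filterlim_compose)
  qed
  have Q0: "(\<lambda>n. ?Q n / (s n)\<^sup>2 / e\<^sup>2) \<longlonglongrightarrow> 0" for e :: real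
  proof -
    have "(\<lambda>n. real (d n) / 2 * ?Q n * (1 / e\<^sup>2)) \<longlonglongrightarrow> 0 * (1 / e\<^sup>2)"
      by (intro tendsto_intros residual_vanishes assms le)
    moreover have "?Q n / (s n)\<^sup>2 / e\<^sup>2 = real (d n) / 2 * ?Q n * (1 / e\<^sup>2)" for n
      by (simp add: s_def)
    ultimately show ?thesis by simp
  qed
  \<comment> \<open>Outside the event that the residual is at least e s in modulus, the normalised
    count and the normalised loops differ by less than e; a second e pays for replacing
    \<open>y n\<close> by x.\<close>
  have sandwich: "eventually (\<lambda>n.
      measure (?\<mu> n) {P. loop_normalized n (d n) P \<le> x - 2 * e} - ?Q n / (s n)\<^sup>2 / e\<^sup>2
        \<le> measure (distr (?\<mu> n) borel (?f n)) {..ereal x} \<and>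
      measure (distr (?\<mu> n) borel (?f n)) {..ereal x}
        \<le> measure (?\<mu> n) {P. loop_normalized n (d n) P \<le> x + 2 * e} + ?Q n / (s n)\<^sup>2 / e\<^sup>2) sequentially"
    if e: "0 < e" for e
  proof -
    have "eventually (\<lambda>n. x - e < y n) sequentially" "eventually (\<lambda>n. y n < x + e) sequentially"
      using y e by (auto intro: order_tendstoD)
    then show ?thesis using big eventually_ge_at_top[of 2]
    proof eventually_elim
      case (elim n)
      let ?m = "round_mean n (d n)" and ?V = "loop_normalized n (d n)"
      let ?Y = "\<lambda>P. real (round_count n (d n) P) / ?m - 1"
      let ?B = "{P. e \<le> \<bar>residual n (d n) P\<bar> / s n}"
      have d7: "d n \<ge> 7" using elim(3) by simp
      have sn: "s n > 0" using d7 by (simp add: s_def)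
      note hr = ham_count_ratio[OF assms(1) elim(4) d7]
      have ss: "s n * s n = 2 / real (d n)" by (simp add: s_def)
      have res: "residual n (d n) P / s n = ?Y P / s n - ?V P" for P
      proof -
        have "residual n (d n) P = ?Y P + s n * s n * (real (loop_count n (d n) P) - loop_mean n (d n))"
          unfolding ss by (simp add: residual_def)
        moreover have "?V P = - (real (loop_count n (d n) P) - loop_mean n (d n)) * s n"
          by (simp add: loop_normalized_def s_def)
        moreover have "(a + s n * s n * b) / s n = a / s n - - b * s n" for a b
          using sn by (simp add: field_simps)
        ultimately show ?thesis by (simp only:)
      qed
      have "measure (distr (?\<mu> n) borel (?f n)) {..ereal x} = measure (?\<mu> n) {P. ?f n P \<le> ereal x}"
        by (subst measure_distr) (auto simp: vimage_def)
      also have "\<dots> = measure (?\<mu> n) {P. ?Y P / s n \<le> y n}"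
      proof (rule measure_pmf.finite_measure_eq_AE)
        show "AE P in ?\<mu> n. P \<in> {P. ?f n P \<le> ereal x} \<longleftrightarrow> P \<in> {P. ?Y P / s n \<le> y n}"
        proof (rule AE_pmfI)
          fix P assume "P \<in> set_pmf (config_model n (d n))"
          then have P: "P \<in> pairings n (d n)"
            using set_pmf_of_set[OF pairings_nonempty[OF assms(1)] finite_pairings] by (simp add: config_model_def)
          have m0: "expected_ham_count n (d n) > 0" using hr(1,2) elim(4) by simp
          have q: "real (ham_count n P) / expected_ham_count n (d n) = real (round_count n (d n) P) / ?m"
            unfolding hr(1) hr(3)[OF P] using elim(4) by simp
          have "?f n P \<le> ereal x \<longleftrightarrow> real (ham_count n P) / expected_ham_count n (d n) \<le> exp (x * s n)"
            unfolding s_def[symmetric] by (rule normalized_log_le_iff[OF _ m0 sn]) simp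
          also have "\<dots> \<longleftrightarrow> ?Y P / s n \<le> y n"
            unfolding q y_def using sn by (simp add: divide_le_cancel)
          finally show "P \<in> {P. ?f n P \<le> ereal x} \<longleftrightarrow> P \<in> {P. ?Y P / s n \<le> y n}" by simp
        qed
      qed auto
      finally have eq: "measure (distr (?\<mu> n) borel (?f n)) {..ereal x} = measure (?\<mu> n) {P. ?Y P / s n \<le> y n}" .
      have B: "measure (?\<mu> n) ?B \<le> ?Q n / (s n)\<^sup>2 / e\<^sup>2"
        by (rule chebyshev_pairings[OF assms(1) e sn])
      have cover: "measure (?\<mu> n) S \<le> measure (?\<mu> n) T + ?Q n / (s n)\<^sup>2 / e\<^sup>2" if "S \<subseteq> T \<union> ?B" for S T
      proof -
        have "measure (?\<mu> n) S \<le> measure (?\<mu> n) (T \<union> ?B)"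
          by (rule measure_pmf.finite_measure_mono[OF that]) simp
        also have "\<dots> \<le> measure (?\<mu> n) T + measure (?\<mu> n) ?B" by (rule measure_Un_le) simp_all
        finally show ?thesis using B by linarith
      qed
      have close: "\<bar>?Y P / s n - ?V P\<bar> < e" if "P \<notin> ?B" for P
        using that sn unfolding res[symmetric] by (simp add: not_le)
      have "{P. ?Y P / s n \<le> y n} \<subseteq> {P. ?V P \<le> x + 2 * e} \<union> ?B"
      proof
        fix P assume P: "P \<in> {P. ?Y P / s n \<le> y n}"
        show "P \<in> {P. ?V P \<le> x + 2 * e} \<union> ?B"
        proof (cases "P \<in> ?B")
          case False
          then have "\<bar>?Y P / s n - ?V P\<bar> < e" by (rule close)
          moreover have "?Y P / s n \<le> y n" using P by simp
          ultimately have "?V P \<le> x + 2 * e" using elim(2) by linarith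
          then show ?thesis by simp
        qed simp
      qed
      moreover have "{P. ?V P \<le> x - 2 * e} \<subseteq> {P. ?Y P / s n \<le> y n} \<union> ?B"
      proof
        fix P assume P: "P \<in> {P. ?V P \<le> x - 2 * e}"
        show "P \<in> {P. ?Y P / s n \<le> y n} \<union> ?B"
        proof (cases "P \<in> ?B")
          case False
          then have "\<bar>?Y P / s n - ?V P\<bar> < e" by (rule close)
          moreover have "?V P \<le> x - 2 * e" using P by simp
          ultimately have "?Y P / s n \<le> y n" using elim(1) by linarith
          then show ?thesis by simp
        qed simp
      qed
      ultimately show ?case unfolding eq using cover by (smt (verit))
    qed
  qed
  have clt: "(\<lambda>n. measure (?\<mu> n) {P. loop_normalized n (d n) P \<le> z}) \<longlonglongrightarrow> ?F z" for z
    by (rule loop_clt[OF assms(1,2)])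
  note cont = isCont_cdf_std_normal[of x]
  show "(\<lambda>n. measure (distr (?\<mu> n) borel (?f n)) {..ereal x}) \<longlonglongrightarrow> ?F x"
  proof (rule LIMSEQ_I)
    fix \<epsilon> :: real assume \<epsilon>: "0 < \<epsilon>"
    obtain \<delta> where \<delta>: "\<delta> > 0" "\<And>z. \<bar>z - x\<bar> < \<delta> \<Longrightarrow> \<bar>?F z - ?F x\<bar> < \<epsilon> / 3"
      using cont \<epsilon> unfolding continuous_at_eps_delta dist_real_def by (metis zero_less_divide_iff zero_less_numeral)
    define e where "e = \<delta> / 4"
    have e: "e > 0" using \<delta> by (simp add: e_def)
    have F: "\<bar>?F (x + 2 * e) - ?F x\<bar> < \<epsilon> / 3" "\<bar>?F (x - 2 * e) - ?F x\<bar> < \<epsilon> / 3"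
      using \<delta> by (auto simp: e_def)
    have "eventually (\<lambda>n. measure (?\<mu> n) {P. loop_normalized n (d n) P \<le> x + 2 * e} < ?F (x + 2 * e) + \<epsilon> / 3) sequentially"
      by (rule order_tendstoD(2)[OF clt]) (use \<epsilon> in simp)
    moreover have "eventually (\<lambda>n. measure (?\<mu> n) {P. loop_normalized n (d n) P \<le> x - 2 * e} > ?F (x - 2 * e) - \<epsilon> / 3) sequentially"
      by (rule order_tendstoD(1)[OF clt]) (use \<epsilon> in simp)
    moreover have "eventually (\<lambda>n. ?Q n / (s n)\<^sup>2 / e\<^sup>2 < \<epsilon> / 3) sequentially"
      by (rule order_tendstoD(2)[OF Q0]) (use \<epsilon> in simp)
    ultimately have "eventually (\<lambda>n. \<bar>measure (distr (?\<mu> n) borel (?f n)) {..ereal x} - ?F x\<bar> < \<epsilon>) sequentially"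
      using sandwich[OF e]
    proof eventually_elim
      case (elim n)
      then show ?case using F by linarith
    qed
    then show "\<exists>N. \<forall>n\<ge>N. norm (measure (distr (?\<mu> n) borel (?f n)) {..ereal x} - ?F x) < \<epsilon>"
      unfolding eventually_sequentially by simp
  qed
qed

end
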